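(* Let $\omega:\mathbb{R}^+\to\mathbb{R}^+$ be a function such that $\omega(t)/t$ is concave and $\sum_{n\ge1}\frac{1}{\omega(n)}=\infty$. Then there exists a trigonometric series $\sum_{n\in\mathbb{Z}}c(n)e^{int}$ with not all $c(n)$ zero, whose symmetric partial sums converge to $0$ for almost every $t\in\mathbb{T}$, and such that $c(n)=O\big(e^{-\omega(\log|n|)}\big)$ for $n<0$.
   Context: $\mathbb{T}=\mathbb{R}/2\pi\mathbb{Z}$; symmetric partial sums are $\sum_{|n|\le N}c(n)e^{int}$. *)

theory Defs
  imports "HOL-Analysis.Analysis"
begin

end

theory Submission
  imports Defs "HOL-Complex_Analysis.Complex_Analysis" "HOL-Real_Asymp.Real_Asymp"
begin

text \<open>
  The series is the limit of the Fourier coefficients of products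
  \<open>f\<^sub>k(t) = \<Prod>j<k. Q\<^sub>j(M\<^sub>j \<phi>(t))\<close> with \<open>\<phi>(t) = t + sin t / 100\<close>, where \<open>M\<^sub>j\<close> grows like
  \<open>M\<^bsub>j+1\<^esub> = M\<^sub>j\<^bsup>32\<^esup>\<close>. Put \<open>s\<^sub>j = ln M\<^sub>j\<close>. Each \<open>Q\<^sub>j\<close> is an outer function
  \<open>exp (l / (1 + d) - l / (1 + d - z))\<close>, which has mean \<open>1\<close>, is at most \<open>e\<^bsup>l\<^esup>\<close> and is as small as
  \<open>e\<^bsup>-W\<^esup>\<close> on an arc of length comparable to \<open>d = l / (2 (W + l))\<close>, multiplied by a smooth cutoff
  so that it vanishes identically on such an arc. With \<open>l = s\<^sub>j / 100\<close> and \<open>W = \<omega>(4 s\<^sub>j) + s\<^sub>j\<close> the arcs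
  have lengths comparable to \<open>s\<^sub>j / \<omega>(4 s\<^sub>j)\<close>, whose sum diverges by condensation, so almost every point
  is eventually in the open set on which all later products vanish.

  Multiplying by \<open>Q\<^sub>j(M\<^sub>j \<phi>)\<close> changes all coefficients by a summably small amount, because every coefficient of
  \<open>exp (i N \<phi>)\<close> is \<open>O(N\<^bsup>-1/3\<^esup>)\<close> by van der Corput; hence the limit coefficients exist and tend to zero.
  Coefficients of negative index change only by \<open>O(e\<^bsup>s/10 - W\<^esup>)\<close>, because outer functions have no such coefficients
  and only the cutoff produces them. Since the limit coefficients tend to zero, Riemann localization
  gives convergence to zero at every point near which the products vanish.
\<close>

text \<open>The bent phase resolves a conflict. With the plain phase t each factor would copy the
  earlier coefficients to multiples of \<open>M j\<close> with the coefficients of the factor, which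
  are not small, as multipliers, and the limit could not tend to zero. The sine term spreads each
  frequency N over a band, at the price of one-sidedness; as the phase is entire, what remains to
  the left of N / 2 is only exp (- N), and 1 / 100 makes exp 4 / 100 < 1 in that estimate. A cutoff
  that vanishes on an arc cannot have exponentially decaying coefficients, but the rate exp (-
  \<theta> sqrt |n|) is available and its inverse is submultiplicative; hence the weights. Concavity
  of \<omega> t / t enters through three consequences: \<omega> increases, and for t >= 1 one has
  \<omega> t >= \<omega> 1 * t and \<omega> t = O(t^2). The last one keeps the norms of the cutoffs
  polynomial in s, to be absorbed by exp (s / 10). The exponent 32 leaves room for exp (3 s) <= exp
  (32 s / 10) after each factor, and makes the earlier weight rate at least exp (- s / 32), so that
  exp (s / 2 - s / 32) beats W.\<close>

abbreviation asum :: "('a \<Rightarrow> complex) \<Rightarrow> bool" where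
  "asum f \<equiv> (\<lambda>x. norm (f x)) summable_on UNIV"

section \<open>Weighted absolutely convergent Fourier series\<close>

text \<open>Bounding every finite sum states weighted summability and the norm bound at once, so
  estimates reduce to finite sums.\<close>

definition wbound :: "('a \<Rightarrow> real) \<Rightarrow> real \<Rightarrow> ('a \<Rightarrow> complex) \<Rightarrow> bool" where
  "wbound v K c \<longleftrightarrow> (\<forall>A. finite A \<longrightarrow> (\<Sum>n\<in>A. norm (c n) * v n) \<le> K)"

definition fser :: "(int \<Rightarrow> complex) \<Rightarrow> real \<Rightarrow> complex" where
  "fser c t = (\<Sum>\<^sub>\<infinity>n. c n * cis (of_int n * t))"

text \<open>Weights of this kind make the weighted summable sequences a Banach algebra under
  convolution; \<open>1 \<le> v n\<close> keeps them absolutely summable.\<close>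

definition submult :: "(int \<Rightarrow> real) \<Rightarrow> bool" where
  "submult v \<longleftrightarrow> (\<forall>n. 1 \<le> v n) \<and> (\<forall>m n. v (m + n) \<le> v m * v n)"

lemma wboundD: "wbound v K c \<Longrightarrow> finite A \<Longrightarrow> (\<Sum>n\<in>A. norm (c n) * v n) \<le> K"
  by (simp add: wbound_def)

lemma wbound_nonneg: "wbound v K c \<Longrightarrow> 0 \<le> K"
  using wboundD[of v K c "{}"] by simp

lemma wbound_term: "wbound v K c \<Longrightarrow> norm (c n) * v n \<le> K"
  using wboundD[of v K c "{n}"] by simp

lemma wbound_mono:
  assumes "wbound v K c" "\<And>n. u n \<le> v n" "K \<le> L"
  shows "wbound u L c"
  unfolding wbound_def
proof (intro allI impI)
  fix A :: "'a set" assume A: "finite A"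
  have "(\<Sum>n\<in>A. norm (c n) * u n) \<le> (\<Sum>n\<in>A. norm (c n) * v n)"
    by (intro sum_mono mult_left_mono assms) auto
  also have "\<dots> \<le> K" using wboundD[OF assms(1) A] .
  finally show "(\<Sum>n\<in>A. norm (c n) * u n) \<le> L" using assms(3) by linarith
qed

lemma wbound_weight_summable:
  assumes "wbound v K c" "\<And>n. 0 \<le> v n"
  shows "(\<lambda>n. norm (c n) * v n) summable_on UNIV"
  by (rule nonneg_bdd_above_summable_on)
     (use assms in \<open>auto simp: wbound_def intro!: bdd_aboveI[of _ K]\<close>)

lemma wbound_weight_infsum:
  assumes "wbound v K c" "\<And>n. 0 \<le> v n"
  shows "(\<Sum>\<^sub>\<infinity>n. norm (c n) * v n) \<le> K"
  by (rule infsum_le_finite_sums[OF wbound_weight_summable[OF assms]]) (use assms in \<open>auto simp: wbound_def\<close>)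

lemma wbound_one:
  assumes "wbound v K c" "\<And>n. 1 \<le> v n"
  shows "wbound (\<lambda>_. 1) K c"
  by (rule wbound_mono[OF assms(1)]) (use assms in auto)

lemma wbound_abs_summable:
  assumes "wbound v K c" "\<And>n. 1 \<le> v n"
  shows "(\<lambda>n. norm (c n)) summable_on UNIV"
  using wbound_weight_summable[OF wbound_one[OF assms]] by simp

lemma wbound_infsum_norm:
  assumes "wbound v K c" "\<And>n. 1 \<le> v n"
  shows "(\<Sum>\<^sub>\<infinity>n. norm (c n)) \<le> K"
  using wbound_weight_infsum[OF wbound_one[OF assms]] by simp

lemma norm_infsum_le_bound:
  fixes f :: "'a \<Rightarrow> complex"
  assumes "g summable_on UNIV" "\<And>x. norm (f x) \<le> g x"
  shows "norm (\<Sum>\<^sub>\<infinity>x. f x) \<le> (\<Sum>\<^sub>\<infinity>x. g x)"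
proof -
  have *: "asum f"
    by (rule Infinite_Sum.abs_summable_on_comparison_test'[OF assms(1)]) (use assms in auto)
  have "norm (\<Sum>\<^sub>\<infinity>x. f x) \<le> (\<Sum>\<^sub>\<infinity>x. norm (f x))" by (rule norm_infsum_bound[OF *])
  also have "\<dots> \<le> (\<Sum>\<^sub>\<infinity>x. g x)" by (rule infsum_mono[OF * assms(1)]) (use assms in auto)
  finally show ?thesis .
qed

lemma has_sum_finite_sum:
  fixes f :: "'a \<Rightarrow> 'b \<Rightarrow> 'c :: {comm_monoid_add, topological_comm_monoid_add}"
  assumes "finite A" "\<And>n. n \<in> A \<Longrightarrow> (f n has_sum s n) B"
  shows "((\<lambda>a. \<Sum>n\<in>A. f n a) has_sum (\<Sum>n\<in>A. s n)) B"
  using assms by (induction rule: finite_induct) (simp_all add: has_sum_add)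

lemma wbound_mult_bounded:
  assumes "wbound v K c" "\<And>n. 1 \<le> v n" "\<And>n. norm (y n) \<le> B"
  shows "asum (\<lambda>n. c n * y n)" "norm (\<Sum>\<^sub>\<infinity>n. c n * y n) \<le> K * B"
proof -
  have B: "0 \<le> B" using assms(3)[of undefined] norm_ge_zero[of "y undefined"] by linarith
  have s: "(\<lambda>n. norm (c n) * B) summable_on UNIV"
    by (rule summable_on_cmult_left[OF wbound_abs_summable[OF assms(1,2)]])
  have le: "norm (c n * y n) \<le> norm (c n) * B" for n
    by (simp add: norm_mult mult_left_mono assms)
  show "asum (\<lambda>n. c n * y n)"
    by (rule Infinite_Sum.abs_summable_on_comparison_test'[OF s]) (use le in auto)
  have "norm (\<Sum>\<^sub>\<infinity>n. c n * y n) \<le> (\<Sum>\<^sub>\<infinity>n. norm (c n) * B)"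
    by (rule norm_infsum_le_bound[OF s le])
  also have "\<dots> = (\<Sum>\<^sub>\<infinity>n. norm (c n)) * B"
    by (rule infsum_cmult_left) (use wbound_abs_summable[OF assms(1,2)] in auto)
  also have "\<dots> \<le> K * B" using wbound_infsum_norm[OF assms(1,2)] B by (intro mult_right_mono)
  finally show "norm (\<Sum>\<^sub>\<infinity>n. c n * y n) \<le> K * B" .
qed

lemma fser_abs_summable:
  assumes "wbound v K c" "\<And>n. 1 \<le> v n"
  shows "asum (\<lambda>n. c n * cis (of_int n * t))"
  using wbound_mult_bounded(1)[OF assms, of "\<lambda>n. cis (of_int n * t)" 1] by simp

lemma fser_uniform_limit:
  assumes "wbound v K c" "\<And>n. 1 \<le> v n"
  shows "uniform_limit X (\<lambda>A t. \<Sum>n\<in>A. c n * cis (of_int n * t)) (fser c) (finite_subsets_at_top UNIV)"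
  unfolding fser_def
  by (rule Weierstrass_m_test_general[where M="\<lambda>n. norm (c n)"])
     (use wbound_abs_summable[OF assms] in \<open>auto simp: norm_mult\<close>)

lemma continuous_on_fser:
  assumes "wbound v K c" "\<And>n. 1 \<le> v n"
  shows "continuous_on X (fser c)"
  by (rule uniform_limit_theorem[OF _ fser_uniform_limit[OF assms]])
     (auto intro!: always_eventually continuous_intros)

lemma has_integral_cis_period:
  "((\<lambda>t. cis (of_int n * t)) has_integral (if n = 0 then of_real (2 * pi) else 0)) {-pi..pi}"
proof (cases "n = 0")
  case True
  have "((\<lambda>t::real. 1::complex) has_integral (measure lborel {-pi..pi} *\<^sub>R 1)) {-pi..pi}"
    using has_integral_const_real by blast
  then show ?thesis using True by (simp add: scaleR_conv_of_real)
next
  case False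
  have d: "((\<lambda>t. cis (of_int n * t) / (\<i> * of_int n)) has_vector_derivative cis (of_int n * t)) (at t within {-pi..pi})" for t
  proof -
    have "((\<lambda>t. exp (\<i> * of_int n * of_real t) / (\<i> * of_int n)) has_vector_derivative exp (\<i> * of_int n * of_real t)) (at t within {-pi..pi})"
      by (rule has_vector_derivative_real_field) (use False in \<open>auto intro!: derivative_eq_intros simp: field_simps\<close>)
    then show ?thesis by (simp add: cis_conv_exp mult_ac)
  qed
  have e: "cis (of_int n * pi) = cis (of_int n * (- pi))"
  proof -
    have "cis (of_int n * pi) = cis (of_int n * (-pi) + of_int n * (2*pi))" by (simp add: algebra_simps)
    also have "\<dots> = cis (of_int n * (-pi)) * cis (of_int n * (2*pi))" by (simp add: cis_mult)
    also have "cis (of_int n * (2*pi)) = 1" using cis_multiple_2pi[of "of_int n"] by (simp add: mult_ac)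
    finally show ?thesis by simp
  qed
  have "((\<lambda>t. cis (of_int n * t)) has_integral
     (cis (of_int n * pi) / (\<i> * of_int n) - cis (of_int n * (-pi)) / (\<i> * of_int n))) {-pi..pi}"
    by (rule fundamental_theorem_of_calculus) (use d in auto)
  then show ?thesis using False e by simp
qed

text \<open>Uniform convergence along the net of finite index sets allows termwise integration; the
  integral is constant once the set contains \<open>n\<close>.\<close>

lemma fser_coeff:
  assumes "wbound v K c" "\<And>n. 1 \<le> v n"
  shows "((\<lambda>t. fser c t * cis (- of_int n * t)) has_integral (of_real (2 * pi) * c n)) {-pi..pi}"
proof -
  let ?F = "finite_subsets_at_top (UNIV::int set)"
  have ul: "uniform_limit {-pi..pi} (\<lambda>A t. (\<Sum>m\<in>A. c m * cis (of_int m * t)) * cis (- of_int n * t))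
      (\<lambda>t. fser c t * cis (- of_int n * t)) ?F"
  proof (rule uniform_limit_on_subset[OF _ subset_UNIV], rule uniform_limitI)
    fix e :: real assume "e > 0"
    then have "\<forall>\<^sub>F A in ?F. \<forall>t\<in>UNIV. dist (\<Sum>m\<in>A. c m * cis (of_int m * t)) (fser c t) < e"
      using fser_uniform_limit[OF assms, of UNIV] by (auto simp: uniform_limit_iff)
    then show "\<forall>\<^sub>F A in ?F. \<forall>t\<in>UNIV. dist ((\<Sum>m\<in>A. c m * cis (of_int m * t)) * cis (- of_int n * t))
        (fser c t * cis (- of_int n * t)) < e"
      by eventually_elim (simp add: dist_norm left_diff_distrib[symmetric] norm_mult)
  qed
  obtain I J where I: "\<And>A. ((\<lambda>t. (\<Sum>m\<in>A. c m * cis (of_int m * t)) * cis (- of_int n * t)) has_integral I A) {-pi..pi}"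
    and J: "((\<lambda>t. fser c t * cis (- of_int n * t)) has_integral J) {-pi..pi}" and lim: "(I \<longlongrightarrow> J) ?F"
    by (rule uniform_limit_integral[OF ul]) (auto intro!: continuous_intros)
  have IA: "I A = (if n \<in> A then of_real (2 * pi) * c n else 0)" if A: "finite A" for A
  proof -
    have "((\<lambda>t. \<Sum>m\<in>A. c m * cis (of_int (m - n) * t)) has_integral (\<Sum>m\<in>A. c m * (if m - n = 0 then of_real (2 * pi) else 0))) {-pi..pi}"
      by (intro has_integral_sum A has_integral_mult_right has_integral_cis_period)
    moreover have "(\<Sum>m\<in>A. c m * cis (of_int (m - n) * t)) = (\<Sum>m\<in>A. c m * cis (of_int m * t)) * cis (- of_int n * t)" for t
      by (subst sum_distrib_right, rule sum.cong) (simp_all add: mult.assoc cis_mult left_diff_distrib)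
    ultimately have "((\<lambda>t. (\<Sum>m\<in>A. c m * cis (of_int m * t)) * cis (- of_int n * t)) has_integral
        (\<Sum>m\<in>A. c m * (if m - n = 0 then of_real (2 * pi) else 0))) {-pi..pi}" by simp
    moreover have "(\<Sum>m\<in>A. c m * (if m - n = 0 then of_real (2 * pi) else 0)) = (\<Sum>m\<in>A. if m = n then of_real (2 * pi) * c n else 0)"
      by (rule sum.cong) auto
    moreover have "\<dots> = (if n \<in> A then of_real (2 * pi) * c n else 0)" using A by (simp add: sum.delta)
    ultimately show ?thesis using has_integral_unique[OF I[of A]] by simp
  qed
  have "\<forall>\<^sub>F A in ?F. I A = of_real (2 * pi) * c n"
    unfolding eventually_finite_subsets_at_top by (rule exI[of _ "{n}"]) (simp add: IA)
  then have "(I \<longlongrightarrow> of_real (2 * pi) * c n) ?F" by (rule tendsto_eventually)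
  then have "J = of_real (2 * pi) * c n" using lim tendsto_unique finite_subsets_at_top_neq_bot by blast
  then show ?thesis using J by simp
qed

lemma norm_coeff_le:
  assumes "wbound v K c" "\<And>n. 1 \<le> v n" "\<And>t. norm (fser c t) \<le> B"
  shows "norm (c n) \<le> B"
proof -
  have B: "0 \<le> B" using assms(3)[of 0] norm_ge_zero[of "fser c 0"] by linarith
  have "norm (of_real (2 * pi) * c n) \<le> B * measure lborel (cbox (-pi) pi)"
    by (rule has_integral_bound[OF B])
       (use fser_coeff[OF assms(1,2)] assms(3) in \<open>auto simp: norm_mult\<close>)
  then have "2 * pi * norm (c n) \<le> 2 * pi * B" by (simp add: norm_mult mult_ac)
  then show ?thesis by simp
qed

lemma fser_unique:
  assumes "wbound v K c" "\<And>n. 1 \<le> v n" "wbound u L d" "\<And>n. 1 \<le> u n" "\<And>t. fser c t = fser d t"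
  shows "c = d"
proof
  fix n
  have "of_real (2 * pi) * c n = of_real (2 * pi) * d n"
    using has_integral_unique[OF fser_coeff[OF assms(1,2), of n]] fser_coeff[OF assms(3,4), of n] assms(5) by simp
  then show "c n = d n" by simp
qed

text \<open>Used twice: with translates, for convolution, and with the phases of frequency
  \<open>M * a\<close>, for composition. Summability of \<open>norm (q a) * K a\<close> dominates
  the double series, which justifies exchanging the sums over \<open>a\<close> and
  \<open>n\<close>.\<close>

lemma superpose:
  fixes q :: "int \<Rightarrow> complex" and E :: "int \<Rightarrow> int \<Rightarrow> complex"
  assumes E: "\<And>a. wbound v (K a) (E a)" and q: "wbound K G q" and v: "\<And>n. 1 \<le> v n"
  shows "wbound v G (\<lambda>n. \<Sum>\<^sub>\<infinity>a. q a * E a n)"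
    and "fser (\<lambda>n. \<Sum>\<^sub>\<infinity>a. q a * E a n) t = (\<Sum>\<^sub>\<infinity>a. q a * fser (E a) t)"
    and "asum (\<lambda>a. q a * E a n)"
proof -
  have K0: "0 \<le> K a" for a using wbound_nonneg[OF E] .
  have v0: "0 \<le> v n" for n using v[of n] by linarith
  have sq: "(\<lambda>a. norm (q a) * K a) summable_on UNIV" by (rule wbound_weight_summable[OF q K0])
  have EK: "norm (E a n) \<le> K a" for a n
    using wbound_term[OF E, of a n] mult_left_mono[OF v, of "norm (E a n)" n] by simp
  show abs: "asum (\<lambda>a. q a * E a n)" for n
    by (rule Infinite_Sum.abs_summable_on_comparison_test'[OF sq]) (use EK in \<open>auto simp: norm_mult mult_left_mono\<close>)
  show wb: "wbound v G (\<lambda>n. \<Sum>\<^sub>\<infinity>a. q a * E a n)"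
    unfolding wbound_def
  proof (intro allI impI)
    fix A :: "int set" assume A: "finite A"
    have abs': "(\<lambda>a. norm (q a * E a n) * v n) summable_on UNIV" for n
      using summable_on_cmult_left[OF abs] .
    have "(\<Sum>n\<in>A. norm (\<Sum>\<^sub>\<infinity>a. q a * E a n) * v n) \<le> (\<Sum>n\<in>A. (\<Sum>\<^sub>\<infinity>a. norm (q a * E a n)) * v n)"
      by (intro sum_mono mult_right_mono norm_infsum_bound abs v0)
    also have "\<dots> = (\<Sum>n\<in>A. (\<Sum>\<^sub>\<infinity>a. norm (q a * E a n) * v n))"
      by (intro sum.cong refl infsum_cmult_left[symmetric] abs)
    also have "\<dots> \<le> (\<Sum>\<^sub>\<infinity>a. norm (q a) * K a)"
    proof (rule has_sum_mono[OF has_sum_finite_sum[OF A] has_sum_infsum[OF sq]])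
      show "((\<lambda>a. norm (q a * E a n) * v n) has_sum (\<Sum>\<^sub>\<infinity>a. norm (q a * E a n) * v n)) UNIV" for n
        by (rule has_sum_infsum[OF abs'])
      show "(\<Sum>n\<in>A. norm (q a * E a n) * v n) \<le> norm (q a) * K a" for a
        using mult_left_mono[OF wboundD[OF E A], of "norm (q a)" a]
        by (simp add: norm_mult sum_distrib_left mult_ac)
    qed
    also have "\<dots> \<le> G" by (rule wbound_weight_infsum[OF q K0])
    finally show "(\<Sum>n\<in>A. norm (\<Sum>\<^sub>\<infinity>a. q a * E a n) * v n) \<le> G" .
  qed
  \<comment> \<open>A finite set of pairs is enlarged to a rectangle, where the inner sums over
    \<open>n\<close> are controlled by \<open>K a\<close>.\<close>
  have "asum (\<lambda>(n, a). q a * E a n * cis (of_int n * t))"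
  proof (rule nonneg_bdd_above_summable_on)
    show "bdd_above (sum (\<lambda>x. norm (case x of (n, a) \<Rightarrow> q a * E a n * cis (of_int n * t))) ` {F. F \<subseteq> UNIV \<and> finite F})"
    proof (rule bdd_aboveI2)
      fix F :: "(int \<times> int) set" assume "F \<in> {F. F \<subseteq> UNIV \<and> finite F}"
      then have F: "finite F" by simp
      have "(\<Sum>x\<in>F. norm (case x of (n, a) \<Rightarrow> q a * E a n * cis (of_int n * t)))
           = (\<Sum>x\<in>F. case x of (n, a) \<Rightarrow> norm (q a) * norm (E a n))"
        by (rule sum.cong) (auto simp: norm_mult)
      also have "\<dots> \<le> (\<Sum>x\<in>fst ` F \<times> snd ` F. case x of (n, a) \<Rightarrow> norm (q a) * norm (E a n))"
        by (rule sum_mono2) (use F in \<open>auto intro: rev_image_eqI\<close>)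
      also have "\<dots> = (\<Sum>a\<in>snd ` F. \<Sum>n\<in>fst ` F. norm (q a) * norm (E a n))"
        unfolding sum.cartesian_product[symmetric] by (rule sum.swap)
      also have "\<dots> \<le> (\<Sum>a\<in>snd ` F. norm (q a) * K a)"
      proof (rule sum_mono)
        fix a assume "a \<in> snd ` F"
        have "(\<Sum>n\<in>fst ` F. norm (E a n)) \<le> (\<Sum>n\<in>fst ` F. norm (E a n) * v n)"
          using mult_left_mono[OF v, of "norm (E a n)" n for n] by (intro sum_mono) simp
        also have "\<dots> \<le> K a" by (rule wboundD[OF E]) (use F in auto)
        finally show "(\<Sum>n\<in>fst ` F. norm (q a) * norm (E a n)) \<le> norm (q a) * K a"
          by (simp add: sum_distrib_left[symmetric] mult_left_mono)
      qed
      also have "\<dots> \<le> G" by (rule wboundD[OF q]) (use F in auto)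
      finally show "(\<Sum>x\<in>F. norm (case x of (n, a) \<Rightarrow> q a * E a n * cis (of_int n * t))) \<le> G" .
    qed
  qed auto
  then have "(\<lambda>(n, a). q a * E a n * cis (of_int n * t)) summable_on UNIV"
    by (rule abs_summable_summable)
  then have sm: "(\<lambda>(n, a). q a * E a n * cis (of_int n * t)) summable_on UNIV \<times> UNIV"
    by simp
  have "fser (\<lambda>n. \<Sum>\<^sub>\<infinity>a. q a * E a n) t = (\<Sum>\<^sub>\<infinity>n. \<Sum>\<^sub>\<infinity>a. q a * E a n * cis (of_int n * t))"
    unfolding fser_def
    by (intro infsum_cong infsum_cmult_left[symmetric]) (rule abs_summable_summable[OF abs])
  also have "\<dots> = (\<Sum>\<^sub>\<infinity>a. \<Sum>\<^sub>\<infinity>n. q a * E a n * cis (of_int n * t))"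
    by (rule infsum_swap_banach[OF sm])
  also have "\<dots> = (\<Sum>\<^sub>\<infinity>a. q a * fser (E a) t)"
    unfolding fser_def mult.assoc
    by (intro infsum_cong infsum_cmult_right) (rule abs_summable_summable[OF fser_abs_summable[OF E v]])
  finally show "fser (\<lambda>n. \<Sum>\<^sub>\<infinity>a. q a * E a n) t = (\<Sum>\<^sub>\<infinity>a. q a * fser (E a) t)" .
qed

section \<open>Translation and convolution of coefficient sequences\<close>

definition shift :: "int \<Rightarrow> (int \<Rightarrow> complex) \<Rightarrow> int \<Rightarrow> complex" where
  "shift m d n = d (n - m)"

lemma wbound_shift:
  assumes "wbound v L d" "submult v"
  shows "wbound v (v m * L) (shift m d)"
  unfolding wbound_def
proof (intro allI impI)
  fix A :: "int set" assume A: "finite A"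
  have vm: "0 \<le> v m" using assms(2) by (auto simp: submult_def intro: order_trans[OF zero_le_one])
  have "(\<Sum>n\<in>A. norm (shift m d n) * v n) \<le> (\<Sum>n\<in>A. v m * (norm (d (n - m)) * v (n - m)))"
  proof (rule sum_mono)
    fix n
    have "v n \<le> v m * v (n - m)" using assms(2) unfolding submult_def by (metis add.commute diff_add_cancel)
    then show "norm (shift m d n) * v n \<le> v m * (norm (d (n - m)) * v (n - m))"
      using mult_left_mono[of "v n" "v m * v (n-m)" "norm (d (n - m))"] by (simp add: shift_def mult_ac)
  qed
  also have "\<dots> = v m * (\<Sum>n\<in>(\<lambda>n. n - m) ` A. norm (d n) * v n)"
    by (subst sum.reindex) (auto simp: inj_on_def sum_distrib_left)
  also have "\<dots> \<le> v m * L" by (intro mult_left_mono wboundD[OF assms(1)] vm) (use A in auto)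
  finally show "(\<Sum>n\<in>A. norm (shift m d n) * v n) \<le> v m * L" .
qed

lemma fser_shift: "fser (shift m d) t = cis (of_int m * t) * fser d t"
proof -
  have "fser (shift m d) t = (\<Sum>\<^sub>\<infinity>n. d (n - m) * cis (of_int n * t))" by (simp add: fser_def shift_def)
  also have "\<dots> = (\<Sum>\<^sub>\<infinity>n. d n * cis (of_int (n + m) * t))"
    by (rule infsum_reindex_bij_witness[of _ "\<lambda>n. n + m" "\<lambda>n. n - m"]) auto
  also have "\<dots> = (\<Sum>\<^sub>\<infinity>n. cis (of_int m * t) * (d n * cis (of_int n * t)))"
    by (intro infsum_cong) (simp add: ring_distribs cis_mult[symmetric])
  also have "\<dots> = cis (of_int m * t) * fser d t" unfolding fser_def by (rule infsum_cmult_right') 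
  finally show ?thesis .
qed

definition conv :: "(int \<Rightarrow> complex) \<Rightarrow> (int \<Rightarrow> complex) \<Rightarrow> int \<Rightarrow> complex" where
  "conv c d n = (\<Sum>\<^sub>\<infinity>m. c m * d (n - m))"

text \<open>A convolution is the superposition of the translates \<open>shift a d\<close> with
  coefficients \<open>c a\<close>; by submultiplicativity the translate by \<open>a\<close> has norm
  at most \<open>v a * L\<close>, so \<open>superpose\<close> applies.\<close>

lemma conv_bounds:
  assumes c: "wbound v K c" and d: "wbound v L d" and v: "submult v"
  shows "wbound v (K * L) (conv c d)" "fser (conv c d) t = fser c t * fser d t"
proof -
  have L: "0 \<le> L" using wbound_nonneg[OF d] .
  have v1: "1 \<le> v n" for n using v by (simp add: submult_def)
  have q: "wbound (\<lambda>m. v m * L) (K * L) c"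
    unfolding wbound_def
  proof (intro allI impI)
    fix A :: "int set" assume "finite A"
    then show "(\<Sum>n\<in>A. norm (c n) * (v n * L)) \<le> K * L"
      using mult_right_mono[OF wboundD[OF c] L, of A] by (simp add: sum_distrib_right mult.assoc)
  qed
  have eq: "conv c d = (\<lambda>n. \<Sum>\<^sub>\<infinity>a. c a * shift a d n)" by (auto simp: conv_def shift_def)
  note S = superpose[of v "\<lambda>m. v m * L" "\<lambda>m. shift m d", OF wbound_shift[OF d v] q v1]
  show "wbound v (K * L) (conv c d)" unfolding eq by (rule S(1))
  have "fser (conv c d) t = (\<Sum>\<^sub>\<infinity>a. c a * fser (shift a d) t)" unfolding eq by (rule S(2))
  also have "\<dots> = (\<Sum>\<^sub>\<infinity>a. c a * cis (of_int a * t) * fser d t)" by (simp add: fser_shift mult.assoc)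
  also have "\<dots> = fser c t * fser d t" unfolding fser_def[of c] by (rule infsum_cmult_left')
  finally show "fser (conv c d) t = fser c t * fser d t" .
qed

text \<open>Pairs a summable with a bounded sequence, for factors such as the limit coefficients
  that are controlled only in the sup norm.\<close>

lemma norm_conv_le:
  assumes "wbound v K c" "\<And>n. 1 \<le> v n" "\<And>n. norm (d n) \<le> B"
  shows "norm (conv c d n) \<le> K * B"
  unfolding conv_def by (rule wbound_mult_bounded(2)[OF assms(1,2)]) (use assms in auto)

lemma wbound_add:
  assumes "wbound v K c" "wbound v L d" "\<And>n. 0 \<le> v n"
  shows "wbound v (K + L) (\<lambda>n. c n + d n)"
  unfolding wbound_def
proof (intro allI impI)
  fix A :: "'a set" assume A: "finite A"
  have "(\<Sum>n\<in>A. norm (c n + d n) * v n) \<le> (\<Sum>n\<in>A. norm (c n) * v n + norm (d n) * v n)"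
    by (intro sum_mono) (use assms(3) in \<open>simp add: ring_distribs(2)[symmetric] mult_right_mono norm_triangle_ineq\<close>)
  also have "\<dots> \<le> K + L" using wboundD[OF assms(1) A] wboundD[OF assms(2) A] by (simp add: sum.distrib)
  finally show "(\<Sum>n\<in>A. norm (c n + d n) * v n) \<le> K + L" .
qed

lemma wbound_uminus: "wbound v K c \<Longrightarrow> wbound v K (\<lambda>n. - c n)"
  by (simp add: wbound_def)

lemma fser_diff:
  assumes "wbound v K c" "wbound u L d" "\<And>n. 1 \<le> v n" "\<And>n. 1 \<le> u n"
  shows "fser (\<lambda>n. c n - d n) t = fser c t - fser d t"
proof -
  have "((\<lambda>n. c n * cis (of_int n * t) + - (d n * cis (of_int n * t))) has_sum fser c t + - fser d t) UNIV"
    unfolding fser_def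
    by (rule has_sum_add[OF has_sum_infsum has_sum_uminusI[OF has_sum_infsum]])
       (rule abs_summable_summable[OF fser_abs_summable[OF assms(1,3)]] abs_summable_summable[OF fser_abs_summable[OF assms(2,4)]])+
  then show ?thesis unfolding fser_def[of "\<lambda>n. c n - d n"] by (intro infsumI) (simp add: left_diff_distrib)
qed

definition unitseq :: "int \<Rightarrow> complex" where "unitseq n = (if n = 0 then 1 else 0)"

lemma wbound_unitseq: "v 0 \<ge> 0 \<Longrightarrow> wbound v (v 0) unitseq"
  by (auto simp: wbound_def unitseq_def if_distrib if_distribR sum.delta cong: if_cong)

lemma infsum_delta_int:
  fixes f :: "int \<Rightarrow> complex"
  shows "(\<Sum>\<^sub>\<infinity>m. (if m = k then f m else 0)) = f k"
proof -
  have "(\<Sum>\<^sub>\<infinity>m. (if m = k then f m else 0)) = (\<Sum>\<^sub>\<infinity>m\<in>{k}. f m)"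
    by (rule infsum_cong_neutral) auto
  then show ?thesis by simp
qed

lemma fser_unitseq: "fser unitseq t = 1"
proof -
  have "fser unitseq t = (\<Sum>\<^sub>\<infinity>m. (if m = 0 then cis (of_int m * t) else 0))"
    unfolding fser_def unitseq_def by (rule infsum_cong) auto
  then show ?thesis by (simp add: infsum_delta_int)
qed

section \<open>Oscillatory phases\<close>

text \<open>First-derivative van der Corput estimate. Integration by parts leaves boundary terms of
  total size 2 / l and the integral of the derivative \<open>h\<close> of 1 / D. On [0, pi] with x
  >= 0 that derivative has one sign, so its absolute integral is again a difference of boundary
  values.\<close>

lemma osc_integral_nonstationary:
  fixes a b p x l :: real
  assumes "a \<le> b" "0 \<le> a" "b \<le> pi" "0 \<le> x" "0 < l" and ge: "\<And>t. t \<in> {a..b} \<Longrightarrow> l \<le> \<bar>p + x * cos t\<bar>"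
  shows "norm (integral {a..b} (\<lambda>t. cis (p * t + x * sin t))) \<le> 4 / l"
proof -
  define D where "D t = p + x * cos t" for t
  define h where "h t = x * sin t / (D t)\<^sup>2" for t
  have nz: "D t \<noteq> 0" if "t \<in> {a..b}" for t using ge[OF that] assms(5) by (auto simp: D_def)
  have inv: "\<bar>1 / D t\<bar> \<le> 1 / l" if "t \<in> {a..b}" for t
    using ge[OF that] assms(5) nz[OF that] by (simp add: D_def divide_simps)
  have dD: "(D has_real_derivative - x * sin t) (at t within {a..b})" for t
    unfolding D_def by (auto intro!: derivative_eq_intros)
  have dinv: "((\<lambda>t. 1 / D t) has_vector_derivative h t) (at t within {a..b})" if "t \<in> {a..b}" for t
    unfolding has_real_derivative_iff_has_vector_derivative[symmetric] h_def
    by (rule derivative_eq_intros dD refl | use nz[OF that] in \<open>simp add: power2_eq_square\<close>)+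
  from dinv have hi: "(h has_integral (1 / D b - 1 / D a)) {a..b}"
    by (intro fundamental_theorem_of_calculus assms)
  have hle: "integral {a..b} h \<le> 2 / l"
  proof -
    have "1 / D b \<le> 1 / l" by (rule order_trans[OF abs_ge_self inv]) (use assms in auto)
    moreover have "- (1 / D a) \<le> 1 / l" by (rule order_trans[OF abs_ge_minus_self inv]) (use assms in auto)
    ultimately show ?thesis using integral_unique[OF hi] by simp
  qed
  have dc: "((\<lambda>t. cis (p * t + x * sin t)) has_vector_derivative (\<i> * D t * cis (p * t + x * sin t))) (at t within {a..b})" for t
  proof -
    have "((\<lambda>t. exp (\<i> * (of_real p * of_real t + of_real x * of_real (sin t)))) has_vector_derivative
       (\<i> * D t * exp (\<i> * (of_real p * of_real t + of_real x * of_real (sin t))))) (at t within {a..b})"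
      unfolding sin_of_real[symmetric]
      by (rule has_vector_derivative_real_field)
         (auto intro!: derivative_eq_intros simp: D_def cos_of_real algebra_simps)
    then show ?thesis by (simp add: cis_conv_exp algebra_simps)
  qed
  define G where "G t = cis (p * t + x * sin t) * of_real (1 / D t) / \<i>" for t
  have dG: "(G has_vector_derivative (cis (p * t + x * sin t) + cis (p * t + x * sin t) * of_real (h t) / \<i>)) (at t within {a..b})"
    if t: "t \<in> {a..b}" for t
  proof -
    have "((\<lambda>t. complex_of_real (1 / D t)) has_vector_derivative of_real (h t)) (at t within {a..b})"
      using has_vector_derivative_of_real[OF dinv[folded has_real_derivative_iff_has_vector_derivative, OF t]] .
    from has_vector_derivative_mult[OF dc this]
    have "((\<lambda>t. cis (p * t + x * sin t) * of_real (1 / D t)) has_vector_derivative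
       (cis (p * t + x * sin t) * of_real (h t) + \<i> * D t * cis (p * t + x * sin t) * of_real (1 / D t))) (at t within {a..b})" .
    from has_vector_derivative_divide[OF this, of \<i>]
    have "(G has_vector_derivative ((cis (p * t + x * sin t) * of_real (h t) + \<i> * D t * cis (p * t + x * sin t) * of_real (1 / D t)) / \<i>)) (at t within {a..b})"
      unfolding G_def .
    moreover have "(cis (p * t + x * sin t) * of_real (h t) + \<i> * D t * cis (p * t + x * sin t) * of_real (1 / D t)) / \<i>
        = cis (p * t + x * sin t) + cis (p * t + x * sin t) * of_real (h t) / \<i>"
      using nz[OF t] by (simp add: ring_distribs mult.assoc[symmetric])
    ultimately show ?thesis by simp
  qed
  have FI: "((\<lambda>t. cis (p * t + x * sin t) + cis (p * t + x * sin t) * of_real (h t) / \<i>) has_integral (G b - G a)) {a..b}"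
    by (intro fundamental_theorem_of_calculus assms dG)
  have cD: "continuous_on {a..b} D" unfolding D_def by (intro continuous_intros)
  have ch: "continuous_on {a..b} h" unfolding h_def using nz by (intro continuous_intros cD) auto
  have I2: "(\<lambda>t. cis (p * t + x * sin t) * of_real (h t) / \<i>) integrable_on {a..b}"
    by (intro integrable_continuous_interval continuous_intros ch) auto
  have I1: "(\<lambda>t. cis (p * t + x * sin t)) integrable_on {a..b}"
    by (intro integrable_continuous_interval continuous_intros)
  have "integral {a..b} (\<lambda>t. cis (p * t + x * sin t)) + integral {a..b} (\<lambda>t. cis (p * t + x * sin t) * of_real (h t) / \<i>) = G b - G a"
    using integral_unique[OF FI] integral_add[OF I1 I2] by simp
  then have "integral {a..b} (\<lambda>t. cis (p * t + x * sin t)) = (G b - G a) - integral {a..b} (\<lambda>t. cis (p * t + x * sin t) * of_real (h t) / \<i>)"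
    by (simp add: algebra_simps)
  also have "norm \<dots> \<le> norm (G b - G a) + norm (integral {a..b} (\<lambda>t. cis (p * t + x * sin t) * of_real (h t) / \<i>))"
    by (rule norm_triangle_ineq4)
  also have "norm (G b - G a) \<le> norm (G b) + norm (G a)" by (rule norm_triangle_ineq4)
  also have "norm (G b) \<le> 1 / l" using inv[of b] assms(1) by (simp add: G_def norm_divide norm_mult)
  also have "norm (G a) \<le> 1 / l" using inv[of a] assms(1) by (simp add: G_def norm_divide norm_mult)
  also have "norm (integral {a..b} (\<lambda>t. cis (p * t + x * sin t) * of_real (h t) / \<i>)) \<le> integral {a..b} h"
  proof (rule integral_norm_bound_integral[OF I2 has_integral_integrable[OF hi]])
    fix t assume "t \<in> {a..b}"
    then have "0 \<le> sin t" using assms by (intro sin_ge_zero) auto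
    then show "norm (cis (p * t + x * sin t) * of_real (h t) / \<i>) \<le> h t"
      using assms(4) by (simp add: norm_mult norm_divide h_def norm_power)
  qed
  also note hle
  finally show ?thesis by (simp add: add_divide_distrib[symmetric])
qed

text \<open>With w = z / 2, the bound w cos w <= sin w from the mean value theorem gives sin z >= 2
  w (cos w)^2 = (z / 2) (1 + cos z), and cos z >= 0.\<close>

lemma sin_ge_half:
  assumes "0 \<le> z" "z \<le> pi / 2"
  shows "z / 2 \<le> sin z"
proof -
  define w where "w = z / 2"
  have w: "0 \<le> w" "w \<le> pi / 4" using assms by (auto simp: w_def)
  have "w * cos w \<le> sin w"
  proof (cases "w = 0")
    case False
    then obtain c where c: "0 < c" "c < w" "sin w - sin 0 = (w - 0) * cos c"
      using MVT2[of 0 w sin cos] w by (auto intro!: DERIV_sin)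
    have "cos w \<le> cos c" using c w by (intro cos_monotone_0_pi_le) auto
    then show ?thesis using c w by (simp add: mult_left_mono)
  qed simp
  moreover have "0 \<le> cos w" using w by (intro cos_ge_zero) auto
  ultimately have "2 * (w * cos w) * cos w \<le> 2 * sin w * cos w" by (simp add: mult_right_mono)
  also have "\<dots> = sin z" using sin_double[of w] by (simp add: w_def)
  also have "2 * (w * cos w) * cos w = z / 2 + z / 2 * cos z"
  proof -
    have "cos z = 2 * (cos w * cos w) - 1"
      using cos_double_cos[of w] by (simp add: w_def power2_eq_square)
    then have "z / 2 + z / 2 * cos z = z / 2 + z / 2 * (2 * (cos w * cos w) - 1)" by simp
    then show ?thesis by (simp add: w_def algebra_simps)
  qed
  finally have "z / 2 + z / 2 * cos z \<le> sin z" .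
  moreover have "0 \<le> z / 2 * cos z" using assms by (intro mult_nonneg_nonneg cos_ge_zero) auto
  ultimately show ?thesis by linarith
qed

text \<open>The phase derivative is p + x cos t. Where it is at least y in absolute value,
  \<open>osc_integral_nonstationary\<close> gives 4 / y on each side; the other t form an interval
  on which cos varies by at most 2 y / x = 2 / y^2, hence of length O(1 / y). The relation x = y^3
  balances the two; the cube is due to the zeros of sin at 0 and pi.\<close>

lemma osc_integral_half:
  fixes p x y :: real
  assumes y: "0 < y" and x: "x = y ^ 3"
  shows "norm (integral {0..pi} (\<lambda>t. cis (p * t + x * sin t))) \<le> 12 / y"
proof -
  let ?f = "\<lambda>t. cis (p * t + x * sin t)"
  have x0: "0 < x" using x y by simp
  \<comment> \<open>The values of cos at which the derivative is y and - y, clamped to [-1, 1] so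
    that \<open>arccos\<close> applies. Where clamping destroys the inequality needed on an outer
    interval, that interval is a point.\<close>
  define u where "u = max (-1) (min 1 ((y - p) / x))"
  define v where "v = max (-1) (min 1 ((- y - p) / x))"
  have uv: "-1 \<le> u" "u \<le> 1" "-1 \<le> v" "v \<le> 1" by (auto simp: u_def v_def)
  have le: "(- y - p) / x \<le> (y - p) / x" using x0 y by (intro divide_right_mono) auto
  have vu: "v \<le> u" unfolding u_def v_def using le by linarith
  define t1 where "t1 = arccos u"
  define t2 where "t2 = arccos v"
  have t: "0 \<le> t1" "t1 \<le> t2" "t2 \<le> pi"
    using uv vu by (auto simp: t1_def t2_def arccos_lbound arccos_ubound intro: arccos_le_arccos)
  have ct: "cos t1 = u" "cos t2 = v" using uv by (auto simp: t1_def t2_def cos_arccos)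
  have int: "?f integrable_on {a..b}" for a b by (intro integrable_continuous_interval continuous_intros)
  have "integral {0..t1} ?f + integral {t1..pi} ?f = integral {0..pi} ?f"
    by (rule Henstock_Kurzweil_Integration.integral_combine) (use t int in auto)
  moreover have "integral {t1..t2} ?f + integral {t2..pi} ?f = integral {t1..pi} ?f"
    by (rule Henstock_Kurzweil_Integration.integral_combine) (use t int in auto)
  ultimately have "integral {0..pi} ?f = integral {0..t1} ?f + integral {t1..t2} ?f + integral {t2..pi} ?f"
    by (simp only: add.assoc)
  then have h0: "norm (integral {0..pi} ?f) \<le> norm (integral {0..t1} ?f) + norm (integral {t1..t2} ?f) + norm (integral {t2..pi} ?f)"
    by (simp only:) (rule order_trans[OF norm_triangle_ineq], intro add_right_mono norm_triangle_ineq)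
  have h1: "norm (integral {0..t1} ?f) \<le> 4 / y"
  proof (cases "t1 = 0")
    case True then show ?thesis using y by simp
  next
    case False
    then have "u \<noteq> 1" by (auto simp: t1_def)
    then have "(y - p) / x \<le> u" by (auto simp: u_def)
    then have *: "y - p \<le> u * x" using x0 by (simp add: pos_divide_le_eq)
    show ?thesis
    proof (rule osc_integral_nonstationary)
      fix s assume "s \<in> {0..t1}"
      then have "u \<le> cos s" using cos_monotone_0_pi_le[of s t1] t ct by auto
      then have "u * x \<le> cos s * x" using x0 by (intro mult_right_mono) auto
      then show "y \<le> \<bar>p + x * cos s\<bar>" using * by (simp add: mult.commute)
    qed (use t x0 y in auto)
  qed
  have h2: "norm (integral {t2..pi} ?f) \<le> 4 / y"
  proof (cases "t2 = pi")
    case True then show ?thesis using y by simp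
  next
    case False
    then have "v \<noteq> -1" by (auto simp: t2_def)
    then have "v \<le> (- y - p) / x" by (auto simp: v_def)
    then have *: "v * x \<le> - y - p" using x0 by (simp add: pos_le_divide_eq)
    show ?thesis
    proof (rule osc_integral_nonstationary)
      fix s assume "s \<in> {t2..pi}"
      then have "cos s \<le> v" using cos_monotone_0_pi_le[of t2 s] t ct by auto
      then have "cos s * x \<le> v * x" using x0 by (intro mult_right_mono) auto
      then show "y \<le> \<bar>p + x * cos s\<bar>" using * by (simp add: mult.commute)
    qed (use t x0 y in auto)
  qed
  have h3: "norm (integral {t1..t2} ?f) \<le> 4 / y"
  proof -
    have "norm (integral {t1..t2} ?f) \<le> 1 * (t2 - t1)"
      by (rule integral_bound) (use t in \<open>auto intro!: continuous_intros\<close>)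
    moreover have "t2 - t1 \<le> 4 / y"
    proof -
      define d where "d = (t2 - t1) / 2"
      have d: "0 \<le> d" "d \<le> pi / 2" using t by (auto simp: d_def)
      have sd: "0 \<le> sin d" using d by (intro sin_ge_zero) auto
      \<comment> \<open>cos t1 - cos t2 is twice the product of the sines of the half sum and the
        half difference d; the half sum lies between d and pi - d, so its sine is at least sin
        d.\<close>
      have "sin d \<le> sin ((t1 + t2) / 2)"
      proof (cases "(t1 + t2) / 2 \<le> pi / 2")
        case True then show ?thesis using t by (intro sin_monotone_2pi_le) (auto simp: d_def)
      next
        case False
        have "sin d \<le> sin (pi - (t1 + t2) / 2)" using False t by (intro sin_monotone_2pi_le) (auto simp: d_def field_simps)
        then show ?thesis by simp
      qed
      then have "2 * (sin d * sin d) \<le> 2 * (sin ((t1 + t2) / 2) * sin d)"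
        using sd by (simp add: mult_right_mono)
      also have "\<dots> = u - v" using cos_diff_cos[of t1 t2] ct by (simp add: d_def)
      also have "\<dots> \<le> (y - p) / x - (- y - p) / x" unfolding u_def v_def using le by linarith
      also have "\<dots> = 2 * (1 / y * (1 / y))" unfolding x using y by (simp add: field_simps power3_eq_cube)
      finally have "(sin d)\<^sup>2 \<le> (1 / y)\<^sup>2" unfolding power2_eq_square by linarith
      then have "sin d \<le> 1 / y" by (rule power2_le_imp_le) (use y in simp)
      then have "d / 2 \<le> 1 / y" using sin_ge_half[OF d] by linarith
      then show ?thesis by (simp add: d_def field_simps)
    qed
    ultimately show ?thesis by (simp only: mult_1_left)
  qed
  have "norm (integral {0..pi} ?f) \<le> 4 / y + 4 / y + 4 / y"
    by (rule order_trans[OF h0]) (intro add_mono h1 h2 h3)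
  then show ?thesis by simp
qed

text \<open>Reflecting the left half flips the signs of both p and x, and complex conjugation
  reduces negative x to positive x.\<close>

lemma osc_integral_full:
  fixes p x y :: real
  assumes y: "0 < y" and x: "\<bar>x\<bar> = y ^ 3"
  shows "norm (integral {-pi..pi} (\<lambda>t. cis (p * t + x * sin t))) \<le> 24 / y"
proof -
  let ?f = "\<lambda>x p t. cis (p * t + x * sin t)"
  have conj: "cnj (integral {0..pi} (?f x p)) = integral {0..pi} (?f (-x) (-p))" for x p
  proof -
    have "?f x p integrable_on {0..pi}" by (intro integrable_continuous_interval continuous_intros)
    from integral_linear[OF this bounded_linear_cnj] show ?thesis by (simp add: o_def cis_cnj algebra_simps)
  qed
  have half: "norm (integral {0..pi} (?f x p)) \<le> 12 / y" if x: "\<bar>x\<bar> = y ^ 3" for x p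
  proof (cases "x \<ge> 0")
    case True then show ?thesis using osc_integral_half[of y x p] y x by simp
  next
    case False
    then have "norm (integral {0..pi} (?f (-x) (-p))) \<le> 12 / y" using osc_integral_half[of y "-x" "-p"] y x by simp
    then show ?thesis unfolding conj[symmetric] complex_mod_cnj .
  qed
  have int: "?f x p integrable_on {a..b}" for a b by (intro integrable_continuous_interval continuous_intros)
  have "integral {-pi..0} (?f x p) + integral {0..pi} (?f x p) = integral {-pi..pi} (?f x p)"
    by (rule Henstock_Kurzweil_Integration.integral_combine) (use int in auto)
  moreover have "integral {-pi..0} (?f x p) = integral {0..pi} (?f (-x) (-p))"
    using Henstock_Kurzweil_Integration.integral_reflect_real[of pi 0 "?f (-x) (-p)"] by simp
  ultimately have "integral {0..pi} (?f (-x) (-p)) + integral {0..pi} (?f x p) = integral {-pi..pi} (?f x p)"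
    by (simp only:)
  then have "norm (integral {-pi..pi} (?f x p)) \<le> norm (integral {0..pi} (?f (-x) (-p))) + norm (integral {0..pi} (?f x p))"
    using norm_triangle_ineq[of "integral {0..pi} (?f (-x) (-p))" "integral {0..pi} (?f x p)"] by (simp only:)
  also have "\<dots> \<le> 12 / y + 12 / y" by (intro add_mono half) (use x in simp_all)
  finally show ?thesis by simp
qed

text \<open>The root serves two needs: functions vanishing on an arc can have coefficients this
  small, and subadditivity of the square root makes the weight submultiplicative.\<close>

definition sw :: "real \<Rightarrow> int \<Rightarrow> real" where "sw \<theta> n = exp (\<theta> * sqrt \<bar>real_of_int n\<bar>)"

text \<open>The phases are entire and can afford an exponential weight. At distance N / 2 it equals
  exp (2 N), which exceeds the norm bound exp (81 / 100 * N) of the Bessel coefficients by more than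
  exp N.\<close>

definition ew :: "int \<Rightarrow> real" where "ew n = exp (4 * \<bar>real_of_int n\<bar>)"

lemma sqrt_abs_add_le: "sqrt \<bar>x + y\<bar> \<le> sqrt \<bar>x\<bar> + sqrt \<bar>y\<bar>"
proof -
  have "sqrt \<bar>x + y\<bar> \<le> sqrt (\<bar>x\<bar> + \<bar>y\<bar>)" by (simp add: abs_triangle_ineq)
  also have "\<dots> \<le> sqrt \<bar>x\<bar> + sqrt \<bar>y\<bar>" by (rule sqrt_add_le_add_sqrt) auto
  finally show ?thesis .
qed

lemma sw_ge_1: "0 \<le> \<theta> \<Longrightarrow> 1 \<le> sw \<theta> n"
  by (simp add: sw_def)

lemma sw_mono: "\<theta> \<le> \<theta>' \<Longrightarrow> sw \<theta> n \<le> sw \<theta>' n"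
  by (simp add: sw_def mult_right_mono)

lemma submult_sw: assumes "0 \<le> \<theta>" shows "submult (sw \<theta>)"
  unfolding submult_def
proof (intro conjI allI)
  fix m n :: int
  show "1 \<le> sw \<theta> n" by (rule sw_ge_1[OF assms])
  have "\<theta> * sqrt \<bar>real_of_int m + real_of_int n\<bar> \<le> \<theta> * (sqrt \<bar>real_of_int m\<bar> + sqrt \<bar>real_of_int n\<bar>)"
    by (intro mult_left_mono sqrt_abs_add_le assms)
  then show "sw \<theta> (m + n) \<le> sw \<theta> m * sw \<theta> n"
    by (simp add: sw_def exp_add[symmetric] ring_distribs)
qed

lemma ew_ge_1: "1 \<le> ew n"
  by (simp add: ew_def)

lemma submult_ew: "submult ew"
  unfolding submult_def
proof (intro conjI allI)
  fix m n :: int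
  show "1 \<le> ew n" by (rule ew_ge_1)
  show "ew (m + n) \<le> ew m * ew n"
    using abs_triangle_ineq[of "real_of_int m" "real_of_int n"] by (simp add: ew_def exp_add[symmetric])
qed

lemma wbound_scale:
  assumes "wbound v K c" "\<And>n. u n \<le> C * v n" "0 \<le> C"
  shows "wbound u (C * K) c"
  unfolding wbound_def
proof (intro allI impI)
  fix A :: "'a set" assume A: "finite A"
  have "(\<Sum>n\<in>A. norm (c n) * u n) \<le> (\<Sum>n\<in>A. norm (c n) * (C * v n))"
    by (intro sum_mono mult_left_mono assms) auto
  also have "\<dots> = C * (\<Sum>n\<in>A. norm (c n) * v n)" by (simp add: sum_distrib_left mult_ac)
  also have "\<dots> \<le> C * K" by (intro mult_left_mono wboundD[OF assms(1) A] assms(3))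
  finally show "(\<Sum>n\<in>A. norm (c n) * u n) \<le> C * K" .
qed

section \<open>Power series on the circle and Bessel coefficients\<close>

definition posseq :: "(nat \<Rightarrow> complex) \<Rightarrow> int \<Rightarrow> complex" where
  "posseq a n = (if n \<ge> 0 then a (nat n) else 0)"

lemma wbound_posseq:
  assumes "\<And>N. (\<Sum>k<N. norm (a k) * v (int k)) \<le> K" "\<And>n. 0 \<le> v n"
  shows "wbound v K (posseq a)"
  unfolding wbound_def
proof (intro allI impI)
  fix A :: "int set" assume A: "finite A"
  define N where "N = Suc (Max (insert 0 (nat ` A)))"
  have N: "nat n < N" if "n \<in> A" for n
    using A that by (auto simp: N_def less_Suc_eq_le intro: Max_ge)
  have "(\<Sum>n\<in>A. norm (posseq a n) * v n) = (\<Sum>n\<in>A \<inter> {0..}. norm (posseq a n) * v n)"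
    by (rule sum.mono_neutral_right) (use A in \<open>auto simp: posseq_def\<close>)
  also have "\<dots> \<le> (\<Sum>n\<in>int ` {..<N}. norm (posseq a n) * v n)"
  proof (rule sum_mono2)
    show "A \<inter> {0..} \<subseteq> int ` {..<N}"
    proof
      fix n assume n: "n \<in> A \<inter> {0..}"
      then show "n \<in> int ` {..<N}" using N[of n] by (intro rev_image_eqI[of "nat n"]) auto
    qed
  qed (use assms in auto)
  also have "\<dots> = (\<Sum>k<N. norm (a k) * v (int k))"
    by (subst sum.reindex) (auto simp: posseq_def)
  also have "\<dots> \<le> K" by (rule assms)
  finally show "(\<Sum>n\<in>A. norm (posseq a n) * v n) \<le> K" .
qed

lemma fser_posseq:
  assumes "summable (\<lambda>k. norm (a k))" "(\<lambda>k. a k * cis t ^ k) sums S"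
  shows "fser (posseq a) t = S"
proof -
  have "((\<lambda>k. a k * cis t ^ k) has_sum S) UNIV"
    by (rule norm_summable_imp_has_sum) (use assms in \<open>auto simp: norm_mult norm_power\<close>)
  moreover have "fser (posseq a) t = (\<Sum>\<^sub>\<infinity>n\<in>range int. posseq a n * cis (of_int n * t))"
    unfolding fser_def
  proof (rule infsum_cong_neutral)
    fix n :: int assume "n \<in> UNIV - range int"
    then have "n < 0" using zero_le_imp_eq_int[of n] by (intro ccontr[of "n < 0"]) auto
    then show "posseq a n * cis (of_int n * t) = 0" by (simp add: posseq_def)
  qed auto
  moreover have "\<dots> = (\<Sum>\<^sub>\<infinity>k. a k * cis t ^ k)"
    by (subst infsum_reindex) (auto simp: o_def posseq_def Complex.DeMoivre)
  ultimately show ?thesis by (simp add: infsumI)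
qed

definition reflseq :: "(int \<Rightarrow> complex) \<Rightarrow> int \<Rightarrow> complex" where
  "reflseq c n = c (- n)"

lemma wbound_reflseq:
  assumes "wbound v K c" "\<And>n. v (- n) = v n"
  shows "wbound v K (reflseq c)"
  unfolding wbound_def
proof (intro allI impI)
  fix A :: "int set" assume A: "finite A"
  have "(\<Sum>n\<in>A. norm (reflseq c n) * v n) = (\<Sum>n\<in>uminus ` A. norm (c n) * v n)"
    by (subst sum.reindex) (auto simp: reflseq_def assms)
  also have "\<dots> \<le> K" by (rule wboundD[OF assms(1)]) (use A in auto)
  finally show "(\<Sum>n\<in>A. norm (reflseq c n) * v n) \<le> K" .
qed

lemma fser_reflseq: "fser (reflseq c) t = fser c (- t)"
  unfolding fser_def reflseq_def
  by (rule infsum_reindex_bij_witness[of _ uminus uminus]) auto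

definition expseq :: "real \<Rightarrow> int \<Rightarrow> complex" where
  "expseq x = posseq (\<lambda>k. of_real (x ^ k / fact k))"

lemma wbound_expseq: "wbound ew (exp (\<bar>x\<bar> * exp 4)) (expseq x)"
  unfolding expseq_def
proof (rule wbound_posseq)
  fix N
  have e: "norm (complex_of_real (x ^ k / fact k)) * ew (int k) = inverse (fact k) * (\<bar>x\<bar> * exp 4) ^ k" for k
    by (simp add: ew_def exp_of_nat_mult[symmetric] power_mult_distrib norm_divide norm_power field_simps)
  have "(\<Sum>k<N. inverse (fact k) * (\<bar>x\<bar> * exp 4) ^ k) \<le> (\<Sum>k. inverse (fact k) * (\<bar>x\<bar> * exp 4) ^ k)"
    by (rule sum_le_suminf[OF summable_exp]) auto
  also have "\<dots> = exp (\<bar>x\<bar> * exp 4)" by (simp add: exp_def scaleR_conv_of_real)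
  finally show "(\<Sum>k<N. norm (complex_of_real (x ^ k / fact k)) * ew (int k)) \<le> exp (\<bar>x\<bar> * exp 4)"
    unfolding e .
qed (use ew_ge_1 order_trans[OF zero_le_one] in blast)

lemma fser_expseq: "fser (expseq x) t = exp (of_real x * cis t)"
  unfolding expseq_def
proof (rule fser_posseq)
  have "summable (\<lambda>k. inverse (fact k) * \<bar>x\<bar> ^ k)" by (rule summable_exp)
  then show "summable (\<lambda>k. norm (complex_of_real (x ^ k / fact k)))"
    by (simp add: norm_divide norm_power field_simps)
  have "(\<lambda>k. (of_real x * cis t) ^ k /\<^sub>R fact k) sums exp (of_real x * cis t)" by (rule exp_converges)
  then show "(\<lambda>k. complex_of_real (x ^ k / fact k) * cis t ^ k) sums exp (of_real x * cis t)"
    by (simp add: scaleR_conv_of_real power_mult_distrib field_simps)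
qed

text \<open>By the generating function exp (x (z - 1 / z) / 2) at z = exp (i t),
  \<open>bessel x m\<close> is the Bessel function of integer order m at x.\<close>

definition bessel :: "real \<Rightarrow> int \<Rightarrow> complex" where
  "bessel x = conv (expseq (x / 2)) (reflseq (expseq (- x / 2)))"

lemma wbound_bessel: "wbound ew (exp (\<bar>x\<bar> * exp 4)) (bessel x)"
proof -
  have "wbound ew (exp (\<bar>x / 2\<bar> * exp 4) * exp (\<bar>- x / 2\<bar> * exp 4)) (bessel x)"
    unfolding bessel_def
    by (intro conv_bounds submult_ew wbound_expseq wbound_reflseq) (simp add: ew_def)
  then show ?thesis by (simp add: exp_add[symmetric])
qed

lemma fser_bessel: "fser (bessel x) t = cis (x * sin t)"
proof -
  have "fser (bessel x) t = fser (expseq (x / 2)) t * fser (reflseq (expseq (- x / 2))) t"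
    unfolding bessel_def
    by (intro conv_bounds(2)[OF wbound_expseq wbound_reflseq[OF wbound_expseq] submult_ew]) (simp add: ew_def)
  also have "\<dots> = exp (of_real (x / 2) * cis t + of_real (- x / 2) * cis (- t))"
    by (simp only: fser_reflseq fser_expseq exp_add)
  also have "of_real (x / 2) * cis t + of_real (- x / 2) * cis (- t) = \<i> * of_real (x * sin t)"
    by (simp add: complex_eq_iff)
  finally show ?thesis by (simp add: cis_conv_exp)
qed

lemma norm_bessel_le_1: "norm (bessel x m) \<le> 1"
  by (rule norm_coeff_le[OF wbound_bessel ew_ge_1]) (simp add: fser_bessel)

lemma norm_bessel_decay:
  assumes y: "0 < y" and x: "\<bar>x\<bar> = y ^ 3"
  shows "norm (bessel x m) \<le> 4 / y"
proof -
  have "((\<lambda>t. fser (bessel x) t * cis (- of_int m * t)) has_integral of_real (2 * pi) * bessel x m) {-pi..pi}"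
    by (rule fser_coeff[OF wbound_bessel ew_ge_1])
  moreover have "fser (bessel x) t * cis (- of_int m * t) = cis (- of_int m * t + x * sin t)" for t
    by (simp add: fser_bessel cis_mult add.commute)
  ultimately have "of_real (2 * pi) * bessel x m = integral {-pi..pi} (\<lambda>t. cis (- of_int m * t + x * sin t))"
    by (simp only: integral_unique)
  then have "norm (of_real (2 * pi) * bessel x m) \<le> 24 / y"
    using osc_integral_full[OF y x, of "- of_int m"] by (simp only:)
  then have "2 * pi * norm (bessel x m) \<le> 24 / y" by (simp add: norm_mult)
  moreover have "6 * norm (bessel x m) \<le> 2 * pi * norm (bessel x m)"
    using pi_gt3 by (intro mult_right_mono) auto
  ultimately have "6 * norm (bessel x m) \<le> 24 / y" by linarith
  then show ?thesis by simp
qed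

text \<open>Multiplication by exp (i N t) translates by N, so the coefficients of exp (i N \<phi>)
  are Bessel values centred at N.\<close>

definition phase :: "int \<Rightarrow> int \<Rightarrow> complex" where
  "phase N = shift N (bessel (of_int N / 100))"

lemma fser_phase: "fser (phase N) t = cis (of_int N * (t + sin t / 100))"
  by (simp add: phase_def fser_shift fser_bessel cis_mult algebra_simps)

lemma exp_4_le: "exp (4::real) \<le> 81"
proof -
  have "exp (4::real) = exp 1 ^ 4" using exp_of_nat_mult[of 4 "1::real"] by simp
  also have "\<dots> \<le> 3 ^ 4" by (intro power_mono exp_le) auto
  finally show ?thesis by simp
qed

lemma wbound_bessel_phase: "wbound ew (exp (81 / 100 * \<bar>real_of_int N\<bar>)) (bessel (of_int N / 100))"
proof (rule wbound_mono[OF wbound_bessel])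
  have "\<bar>real_of_int N / 100\<bar> * exp 4 \<le> \<bar>real_of_int N / 100\<bar> * 81"
    by (intro mult_left_mono exp_4_le) auto
  then show "exp (\<bar>real_of_int N / 100\<bar> * exp 4) \<le> exp (81 / 100 * \<bar>real_of_int N\<bar>)" by simp
qed auto

text \<open>For |n| <= |N| the Bessel coefficients are at most 1 and there are 2 |N| + 1 of them;
  beyond, \<open>ew\<close> overpowers \<open>sw \<theta>\<close> and the tail is at most 1. One
  factor exp (\<theta> sqrt |N|) stems from this width and one from the translation by N. Their
  product is subexponential in N, so that sequences with root decay can be composed with
  phases.\<close>

lemma wbound_phase_weight:
  assumes "0 \<le> \<theta>" "\<theta> \<le> 1"
  shows "wbound (sw \<theta>) (exp (2 * \<theta> * sqrt \<bar>of_int N\<bar>) * (2 * \<bar>of_int N\<bar> + 2)) (phase N)"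
proof -
  let ?b = "bessel (of_int N / 100)"
  let ?s = "exp (\<theta> * sqrt \<bar>of_int N\<bar>)"
  have "wbound (sw \<theta>) (?s * (2 * \<bar>of_int N\<bar> + 1) + 1) ?b"
    unfolding wbound_def
  proof (intro allI impI)
    fix A :: "int set" assume A: "finite A"
    have "(\<Sum>n\<in>A. norm (?b n) * sw \<theta> n) = (\<Sum>n\<in>A \<inter> {-\<bar>N\<bar>..\<bar>N\<bar>}. norm (?b n) * sw \<theta> n) + (\<Sum>n\<in>A - {-\<bar>N\<bar>..\<bar>N\<bar>}. norm (?b n) * sw \<theta> n)"
      using A by (subst sum.union_disjoint[symmetric]) (auto intro: sum.cong)
    moreover have "(\<Sum>n\<in>A \<inter> {-\<bar>N\<bar>..\<bar>N\<bar>}. norm (?b n) * sw \<theta> n) \<le> ?s * (2 * \<bar>of_int N\<bar> + 1)"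
    proof -
      have "(\<Sum>n\<in>A \<inter> {-\<bar>N\<bar>..\<bar>N\<bar>}. norm (?b n) * sw \<theta> n) \<le> (\<Sum>n\<in>A \<inter> {-\<bar>N\<bar>..\<bar>N\<bar>}. 1 * ?s)"
      proof (intro sum_mono mult_mono norm_bessel_le_1)
        fix n assume "n \<in> A \<inter> {-\<bar>N\<bar>..\<bar>N\<bar>}"
        then have "\<bar>n\<bar> \<le> \<bar>N\<bar>" by (auto simp: abs_le_iff[of n])
        then have "\<bar>real_of_int n\<bar> \<le> \<bar>real_of_int N\<bar>" by (simp flip: of_int_abs)
        then show "sw \<theta> n \<le> ?s" using assms by (simp add: sw_def mult_left_mono)
      qed (auto simp: sw_def)
      also have "\<dots> = ?s * card (A \<inter> {-\<bar>N\<bar>..\<bar>N\<bar>})" by simp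
      also have "\<dots> \<le> ?s * (2 * \<bar>of_int N\<bar> + 1)"
      proof (rule mult_left_mono)
        have "card (A \<inter> {-\<bar>N\<bar>..\<bar>N\<bar>}) \<le> card {-\<bar>N\<bar>..\<bar>N\<bar>}" by (rule card_mono) auto
        also have "\<dots> = nat (2 * \<bar>N\<bar> + 1)" by simp
        finally have "real (card (A \<inter> {-\<bar>N\<bar>..\<bar>N\<bar>})) \<le> real (nat (2 * \<bar>N\<bar> + 1))" by (simp only: of_nat_le_iff)
        then show "real (card (A \<inter> {-\<bar>N\<bar>..\<bar>N\<bar>})) \<le> 2 * \<bar>of_int N\<bar> + 1" by simp
      qed auto
      finally show ?thesis .
    qed
    moreover have "(\<Sum>n\<in>A - {-\<bar>N\<bar>..\<bar>N\<bar>}. norm (?b n) * sw \<theta> n) \<le> 1"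
    proof -
      have "(\<Sum>n\<in>A - {-\<bar>N\<bar>..\<bar>N\<bar>}. norm (?b n) * sw \<theta> n) \<le> (\<Sum>n\<in>A - {-\<bar>N\<bar>..\<bar>N\<bar>}. norm (?b n) * ew n * exp (- 3 * \<bar>of_int N\<bar>))"
      proof (rule sum_mono)
        fix n assume "n \<in> A - {-\<bar>N\<bar>..\<bar>N\<bar>}"
        then have n: "\<bar>N\<bar> < \<bar>n\<bar>" by auto
        then have n': "\<bar>real_of_int N\<bar> \<le> \<bar>real_of_int n\<bar>" "1 \<le> \<bar>real_of_int n\<bar>" by (simp_all flip: of_int_abs)
        have "\<theta> * sqrt \<bar>real_of_int n\<bar> \<le> 1 * \<bar>real_of_int n\<bar>"
          using assms n' by (intro mult_mono real_le_lsqrt self_le_power) auto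
        then have "\<theta> * sqrt \<bar>real_of_int n\<bar> \<le> 4 * \<bar>real_of_int n\<bar> + - 3 * \<bar>real_of_int N\<bar>" using n' by linarith
        then have "sw \<theta> n \<le> ew n * exp (- 3 * \<bar>of_int N\<bar>)" by (simp only: sw_def ew_def exp_add[symmetric] exp_le_cancel_iff)
        then show "norm (?b n) * sw \<theta> n \<le> norm (?b n) * ew n * exp (- 3 * \<bar>of_int N\<bar>)"
          by (simp add: mult.assoc mult_left_mono)
      qed
      also have "\<dots> = (\<Sum>n\<in>A - {-\<bar>N\<bar>..\<bar>N\<bar>}. norm (?b n) * ew n) * exp (- 3 * \<bar>of_int N\<bar>)" by (simp add: sum_distrib_right)
      also have "\<dots> \<le> exp (81 / 100 * \<bar>real_of_int N\<bar>) * exp (- 3 * \<bar>of_int N\<bar>)"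
        by (intro mult_right_mono wboundD[OF wbound_bessel_phase]) (use A in auto)
      also have "\<dots> \<le> 1" by (simp add: exp_add[symmetric])
      finally show ?thesis .
    qed
    ultimately show "(\<Sum>n\<in>A. norm (?b n) * sw \<theta> n) \<le> ?s * (2 * \<bar>of_int N\<bar> + 1) + 1" by linarith
  qed
  from wbound_shift[OF this submult_sw[OF assms(1)], of N]
  have "wbound (sw \<theta>) (sw \<theta> N * (?s * (2 * \<bar>of_int N\<bar> + 1) + 1)) (phase N)" by (simp only: phase_def)
  then show ?thesis
  proof (rule wbound_mono)
    have "1 \<le> ?s" using assms by simp
    then have "?s * (2 * \<bar>of_int N\<bar> + 1) + 1 \<le> ?s * (2 * \<bar>of_int N\<bar> + 2)" by (simp add: ring_distribs)
    then have "?s * (?s * (2 * \<bar>of_int N\<bar> + 1) + 1) \<le> ?s * (?s * (2 * \<bar>of_int N\<bar> + 2))" by (intro mult_left_mono) auto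
    also have "\<dots> = exp (2 * \<theta> * sqrt \<bar>of_int N\<bar>) * (2 * \<bar>of_int N\<bar> + 2)"
      by (simp add: mult.assoc[symmetric] exp_add[symmetric])
    finally show "sw \<theta> N * (?s * (2 * \<bar>of_int N\<bar> + 1) + 1) \<le> exp (2 * \<theta> * sqrt \<bar>of_int N\<bar>) * (2 * \<bar>of_int N\<bar> + 2)"
      by (simp add: sw_def)
  qed auto
qed

text \<open>The decay is 4 / z with z the cube root of |N| / 100; since 100 < 125, z is at least |N|
  powr (1 / 3) / 5.\<close>

lemma norm_phase_decay:
  assumes "N \<noteq> 0"
  shows "norm (phase N n) \<le> 20 * \<bar>real_of_int N\<bar> powr (- 1 / 3)"
proof -
  define y where "y = (\<bar>real_of_int N\<bar> powr (1 / 3)) / 5"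
  have y: "0 < y" using assms by (simp add: y_def)
  have y3: "y ^ 3 = \<bar>real_of_int N\<bar> / 125"
    using assms by (simp add: y_def power_divide powr_power)
  define z where "z = root 3 (\<bar>real_of_int N\<bar> / 100)"
  have z: "0 < z" "z ^ 3 = \<bar>real_of_int N\<bar> / 100" using assms by (auto simp: z_def)
  have "y ^ 3 \<le> z ^ 3" using y3 z by simp
  then have yz: "y \<le> z" using z by (intro power_le_imp_le_base[of y 2 z]) (auto simp: numeral_3_eq_3)
  have "norm (phase N n) \<le> 4 / z"
    unfolding phase_def shift_def by (rule norm_bessel_decay[OF z(1)]) (use z in simp)
  also have "\<dots> \<le> 4 / y" using y yz by (intro divide_left_mono) auto
  also have "\<dots> = 20 * \<bar>real_of_int N\<bar> powr (- 1 / 3)"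
    by (simp add: y_def powr_minus_divide)
  finally show ?thesis .
qed

text \<open>The substitute for a one-sided spectrum: at distance at least N / 2 from the centre the
  exponential weight beats the norm.\<close>

lemma norm_phase_left:
  assumes "1 \<le> N" "2 * n \<le> N"
  shows "norm (phase N n) \<le> exp (- of_int N)"
proof -
  have "norm (bessel (of_int N / 100) (n - N)) * ew (n - N) \<le> exp (81 / 100 * \<bar>real_of_int N\<bar>)"
    by (rule wbound_term[OF wbound_bessel_phase])
  moreover have "exp (2 * of_int N) \<le> ew (n - N)"
  proof -
    have "\<bar>n - N\<bar> = N - n" using assms by (subst abs_of_nonpos) auto
    then have "2 * N \<le> 4 * \<bar>n - N\<bar>" using assms(2) by simp
    then have "real_of_int (2 * N) \<le> real_of_int (4 * \<bar>n - N\<bar>)" by (simp only: of_int_le_iff)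
    then show ?thesis by (simp add: ew_def)
  qed
  ultimately have "norm (bessel (of_int N / 100) (n - N)) * exp (2 * of_int N) \<le> exp (81 / 100 * \<bar>real_of_int N\<bar>)"
    by (meson mult_left_mono norm_ge_zero order_trans)
  also have "\<dots> \<le> exp (- of_int N) * exp (2 * of_int N)" using assms by (simp add: exp_add[symmetric])
  finally show ?thesis by (simp add: phase_def shift_def)
qed

lemma phase_0: "phase 0 = unitseq"
  by (rule fser_unique[OF wbound_phase_weight[of 0 0] _ wbound_unitseq[of "\<lambda>_. 1"]])
     (auto simp: fser_phase fser_unitseq sw_ge_1)

section \<open>Composition with a high-frequency phase\<close>

definition compphase :: "(int \<Rightarrow> complex) \<Rightarrow> nat \<Rightarrow> int \<Rightarrow> complex" where
  "compphase q M n = (\<Sum>\<^sub>\<infinity>a. q a * phase (int M * a) n)"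

text \<open>The weight rate 1 / M is what composition can afford: the phase of frequency M * a then
  costs exp (2 sqrt |a| / sqrt M), at most exp (\<sigma> sqrt |a| / 2) by the hypothesis on M, and
  the other half of the rate \<sigma> absorbs the polynomial factor 2 M |a| + 2.\<close>

lemma compphase_bounds:
  assumes q: "wbound (sw \<sigma>) G q" and \<sigma>: "0 < \<sigma>" and M: "1 \<le> M" and s: "4 / sqrt M \<le> \<sigma>"
  shows "wbound (sw (1 / real M)) (2 * real M * (1 + 8 / \<sigma>\<^sup>2) * G) (compphase q M)"
    and "fser (compphase q M) t = fser q (M * (t + sin t / 100))"
    and "asum (\<lambda>a. q a * phase (int M * a) n)"
proof -
  let ?th = "1 / real M"
  let ?K = "\<lambda>a. exp (2 * ?th * sqrt \<bar>of_int (int M * a)\<bar>) * (2 * \<bar>of_int (int M * a)\<bar> + 2) :: real"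
  have th: "0 \<le> ?th" "?th \<le> 1" using M by auto
  have E: "wbound (sw ?th) (?K a) (phase (int M * a))" for a
    by (rule wbound_phase_weight[OF th])
  have K: "?K a \<le> (2 * real M * (1 + 8 / \<sigma>\<^sup>2)) * sw \<sigma> a" for a
  proof -
    define r where "r = sqrt \<bar>real_of_int a\<bar>"
    have r: "0 \<le> r" "\<bar>real_of_int a\<bar> = r\<^sup>2" by (auto simp: r_def)
    have "2 * ?th * sqrt \<bar>of_int (int M * a)\<bar> = 2 / sqrt M * r"
      using M by (simp add: r_def abs_mult real_sqrt_mult field_simps)
    also have "\<dots> \<le> \<sigma> / 2 * r" using s r by (intro mult_right_mono) auto
    finally have 1: "exp (2 * ?th * sqrt \<bar>of_int (int M * a)\<bar>) \<le> exp (\<sigma> / 2 * r)" by simp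
    have "(\<sigma> / 2 * r)\<^sup>2 / 2 \<le> exp (\<sigma> / 2 * r)"
    proof -
      have "0 \<le> \<sigma> / 2 * r" using r \<sigma> by simp
      from exp_lower_Taylor_quadratic[OF this] this show ?thesis by linarith
    qed
    then have "r\<^sup>2 \<le> 8 / \<sigma>\<^sup>2 * exp (\<sigma> / 2 * r)" using \<sigma> by (simp add: power_mult_distrib power_divide field_simps)
    moreover have "1 \<le> exp (\<sigma> / 2 * r)" using \<sigma> r by simp
    ultimately have "1 + r\<^sup>2 \<le> (1 + 8 / \<sigma>\<^sup>2) * exp (\<sigma> / 2 * r)"
      unfolding ring_distribs mult_1_left by linarith
    then have "2 * real M * (1 + r\<^sup>2) \<le> 2 * real M * ((1 + 8 / \<sigma>\<^sup>2) * exp (\<sigma> / 2 * r))" by (intro mult_left_mono) auto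
    moreover have "2 * \<bar>of_int (int M * a)\<bar> + 2 \<le> 2 * real M * (1 + r\<^sup>2)"
      using M r by (simp add: abs_mult ring_distribs)
    ultimately have 2: "2 * \<bar>of_int (int M * a)\<bar> + 2 \<le> 2 * real M * (1 + 8 / \<sigma>\<^sup>2) * exp (\<sigma> / 2 * r)" by linarith
    have "?K a \<le> exp (\<sigma> / 2 * r) * (2 * real M * (1 + 8 / \<sigma>\<^sup>2) * exp (\<sigma> / 2 * r))"
      by (intro mult_mono 1 2) auto
    also have "\<dots> = (2 * real M * (1 + 8 / \<sigma>\<^sup>2)) * (exp (\<sigma> / 2 * r) * exp (\<sigma> / 2 * r))" by (simp only: mult_ac)
    also have "exp (\<sigma> / 2 * r) * exp (\<sigma> / 2 * r) = sw \<sigma> a" by (simp add: sw_def r_def exp_add[symmetric])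
    finally show ?thesis .
  qed
  have K': "wbound ?K (2 * real M * (1 + 8 / \<sigma>\<^sup>2) * G) q"
    by (rule wbound_scale[OF q K]) auto
  have eq: "compphase q M = (\<lambda>n. \<Sum>\<^sub>\<infinity>a. q a * phase (int M * a) n)" by (auto simp: compphase_def)
  note S = superpose[of "sw ?th" ?K, OF E K' sw_ge_1[OF th(1)]]
  show "wbound (sw (1 / real M)) (2 * real M * (1 + 8 / \<sigma>\<^sup>2) * G) (compphase q M)" unfolding eq by (rule S(1))
  have "fser (compphase q M) t = (\<Sum>\<^sub>\<infinity>a. q a * fser (phase (int M * a)) t)" unfolding eq by (rule S(2))
  also have "\<dots> = fser q (M * (t + sin t / 100))"
    unfolding fser_phase fser_def[of q] by (intro infsum_cong) (simp add: mult_ac)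
  finally show "fser (compphase q M) t = fser q (M * (t + sin t / 100))" .
  show "asum (\<lambda>a. q a * phase (int M * a) n)" by (rule S(3))
qed

lemma compphase_diff:
  assumes "wbound (sw \<sigma>) G q" "wbound (sw \<sigma>) G' q'" "0 < \<sigma>" "1 \<le> M" "4 / sqrt M \<le> \<sigma>"
  shows "compphase (\<lambda>a. q a - q' a) M n = compphase q M n - compphase q' M n"
proof -
  have "((\<lambda>a. q a * phase (int M * a) n + - (q' a * phase (int M * a) n)) has_sum compphase q M n + - compphase q' M n) UNIV"
    unfolding compphase_def
    by (rule has_sum_add[OF has_sum_infsum has_sum_uminusI[OF has_sum_infsum]])
       (rule abs_summable_summable[OF compphase_bounds(3)[OF assms(1,3,4,5)]] abs_summable_summable[OF compphase_bounds(3)[OF assms(2,3,4,5)]])+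
  then show ?thesis unfolding compphase_def[of "\<lambda>a. q a - q' a"] by (intro infsumI) (simp add: left_diff_distrib)
qed

lemma compphase_unitseq: "compphase (\<lambda>a. z * unitseq a) M n = z * unitseq n"
proof -
  have "compphase (\<lambda>a. z * unitseq a) M n = (\<Sum>\<^sub>\<infinity>a. if a = 0 then z * phase (int M * a) n else 0)"
    unfolding compphase_def unitseq_def by (rule infsum_cong) auto
  then show ?thesis by (simp add: infsum_delta_int phase_0)
qed

text \<open>Only the support of \<open>q\<close> matters: a vanishing mean excludes the undamped
  phase at a = 0, and a one-sided \<open>q\<close> excludes negative frequencies.\<close>

lemma norm_compphase_le:
  assumes q: "wbound (sw \<sigma>) G q" and \<sigma>: "0 < \<sigma>" and B: "0 \<le> B"
    and le: "\<And>a. q a \<noteq> 0 \<Longrightarrow> norm (phase (int M * a) n) \<le> B"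
  shows "norm (compphase q M n) \<le> G * B"
proof -
  have "compphase q M n = (\<Sum>\<^sub>\<infinity>a. q a * (if q a = 0 then 0 else phase (int M * a) n))"
    unfolding compphase_def by (rule infsum_cong) auto
  also have "norm \<dots> \<le> G * B"
    by (rule wbound_mult_bounded(2)[OF q sw_ge_1]) (use \<sigma> B le in auto)
  finally show ?thesis .
qed

section \<open>Bump functions with rapidly decreasing coefficients\<close>

lemma avg_close:
  fixes g :: "real \<Rightarrow> real"
  assumes b: "0 < b" and g: "continuous_on {-b..b} g" and le: "\<And>u. u \<in> {-b..b} \<Longrightarrow> \<bar>g u - c\<bar> \<le> e"
  shows "\<bar>integral {-b..b} g / (2 * b) - c\<bar> \<le> e"
proof -
  have gi: "g integrable_on {-b..b}" using g by (rule integrable_continuous_interval)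
  have "integral {-b..b} (\<lambda>u. g u - c) = integral {-b..b} g - 2 * b * c"
    using b by (simp add: Henstock_Kurzweil_Integration.integral_diff[OF gi integrable_const_ivl])
  moreover have "norm (integral {-b..b} (\<lambda>u. g u - c)) \<le> e * (b - (-b))"
    by (rule integral_bound) (use b g le in \<open>auto intro!: continuous_intros\<close>)
  ultimately have "\<bar>integral {-b..b} g - 2 * b * c\<bar> \<le> e * (2 * b)" by simp
  moreover have "integral {-b..b} g / (2 * b) - c = (integral {-b..b} g - 2 * b * c) / (2 * b)"
    using b by (simp add: field_simps)
  ultimately show ?thesis using b by (simp add: abs_divide divide_le_eq)
qed

text \<open>Convolution with the normalized indicator of an arc of half-width \<open>b\<close>.
  Rotating the argument of a function on the plane makes periodicity automatic and keeps Lipschitz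
  constants.\<close>

definition angavg :: "real \<Rightarrow> (complex \<Rightarrow> real) \<Rightarrow> complex \<Rightarrow> real" where
  "angavg b F z = integral {-b..b} (\<lambda>u. F (z * cis u)) / (2 * b)"

lemma continuous_on_rotate:
  assumes "continuous_on UNIV F"
  shows "continuous_on A (\<lambda>u. F (z * cis u))"
  by (rule continuous_on_compose2[OF assms]) (auto intro!: continuous_intros)

lemma angavg_lipschitz:
  assumes b: "0 < b" and F: "continuous_on UNIV F" and L: "\<And>z z'. \<bar>F z - F z'\<bar> \<le> L * norm (z - z')"
  shows "\<bar>angavg b F z - angavg b F z'\<bar> \<le> L * norm (z - z')"
proof -
  have i: "(\<lambda>u. F (z * cis u)) integrable_on {-b..b}" for z
    by (intro integrable_continuous_interval continuous_on_rotate F)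
  have "\<bar>integral {-b..b} (\<lambda>u. F (z * cis u) - F (z' * cis u)) / (2 * b) - 0\<bar> \<le> L * norm (z - z')"
  proof (rule avg_close[OF b])
    fix u
    have "\<bar>F (z * cis u) - F (z' * cis u)\<bar> \<le> L * norm (z * cis u - z' * cis u)" by (rule L)
    also have "norm (z * cis u - z' * cis u) = norm (z - z')"
      by (simp add: left_diff_distrib[symmetric] norm_mult)
    finally show "\<bar>F (z * cis u) - F (z' * cis u) - 0\<bar> \<le> L * norm (z - z')" by simp
  qed (intro continuous_intros continuous_on_rotate F)
  then show ?thesis
    unfolding angavg_def by (simp add: Henstock_Kurzweil_Integration.integral_diff[OF i i] diff_divide_distrib)
qed

lemma lipschitz_imp_continuous:
  fixes F :: "complex \<Rightarrow> real"
  assumes L: "\<And>z z'. \<bar>F z - F z'\<bar> \<le> L * norm (z - z')"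
  shows "continuous_on UNIV F"
proof -
  have "0 \<le> L" using order_trans[OF abs_ge_zero L[of 1 0]] by simp
  then have "L-lipschitz_on UNIV F" using L by (auto simp: lipschitz_on_def dist_norm)
  then show ?thesis by (rule lipschitz_on_continuous_on)
qed

section \<open>Fourier coefficients of arc averages\<close>

lemma integral_shift_period:
  fixes G :: "real \<Rightarrow> complex"
  assumes G: "continuous_on UNIV G" and per: "\<And>t. G (t + 2 * pi) = G t"
  shows "integral {-pi..pi} (\<lambda>t. G (t + u)) = integral {-pi..pi} G"
proof -
  have int: "G integrable_on {a..b}" for a b
    using G by (intro integrable_continuous_interval) (auto intro: continuous_on_subset)
  have sh: "integral {a..b} (\<lambda>t. G (t + v)) = integral {a + v..b + v} G" for a b v
    using integral_shift_Icc_real[of a b G v] by (simp add: o_def add.commute)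
  have per': "integral {a..b} G = integral {a + 2 * pi..b + 2 * pi} G" for a b
    using sh[of a b "2 * pi"] by (simp add: per)
  have main: "integral {-pi + v..pi + v} G = integral {-pi..pi} G" if v: "0 \<le> v" "v \<le> 2 * pi" for v
  proof -
    have 1: "integral {-pi..-pi + v} G + integral {-pi + v..pi + v} G = integral {-pi..pi + v} G"
      by (rule Henstock_Kurzweil_Integration.integral_combine) (use v int in auto)
    have 2: "integral {-pi..pi} G + integral {pi..pi + v} G = integral {-pi..pi + v} G"
      by (rule Henstock_Kurzweil_Integration.integral_combine) (use v int in auto)
    have 3: "integral {-pi..-pi + v} G = integral {pi..pi + v} G"
      using per'[of "-pi" "-pi + v"] by simp
    from 1 2 3 show ?thesis by (metis add.commute add_left_cancel)
  qed
  have step: "integral {-pi + (v + 2 * pi)..pi + (v + 2 * pi)} G = integral {-pi + v..pi + v} G" for v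
    using per'[of "-pi + v" "pi + v"] by (simp add: add.assoc)
  have nat: "integral {-pi + (v + 2 * pi * real k)..pi + (v + 2 * pi * real k)} G = integral {-pi + v..pi + v} G" for v k
  proof (induction k)
    case (Suc k)
    have "v + 2 * pi * real (Suc k) = (v + 2 * pi * real k) + 2 * pi" by (simp add: algebra_simps)
    then show ?case using step[of "v + 2 * pi * real k"] Suc by simp
  qed simp
  define m where "m = \<lfloor>u / (2 * pi)\<rfloor>"
  define v where "v = u - 2 * pi * of_int m"
  have "of_int m \<le> u / (2 * pi)" "u / (2 * pi) < of_int m + 1" unfolding m_def by linarith+
  then have v: "0 \<le> v" "v \<le> 2 * pi" by (auto simp: v_def field_simps)
  have "integral {-pi + u..pi + u} G = integral {-pi + v..pi + v} G"
  proof (cases "m \<ge> 0")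
    case True
    then show ?thesis using nat[of v "nat m"] by (simp add: v_def)
  next
    case False
    then show ?thesis using nat[of u "nat (-m)"] by (simp add: v_def)
  qed
  then show ?thesis using main[OF v] sh[of "-pi" pi u] by simp
qed

definition circoeff :: "(complex \<Rightarrow> real) \<Rightarrow> int \<Rightarrow> complex" where
  "circoeff F n = integral {-pi..pi} (\<lambda>t. of_real (F (cis t)) * cis (- of_int n * t)) / of_real (2 * pi)"

text \<open>The Fourier multiplier of \<open>angavg b\<close>; for b > 0 and n \<noteq> 0 it is sin
  (n b) / (n b).\<close>

definition boxmult :: "int \<Rightarrow> real \<Rightarrow> complex" where
  "boxmult n b = integral {-b..b} (\<lambda>u. cis (of_int n * u)) / of_real (2 * b)"

text \<open>By Fubini and periodicity: rotation by u multiplies the coefficient by exp (i n u), and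
  averaging over u gives the multiplier.\<close>

lemma circoeff_angavg:
  assumes b: "0 < b" and F: "continuous_on UNIV F"
  shows "circoeff (angavg b F) n = circoeff F n * boxmult n b"
proof -
  let ?G = "\<lambda>t. of_real (F (cis t)) * cis (- of_int n * t)"
  have cG: "continuous_on UNIV ?G"
    by (intro continuous_intros continuous_on_compose2[OF F]) auto
  have per: "?G (t + 2 * pi) = ?G t" for t
  proof -
    have "cis (- of_int n * (t + 2 * pi)) = cis (- of_int n * t) * cis (2 * pi * of_int (- n))"
      unfolding cis_mult by (simp add: algebra_simps)
    also have "cis (2 * pi * of_int (- n)) = 1" by (rule cis_multiple_2pi) auto
    finally show ?thesis by (simp add: cis_mult[symmetric])
  qed
  have i: "(\<lambda>u. F (cis t * cis u)) integrable_on {-b..b}" for t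
    by (intro integrable_continuous_interval continuous_on_rotate F)
  have c2: "continuous_on (cbox (-pi, -b) (pi, b)) (\<lambda>(t, u). of_real (F (cis t * cis u)) * cis (- of_int n * t))"
    unfolding case_prod_beta by (intro continuous_intros continuous_on_compose2[OF F]) auto
  have "integral {-pi..pi} (\<lambda>t. of_real (angavg b F (cis t)) * cis (- of_int n * t))
      = integral {-pi..pi} (\<lambda>t. integral {-b..b} (\<lambda>u. of_real (F (cis t * cis u)) * cis (- of_int n * t)) / of_real (2 * b))"
  proof (rule Henstock_Kurzweil_Integration.integral_cong)
    fix t
    have "complex_of_real (integral {-b..b} (\<lambda>u. F (cis t * cis u))) = integral {-b..b} (\<lambda>u. of_real (F (cis t * cis u)))"
      using integral_linear[OF i[of t], of complex_of_real, OF bounded_linear_of_real] by (simp add: o_def)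
    then show "of_real (angavg b F (cis t)) * cis (- of_int n * t)
        = integral {-b..b} (\<lambda>u. of_real (F (cis t * cis u)) * cis (- of_int n * t)) / of_real (2 * b)"
      unfolding angavg_def by (simp add: Henstock_Kurzweil_Integration.integral_mult_left)
  qed
  also have "\<dots> = integral {-pi..pi} (\<lambda>t. integral {-b..b} (\<lambda>u. of_real (F (cis t * cis u)) * cis (- of_int n * t))) / of_real (2 * b)"
    by (rule Henstock_Kurzweil_Integration.integral_divide)
  also have "integral {-pi..pi} (\<lambda>t. integral {-b..b} (\<lambda>u. of_real (F (cis t * cis u)) * cis (- of_int n * t)))
     = integral {-b..b} (\<lambda>u. integral {-pi..pi} (\<lambda>t. of_real (F (cis t * cis u)) * cis (- of_int n * t)))"
    using integral_swap_continuous[OF c2] by simp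
  also have "\<dots> = integral {-b..b} (\<lambda>u. cis (of_int n * u) * integral {-pi..pi} ?G)"
  proof (rule Henstock_Kurzweil_Integration.integral_cong)
    fix u
    have "integral {-pi..pi} (\<lambda>t. of_real (F (cis t * cis u)) * cis (- of_int n * t))
       = integral {-pi..pi} (\<lambda>t. cis (of_int n * u) * ?G (t + u))"
    proof (rule Henstock_Kurzweil_Integration.integral_cong)
      fix t
      have "cis (- of_int n * t) = cis (of_int n * u) * cis (- of_int n * (t + u))"
        unfolding cis_mult by (simp add: algebra_simps)
      then show "of_real (F (cis t * cis u)) * cis (- of_int n * t) = cis (of_int n * u) * ?G (t + u)"
        by (simp add: cis_mult mult_ac)
    qed
    also have "\<dots> = cis (of_int n * u) * integral {-pi..pi} (\<lambda>t. ?G (t + u))"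
      by (rule Henstock_Kurzweil_Integration.integral_mult_right)
    also have "integral {-pi..pi} (\<lambda>t. ?G (t + u)) = integral {-pi..pi} ?G"
      by (rule integral_shift_period[OF cG per])
    finally show "integral {-pi..pi} (\<lambda>t. of_real (F (cis t * cis u)) * cis (- of_int n * t)) = cis (of_int n * u) * integral {-pi..pi} ?G" .
  qed
  also have "\<dots> = integral {-b..b} (\<lambda>u. cis (of_int n * u)) * integral {-pi..pi} ?G"
    by (rule Henstock_Kurzweil_Integration.integral_mult_left)
  finally show ?thesis by (simp add: circoeff_def boxmult_def mult_ac)
qed

lemma norm_boxmult_le_1: "0 < b \<Longrightarrow> norm (boxmult n b) \<le> 1"
proof -
  assume b: "0 < b"
  have "norm (integral {-b..b} (\<lambda>u. cis (of_int n * u))) \<le> 1 * (b - (-b))"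
    by (rule integral_bound) (use b in \<open>auto intro!: continuous_intros\<close>)
  then show ?thesis using b by (simp add: boxmult_def norm_divide divide_le_eq)
qed

lemma norm_boxmult_le:
  assumes b: "0 < b" and n: "n \<noteq> 0"
  shows "norm (boxmult n b) \<le> 1 / (\<bar>of_int n\<bar> * b)"
proof -
  have d: "((\<lambda>t. cis (of_int n * t) / (\<i> * of_int n)) has_vector_derivative cis (of_int n * t)) (at t within {-b..b})" for t
  proof -
    have "((\<lambda>t. exp (\<i> * of_int n * of_real t) / (\<i> * of_int n)) has_vector_derivative exp (\<i> * of_int n * of_real t)) (at t within {-b..b})"
      by (rule has_vector_derivative_real_field) (use n in \<open>auto intro!: derivative_eq_intros simp: field_simps\<close>)
    then show ?thesis by (simp add: cis_conv_exp mult_ac)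
  qed
  have "((\<lambda>t. cis (of_int n * t)) has_integral
     (cis (of_int n * b) / (\<i> * of_int n) - cis (of_int n * (-b)) / (\<i> * of_int n))) {-b..b}"
    by (rule fundamental_theorem_of_calculus) (use d b in auto)
  then have "integral {-b..b} (\<lambda>u. cis (of_int n * u)) = cis (of_int n * b) / (\<i> * of_int n) - cis (of_int n * (-b)) / (\<i> * of_int n)"
    by (rule integral_unique)
  also have "norm \<dots> \<le> norm (cis (of_int n * b) / (\<i> * of_int n)) + norm (cis (of_int n * (-b)) / (\<i> * of_int n))"
    by (rule norm_triangle_ineq4)
  also have "\<dots> = 2 / \<bar>of_int n\<bar>" by (simp add: norm_divide norm_mult)
  finally have "norm (integral {-b..b} (\<lambda>u. cis (of_int n * u))) / (2 * b) \<le> 2 / \<bar>of_int n\<bar> / (2 * b)"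
    using b by (intro divide_right_mono) auto
  then show ?thesis using b by (simp add: boxmult_def norm_divide norm_mult)
qed

text \<open>The continuous functions orthogonal to all characters form a space closed under
  multiplication by characters. On the circle a real linear form is a combination of cis t and cis
  (- t), so induction over polynomials gives closure under multiplication by every real
  polynomial.\<close>

lemma trig_real_polynomial_orthogonal:
  fixes D :: "real \<Rightarrow> complex"
  assumes p: "real_polynomial_function p"
    and D: "continuous_on UNIV D" "\<And>n::int. integral {-pi..pi} (\<lambda>t. D t * cis (of_int n * t)) = 0"
  shows "integral {-pi..pi} (\<lambda>t. D t * of_real (p (cis t)) * cis (of_int n * t)) = 0"
proof -
  define Z where "Z = {D :: real \<Rightarrow> complex. continuous_on UNIV D \<and> (\<forall>n::int. integral {-pi..pi} (\<lambda>t. D t * cis (of_int n * t)) = 0)}"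
  have I: "(\<lambda>t. D t * cis (of_int n * t)) integrable_on {-pi..pi}" if "D \<in> Z" for D and n :: int
  proof (intro integrable_continuous_interval continuous_intros)
    show "continuous_on {-pi..pi} D" using that by (auto simp: Z_def intro: continuous_on_subset)
  qed
  have add: "(\<lambda>t. D t + E t) \<in> Z" if "D \<in> Z" "E \<in> Z" for D E
    using that Henstock_Kurzweil_Integration.integral_add[OF I[OF that(1)] I[OF that(2)]]
    by (auto simp: Z_def distrib_right intro!: continuous_intros)
  have scale: "(\<lambda>t. z * D t) \<in> Z" if "D \<in> Z" for D z
    using that by (auto simp: Z_def mult.assoc intro!: continuous_intros)
  have cs: "(\<lambda>t. cis (of_int m * t) * D t) \<in> Z" if "D \<in> Z" for D and m :: int
  proof -
    have "integral {-pi..pi} (\<lambda>t. cis (of_int m * t) * D t * cis (of_int n * t)) = 0" for n :: int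
    proof -
      have "cis (of_int m * t) * D t * cis (of_int n * t) = D t * cis (of_int (m + n) * t)" for t
      proof -
        have "cis (of_int (m + n) * t) = cis (of_int m * t) * cis (of_int n * t)"
          by (simp add: cis_mult ring_distribs)
        then show ?thesis by (simp only: mult_ac)
      qed
      moreover have "integral {-pi..pi} (\<lambda>t. D t * cis (of_int (m + n) * t)) = 0" using that by (simp only: Z_def mem_Collect_eq)
      ultimately show ?thesis by (simp only:)
    qed
    then show ?thesis using that by (auto simp: Z_def intro!: continuous_intros)
  qed
  have "\<forall>D\<in>Z. (\<lambda>t. of_real (p (cis t)) * D t) \<in> Z" using p
  proof (induction p rule: real_polynomial_function.induct)
    case (linear f)
    show ?case
    proof
      fix D assume D: "D \<in> Z"
      have e: "f z = Re z * f 1 + Im z * f \<i>" for z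
      proof -
        interpret f: bounded_linear f by fact
        have "f z = f (Re z *\<^sub>R 1 + Im z *\<^sub>R \<i>)" by (rule arg_cong[of _ _ f]) (simp add: complex_eq_iff)
        then show ?thesis by (simp only: f.add f.scaleR real_scaleR_def)
      qed
      have e1: "of_real (cos t) = (cis t + cis (- t)) / 2" for t by (simp add: complex_eq_iff)
      have e2: "of_real (sin t) = - \<i> * ((cis t - cis (- t)) / 2)" for t by (simp add: complex_eq_iff)
      let ?a = "complex_of_real (f 1)" and ?b = "complex_of_real (f \<i>)"
      have "(\<lambda>t. of_real (f (cis t)) * D t) = (\<lambda>t. ((?a - \<i> * ?b) / 2) * (cis (of_int 1 * t) * D t) + ((?a + \<i> * ?b) / 2) * (cis (of_int (-1) * t) * D t))"
      proof
        fix t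
        have "complex_of_real (f (cis t)) = of_real (cos t) * ?a + of_real (sin t) * ?b" by (subst e) simp
        also have "\<dots> = ((?a - \<i> * ?b) / 2) * cis t + ((?a + \<i> * ?b) / 2) * cis (- t)"
          unfolding e1 e2 by (simp add: field_simps)
        finally show "of_real (f (cis t)) * D t = ((?a - \<i> * ?b) / 2) * (cis (of_int 1 * t) * D t) + ((?a + \<i> * ?b) / 2) * (cis (of_int (-1) * t) * D t)"
          by (simp add: ring_distribs mult.assoc)
      qed
      then show "(\<lambda>t. of_real (f (cis t)) * D t) \<in> Z" by (simp only:) (intro add scale cs D)
    qed
  next
    case (const c)
    then show ?case by (auto intro: scale)
  next
    case (add f g)
    then show ?case using \<open>\<And>D E. D \<in> Z \<Longrightarrow> E \<in> Z \<Longrightarrow> (\<lambda>t. D t + E t) \<in> Z\<close> by (simp add: distrib_right)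
  next
    case (mult f g)
    show ?case
    proof
      fix D assume "D \<in> Z"
      then have "(\<lambda>t. of_real (g (cis t)) * D t) \<in> Z" using mult by blast
      from bspec[OF mult(3) this]
      have "(\<lambda>t. of_real (f (cis t)) * (of_real (g (cis t)) * D t)) \<in> Z" .
      then show "(\<lambda>t. of_real (f (cis t) * g (cis t)) * D t) \<in> Z" by (simp add: mult.assoc)
    qed
  qed
  moreover have "D \<in> Z" using D by (simp add: Z_def)
  ultimately have "(\<lambda>t. of_real (p (cis t)) * D t) \<in> Z" by blast
  then show ?thesis by (simp add: Z_def mult.commute)
qed

lemma norm_powi_unit: "norm z = 1 \<Longrightarrow> norm (z powi n) = (1::real)" for z :: complex
  by (simp add: norm_power_int)

lemma cis_powi: "cis t powi n = cis (of_int n * t)"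
  by (simp add: power_int_def Complex.DeMoivre cis_inverse flip: power_inverse)

text \<open>The difference between F and its absolutely convergent series is continuous on the
  circle with vanishing coefficients. By Stone-Weierstrass it is orthogonal to all continuous real
  functions, in particular to its own real and imaginary parts, so its square norm vanishes.\<close>

lemma fourier_inversion:
  fixes F :: "complex \<Rightarrow> real"
  assumes F: "continuous_on UNIV F" and K: "wbound (\<lambda>_. 1) K (circoeff F)"
  shows "fser (circoeff F) t = of_real (F (cis t))"
proof -
  let ?a = "circoeff F"
  \<comment> \<open>Integer powers of z make the series a function on the compact circle, where
    polynomial approximation applies.\<close>
  define H where "H z = (\<Sum>\<^sub>\<infinity>n. ?a n * z powi n)" for z
  have Hc: "fser ?a t = H (cis t)" for t unfolding fser_def H_def by (simp add: cis_powi)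
  have cH: "continuous_on (sphere 0 1) H"
  proof (rule uniform_limit_theorem)
    show "uniform_limit (sphere 0 1) (\<lambda>A z. \<Sum>n\<in>A. ?a n * z powi n) H (finite_subsets_at_top UNIV)"
      unfolding H_def
      by (rule Weierstrass_m_test_general[where M="\<lambda>n. norm (?a n)"])
         (use wbound_abs_summable[OF K] in \<open>auto simp: norm_mult norm_powi_unit\<close>)
    show "\<forall>\<^sub>F A in finite_subsets_at_top UNIV. continuous_on (sphere 0 1) (\<lambda>z. \<Sum>n\<in>A. ?a n * z powi n)"
      by (intro always_eventually allI continuous_intros) auto
  qed auto
  define E where "E z = of_real (F z) - H z" for z
  have cE: "continuous_on (sphere 0 1) E"
    unfolding E_def by (intro continuous_intros cH continuous_on_subset[OF F]) auto
  define D where "D t = E (cis t)" for t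
  have cD: "continuous_on A D" for A
    unfolding D_def by (rule continuous_on_compose2[OF cE]) (auto intro!: continuous_intros)
  have "continuous_on (sphere 0 1) (\<lambda>z. norm (E z))" by (intro continuous_intros cE)
  then have "bounded ((\<lambda>z. norm (E z)) ` sphere 0 1)"
    by (intro compact_imp_bounded compact_continuous_image) auto
  then obtain B where "\<forall>z\<in>sphere 0 1. norm (E z) \<le> B" by (auto simp: bounded_iff)
  then have B: "norm (E z) \<le> B" if "norm z = 1" for z using that by simp
  have B0: "0 \<le> B" using order_trans[OF norm_ge_zero B[of 1]] by simp
  have Fi: "(\<lambda>t. of_real (F (cis t)) * cis (of_int n * t)) integrable_on {-pi..pi}" for n :: int
    by (intro integrable_continuous_interval continuous_intros continuous_on_compose2[OF F]) auto
  have coeff: "integral {-pi..pi} (\<lambda>t. D t * cis (of_int n * t)) = 0" for n :: int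
  proof -
    have 1: "((\<lambda>t. of_real (F (cis t)) * cis (of_int n * t)) has_integral of_real (2 * pi) * ?a (- n)) {-pi..pi}"
      using integrable_integral[OF Fi[of n]] by (simp add: circoeff_def)
    have 2: "((\<lambda>t. fser ?a t * cis (of_int n * t)) has_integral of_real (2 * pi) * ?a (- n)) {-pi..pi}"
      using fser_coeff[OF K, of "- n"] by simp
    from has_integral_diff[OF 1 2] show ?thesis
      by (intro integral_unique) (simp add: D_def E_def Hc left_diff_distrib)
  qed
  have orth: "integral {-pi..pi} (\<lambda>t. D t * of_real (g (cis t))) = 0" if g: "continuous_on (sphere 0 1) g" for g :: "complex \<Rightarrow> real"
  proof -
    let ?I = "integral {-pi..pi} (\<lambda>t. D t * of_real (g (cis t)))"
    have "norm ?I \<le> e" if "0 < e" for e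
    proof -
      define d where "d = e / (2 * pi * (B + 1))"
      have d: "0 < d" using that B0 by (simp add: d_def)
      obtain p where p: "real_polynomial_function p" "\<And>z. z \<in> sphere 0 1 \<Longrightarrow> \<bar>g z - p z\<bar> < d"
        using Stone_Weierstrass_real_polynomial_function[OF compact_sphere g d] by metis
      have cp: "continuous_on A p" for A
        using continuous_on_polymonial_function p(1) real_polynomial_function_eq by blast
      have gi: "(\<lambda>t. D t * of_real (g (cis t))) integrable_on {-pi..pi}"
        by (intro integrable_continuous_interval continuous_intros cD continuous_on_compose2[OF g]) auto
      have pI: "(\<lambda>t. D t * of_real (p (cis t))) integrable_on {-pi..pi}"
        by (intro integrable_continuous_interval continuous_intros cD continuous_on_compose2[OF cp[of UNIV]]) auto
      have "integral {-pi..pi} (\<lambda>t. D t * of_real (p (cis t))) = 0"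
        using trig_real_polynomial_orthogonal[OF p(1) cD coeff, of 0] by simp
      then have "?I = integral {-pi..pi} (\<lambda>t. D t * of_real (g (cis t)) - D t * of_real (p (cis t)))"
        by (simp add: Henstock_Kurzweil_Integration.integral_diff[OF gi pI])
      also have "norm \<dots> \<le> (B * d) * (pi - (-pi))"
      proof (rule integral_bound)
        show "continuous_on {-pi..pi} (\<lambda>t. D t * of_real (g (cis t)) - D t * of_real (p (cis t)))"
          by (intro continuous_intros cD continuous_on_compose2[OF cp[of UNIV]] continuous_on_compose2[OF g]) auto
        fix t
        have "norm (D t * of_real (g (cis t)) - D t * of_real (p (cis t))) = norm (D t) * \<bar>g (cis t) - p (cis t)\<bar>"
          by (simp add: right_diff_distrib[symmetric] norm_mult flip: of_real_diff)
        also have "\<dots> \<le> B * d"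
          using p(2)[of "cis t"] B[of "cis t"] by (intro mult_mono) (auto simp: D_def B0 less_imp_le)
        finally show "norm (D t * of_real (g (cis t)) - D t * of_real (p (cis t))) \<le> B * d" .
      qed auto
      also have "\<dots> \<le> (B + 1) * d * (2 * pi)" using d by (simp add: mult_right_mono algebra_simps)
      also have "\<dots> = e / (2 * pi * (B + 1)) * (2 * pi * (B + 1))" unfolding d_def by (simp only: mult_ac)
      also have "\<dots> = e" by (subst times_divide_eq_left, subst nonzero_mult_div_cancel_right) (use B0 in auto)
      finally show ?thesis .
    qed
    then have "norm ?I \<le> 0" by (rule field_le_epsilon[of _ 0, simplified]) auto
    then show ?thesis by simp
  qed
  have DR: "integral {-pi..pi} (\<lambda>t. D t * of_real (Re (D t))) = 0" "integral {-pi..pi} (\<lambda>t. D t * of_real (Im (D t))) = 0"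
    using orth[of "\<lambda>z. Re (E z)"] orth[of "\<lambda>z. Im (E z)"] cE by (auto simp: D_def intro!: continuous_intros)
  have i: "(\<lambda>t. D t * of_real (Re (D t))) integrable_on {-pi..pi}" "(\<lambda>t. \<i> * (D t * of_real (Im (D t)))) integrable_on {-pi..pi}"
    by (intro integrable_continuous_interval continuous_intros cD)+
  have "integral {-pi..pi} (\<lambda>t. D t * of_real (Re (D t)) - \<i> * (D t * of_real (Im (D t)))) = 0"
    by (simp add: Henstock_Kurzweil_Integration.integral_diff[OF i] DR)
  moreover have "D t * of_real (Re (D t)) - \<i> * (D t * of_real (Im (D t))) = of_real ((norm (D t))\<^sup>2)" for t
    unfolding cmod_power2 by (simp add: complex_eq_iff power2_eq_square)
  ultimately have "integral {-pi..pi} (\<lambda>t. complex_of_real ((norm (D t))\<^sup>2)) = 0" by simp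
  moreover have ni: "(\<lambda>t. (norm (D t))\<^sup>2) integrable_on {-pi..pi}"
    by (intro integrable_continuous_interval continuous_intros cD)
  ultimately have "integral {-pi..pi} (\<lambda>t. (norm (D t))\<^sup>2) = 0"
    using integral_linear[OF ni, of complex_of_real, OF bounded_linear_of_real] by (simp add: o_def)
  then have "\<forall>t\<in>{-pi..pi}. (norm (D t))\<^sup>2 = 0"
    by (subst (asm) integral_eq_0_iff) (auto intro!: continuous_intros cD)
  then have D0: "D s = 0" if "s \<in> {-pi..pi}" for s using that by simp
  \<comment> \<open>The integral covers one period only; the principal argument carries an arbitrary
    t into it.\<close>
  have "D (Arg (cis t)) = 0" using Arg_bounded[of "cis t"] by (intro D0) auto
  moreover have "cis (Arg (cis t)) = cis t" using cis_Arg[of "cis t"] by (simp add: sgn_eq)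
  ultimately have "E (cis t) = 0" by (simp add: D_def)
  then show ?thesis by (simp add: E_def Hc)
qed

text \<open>The initial ramp runs from angle 5 / 8 w to angle 7 / 8 w. The averages move either edge
  by at most w / 8 in total, which leaves value 1 up to w / 2 and value 0 from w on.\<close>

primrec bumpiter :: "real \<Rightarrow> nat \<Rightarrow> complex \<Rightarrow> real" where
  "bumpiter w 0 z = max 0 (min 1 ((Re z - cos (7 / 8 * w)) / (cos (5 / 8 * w) - cos (7 / 8 * w))))"
| "bumpiter w (Suc j) z = angavg (w / (16 * (real j + 1)\<^sup>2)) (bumpiter w j) z"


lemma sum_box_widths_le: "(\<Sum>i<j. w / (16 * (real i + 1)\<^sup>2)) \<le> w / 8" if "0 \<le> w"
proof -
  have S: "(\<Sum>i<Suc j. 1 / (real i + 1)\<^sup>2) \<le> 2 - 1 / (real j + 1)" for j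
  proof (induction j)
    case (Suc j)
    have "1 / (real j + 2)\<^sup>2 \<le> 1 / ((real j + 1) * (real j + 2))"
      by (intro divide_left_mono) (auto simp: power2_eq_square)
    also have "\<dots> = 1 / (real j + 1) - 1 / (real j + 2)" by (simp add: field_simps)
    finally show ?case using Suc by (simp add: add_ac)
  qed simp
  have "(\<Sum>i<j. 1 / (real i + 1)\<^sup>2) \<le> 2"
  proof (cases j)
    case (Suc k)
    have "0 \<le> 1 / (real k + 1)" by simp
    then show ?thesis unfolding Suc using S[of k] by linarith
  qed simp
  then have "w / 16 * (\<Sum>i<j. 1 / (real i + 1)\<^sup>2) \<le> w / 16 * 2" using that by (intro mult_left_mono) auto
  then show ?thesis by (simp add: sum_distrib_left)
qed

lemma norm_cis_minus_1_le: "norm (cis u - 1) \<le> \<bar>u\<bar>"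
  using dist_exp_i_1[of u] abs_sin_x_le_abs_x[of "u / 2"] by (simp add: cis_conv_exp)

text \<open>The free p is taken close to sqrt X / 7: each factor is then at most 16 / 49 <= 1 / 3 <=
  exp (- 1), so the power is at most exp (- p), and rounding p down costs a factor exp 1 <= 3. This
  is the origin of the square root in the decay.\<close>

lemma box_decay_bound:
  assumes X: "0 < X" and le: "\<And>p. r \<le> (16 * (real p)\<^sup>2 / X) ^ p"
  shows "r \<le> 3 * exp (- sqrt X / 7)"
proof -
  define p where "p = nat \<lfloor>sqrt X / 7\<rfloor>"
  have s: "0 < sqrt X / 7" using X by simp
  have p: "real p \<le> sqrt X / 7" "sqrt X / 7 < real p + 1" using s unfolding p_def by linarith+
  have "(real p)\<^sup>2 \<le> (sqrt X / 7)\<^sup>2" using p by (intro power_mono) auto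
  then have "16 * (real p)\<^sup>2 / X \<le> 1 / 3" using X by (simp add: power_divide field_simps)
  moreover have "1 / 3 \<le> exp (- 1 :: real)" using exp_le by (simp add: exp_minus field_simps)
  ultimately have "16 * (real p)\<^sup>2 / X \<le> exp (- 1)" by linarith
  then have "(16 * (real p)\<^sup>2 / X) ^ p \<le> exp (- 1) ^ p" using X by (intro power_mono) auto
  also have "\<dots> = exp (- real p)" using exp_of_nat_mult[of p "-1::real"] by simp
  also have "\<dots> \<le> exp (1 + - sqrt X / 7)" using p by simp
  also have "\<dots> = exp 1 * exp (- sqrt X / 7)" by (rule exp_add)
  also have "\<dots> \<le> 3 * exp (- sqrt X / 7)" by (intro mult_right_mono exp_le) auto
  finally show ?thesis using le[of p] by linarith
qed

text \<open>
  A trapezoidal profile is averaged over arcs of half-widths \<open>w / (16 (j + 1)\<^sup>2)\<close>. The widths sum to at most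
  \<open>w / 8\<close>, so the support stays in place, and the \<open>n\<close>-th coefficient gains a factor
  \<open>16 (j + 1)\<^sup>2 / (\<bar>n\<bar> w)\<close> at each step.
\<close>

lemma bump_exists:
  assumes w: "0 < w" "w \<le> 1"
  shows "\<exists>a h. (\<forall>n. norm (a n) \<le> 3 * exp (- sqrt (\<bar>real_of_int n\<bar> * w) / 7)) \<and>
    (\<forall>K. wbound (\<lambda>_. 1) K a \<longrightarrow> (\<forall>t. fser a t = complex_of_real (h t))) \<and>
    (\<forall>t. 0 \<le> h t \<and> h t \<le> 1) \<and> (\<forall>t. cos (w / 2) \<le> cos t \<longrightarrow> h t = 1) \<and>
    (\<forall>t. cos t \<le> cos w \<longrightarrow> h t = 0)"
proof -
  let ?G = "bumpiter w"
  define b where "b j = w / (16 * (real j + 1)\<^sup>2)" for j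
  have b0: "0 < b j" for j using w by (simp add: b_def)
  have bsum: "(\<Sum>i<j. b i) \<le> w / 8" for j unfolding b_def using sum_box_widths_le w by simp
  have Suc: "?G (Suc j) = angavg (b j) (?G j)" for j by (auto simp: b_def)
  define c7 where "c7 = cos (7 / 8 * w)"
  define \<kappa> where "\<kappa> = cos (5 / 8 * w) - c7"
  have \<kappa>: "0 < \<kappa>" unfolding \<kappa>_def c7_def using w pi_gt3 by (simp add: cos_monotone_0_pi)
  define L where "L = 1 / \<kappa>"
  have L0: "0 \<le> L" using \<kappa> by (simp add: L_def)
  have G0: "?G 0 z = max 0 (min 1 ((Re z - c7) / \<kappa>))" for z by (simp add: c7_def \<kappa>_def)
  \<comment> \<open>Averaging keeps the Lipschitz constant of the ramp, so it is uniform in j and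
    passes to the limit.\<close>
  have lip: "\<bar>?G j z - ?G j z'\<bar> \<le> L * norm (z - z')" for j z z'
  proof (induction j arbitrary: z z')
    case 0
    have "\<bar>?G 0 z - ?G 0 z'\<bar> \<le> \<bar>(Re z - c7) / \<kappa> - (Re z' - c7) / \<kappa>\<bar>" unfolding G0 by linarith
    also have "\<dots> = L * \<bar>Re (z - z')\<bar>" using \<kappa> by (simp add: L_def abs_divide flip: diff_divide_distrib)
    also have "\<dots> \<le> L * norm (z - z')" by (intro mult_left_mono abs_Re_le_cmod L0)
    finally show ?case .
  next
    case (Suc j)
    then show ?case unfolding \<open>\<And>j. ?G (Suc j) = angavg (b j) (?G j)\<close>
      by (intro angavg_lipschitz b0 lipschitz_imp_continuous[of _ L])
  qed
  have cont: "continuous_on UNIV (?G j)" for j by (rule lipschitz_imp_continuous[OF lip])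
  have avg: "\<bar>?G (Suc j) z - c\<bar> \<le> e" if "\<And>u. u \<in> {- b j..b j} \<Longrightarrow> \<bar>?G j (z * cis u) - c\<bar> \<le> e" for j z c e
    unfolding Suc angavg_def using that by (intro avg_close b0 continuous_on_rotate cont)
  have rng: "\<bar>?G j z - 1 / 2\<bar> \<le> 1 / 2" for j z
  proof (induction j arbitrary: z)
    case 0 show ?case unfolding G0 by (auto simp: max_def min_def abs_if)
  next
    case (Suc j) then show ?case by (intro avg)
  qed
  have step: "\<bar>?G (Suc j) z - ?G j z\<bar> \<le> L * norm z * b j" for j z
  proof (rule avg)
    fix u assume u: "u \<in> {- b j..b j}"
    have "\<bar>?G j (z * cis u) - ?G j z\<bar> \<le> L * norm (z * cis u - z)" by (rule lip)
    also have "norm (z * cis u - z) = norm z * norm (cis u - 1)" by (simp add: right_diff_distrib flip: norm_mult)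
    also have "norm (cis u - 1) \<le> b j" using norm_cis_minus_1_le[of u] u by auto
    finally show "\<bar>?G j (z * cis u) - ?G j z\<bar> \<le> L * norm z * b j" using L0 by (simp add: mult_left_mono mult.assoc)
  qed
  have "summable b"
    by (rule summableI_nonneg_bounded[of _ "w / 8"]) (use b0 bsum less_imp_le in auto)
  then have conv: "convergent (\<lambda>j. ?G j z)" for z
  proof -
    have "summable (\<lambda>j. ?G (Suc j) z - ?G j z)"
      by (rule summable_comparison_test'[of "\<lambda>j. L * norm z * b j" 0])
         (use \<open>summable b\<close> step in \<open>auto intro: summable_mult simp del: bumpiter.simps\<close>)
    then have "(\<lambda>n. \<Sum>j<n. ?G (Suc j) z - ?G j z) \<longlonglongrightarrow> (\<Sum>j. ?G (Suc j) z - ?G j z)" by (rule summable_LIMSEQ)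
    then have "(\<lambda>n. (?G n z - ?G 0 z) + ?G 0 z) \<longlonglongrightarrow> (\<Sum>j. ?G (Suc j) z - ?G j z) + ?G 0 z"
      unfolding sum_lessThan_telescope[of "\<lambda>j. ?G j z"] by (rule tendsto_add[OF _ tendsto_const])
    then show ?thesis by (auto simp: convergent_def simp del: bumpiter.simps)
  qed
  define F where "F z = lim (\<lambda>j. ?G j z)" for z
  have lim: "(\<lambda>j. ?G j z) \<longlonglongrightarrow> F z" for z unfolding F_def using conv by (simp add: convergent_LIMSEQ_iff)
  have lipF: "\<bar>F z - F z'\<bar> \<le> L * norm (z - z')" for z z'
    by (rule LIMSEQ_le_const2[OF tendsto_rabs[OF tendsto_diff[OF lim lim]]]) (use lip in auto)
  have contF: "continuous_on UNIV F" by (rule lipschitz_imp_continuous[OF lipF])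
  have rngF: "\<bar>F z - 1 / 2\<bar> \<le> 1 / 2" for z
    by (rule LIMSEQ_le_const2[OF tendsto_rabs[OF tendsto_diff[OF lim tendsto_const]]]) (use rng in auto)
  \<comment> \<open>Each average uses up the width \<open>b j\<close> of the plateau on either side;
    at least w / 2 remains.\<close>
  have one: "?G j (cis t) = 1" if "\<bar>t\<bar> \<le> 5 / 8 * w - (\<Sum>i<j. b i)" for j t
    using that
  proof (induction j arbitrary: t)
    case 0
    then have "cos (5 / 8 * w) \<le> cos \<bar>t\<bar>" using w pi_gt3 by (intro cos_monotone_0_pi_le) auto
    then have "1 \<le> (Re (cis t) - c7) / \<kappa>" using \<kappa> by (simp add: \<kappa>_def)
    then show ?case unfolding G0 by simp
  next
    case (Suc j)
    have "\<bar>?G (Suc j) (cis t) - 1\<bar> \<le> 0"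
    proof (rule avg)
      fix u assume u: "u \<in> {- b j..b j}"
      have "?G j (cis (t + u)) = 1" using Suc.prems u by (intro Suc.IH) auto
      then show "\<bar>?G j (cis t * cis u) - 1\<bar> \<le> 0" by (simp add: cis_mult)
    qed
    then show ?case by simp
  qed
  have zero: "?G j (cis t) = 0" if "7 / 8 * w + (\<Sum>i<j. b i) \<le> t" "t \<le> 2 * pi - 7 / 8 * w - (\<Sum>i<j. b i)" for j t
    using that
  proof (induction j arbitrary: t)
    case 0
    have "cos t \<le> c7"
    proof (cases "t \<le> pi")
      case True then show ?thesis unfolding c7_def using 0 w by (intro cos_monotone_0_pi_le) auto
    next
      case False
      have "cos (2 * pi - t) \<le> c7" unfolding c7_def using 0 w False by (intro cos_monotone_0_pi_le) auto
      then show ?thesis by simp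
    qed
    then have "(Re (cis t) - c7) / \<kappa> \<le> 0" using \<kappa> by (simp add: divide_le_0_iff)
    then show ?case unfolding G0 by simp
  next
    case (Suc j)
    have "\<bar>?G (Suc j) (cis t) - 0\<bar> \<le> 0"
    proof (rule avg)
      fix u assume u: "u \<in> {- b j..b j}"
      have "?G j (cis (t + u)) = 0" using Suc.prems u by (intro Suc.IH) auto
      then show "\<bar>?G j (cis t * cis u) - 0\<bar> \<le> 0" by (simp add: cis_mult)
    qed
    then show ?case by simp
  qed
  have F1: "F (cis t) = 1" if t: "cos (w / 2) \<le> cos t" for t
  proof -
    define s where "s = Arg (cis t)"
    have s: "- pi < s" "s \<le> pi" using Arg_bounded[of "cis t"] by (auto simp: s_def)
    have cs: "cis s = cis t" unfolding s_def using cis_Arg[of "cis t"] by (simp add: sgn_eq)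
    then have "cos s = cos t" by (simp add: complex_eq_iff)
    have "\<bar>s\<bar> \<le> w / 2"
    proof (rule ccontr)
      assume "\<not> \<bar>s\<bar> \<le> w / 2"
      then have "cos \<bar>s\<bar> < cos (w / 2)" using s w by (intro cos_monotone_0_pi) auto
      then show False using t \<open>cos s = cos t\<close> by simp
    qed
    then have "?G j (cis s) = 1" for j using bsum[of j] w by (intro one) auto
    then have "(\<lambda>j. ?G j (cis s)) \<longlonglongrightarrow> 1" by (simp del: bumpiter.simps)
    then show ?thesis using LIMSEQ_unique[OF lim[of "cis s"]] cs by simp
  qed
  have F0: "F (cis t) = 0" if t: "cos t \<le> cos w" for t
  proof -
    define s where "s = Arg2pi (cis t)"
    have s: "0 \<le> s" "s < 2 * pi" using Arg2pi_lt_2pi Arg2pi_ge_0 by (auto simp: s_def)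
    have cs: "cis s = cis t" unfolding s_def using Arg2pi_eq[of "cis t"] by (simp add: cis_conv_exp)
    then have "cos s = cos t" by (simp add: complex_eq_iff)
    have "w \<le> s"
    proof (rule ccontr)
      assume "\<not> w \<le> s"
      then have "cos w < cos s" using s w pi_gt3 by (intro cos_monotone_0_pi) auto
      then show False using t \<open>cos s = cos t\<close> by simp
    qed
    moreover have "w \<le> 2 * pi - s"
    proof (rule ccontr)
      assume "\<not> w \<le> 2 * pi - s"
      then have "cos w < cos (2 * pi - s)" using s w pi_gt3 by (intro cos_monotone_0_pi) auto
      then show False using t \<open>cos s = cos t\<close> by simp
    qed
    ultimately have "?G j (cis s) = 0" for j using bsum[of j] w by (intro zero) auto
    then have "(\<lambda>j. ?G j (cis s)) \<longlonglongrightarrow> 0" by (simp del: bumpiter.simps)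
    then show ?thesis using LIMSEQ_unique[OF lim[of "cis s"]] cs by simp
  qed
  have cint: "continuous_on {-pi..pi} (\<lambda>t. complex_of_real (?G j (cis t)) * cis (- of_int n * t))" for j n
    by (intro continuous_intros continuous_on_compose2[OF cont]) auto
  have G1: "norm (complex_of_real (?G j z) * cis x) \<le> 1" for j z x
  proof -
    have "\<bar>?G j z\<bar> \<le> 1" using rng[of j z] by linarith
    then show ?thesis by (simp add: norm_mult del: bumpiter.simps)
  qed
  have coeff_lim: "(\<lambda>j. circoeff (?G j) n) \<longlonglongrightarrow> circoeff F n" for n
    unfolding circoeff_def
  proof (intro tendsto_divide dominated_convergence(2)[where h="\<lambda>_. 1"])
    show "(\<lambda>t. complex_of_real (?G j (cis t)) * cis (- of_int n * t)) integrable_on {-pi..pi}" for j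
      by (intro integrable_continuous_interval cint)
    show "(\<lambda>j. complex_of_real (?G j (cis t)) * cis (- of_int n * t)) \<longlonglongrightarrow> complex_of_real (F (cis t)) * cis (- of_int n * t)" for t
      by (intro tendsto_intros lim)
  qed (use G1 in auto)
  have c0: "norm (circoeff (?G 0) n) \<le> 1" for n
  proof -
    have "norm (integral {-pi..pi} (\<lambda>t. complex_of_real (?G 0 (cis t)) * cis (- of_int n * t))) \<le> 1 * (pi - (-pi))"
      by (rule integral_bound[OF _ cint G1]) auto
    then show ?thesis by (simp add: circoeff_def norm_divide divide_le_eq del: bumpiter.simps)
  qed
  have cSuc: "norm (circoeff (?G (Suc j)) n) = norm (circoeff (?G j) n) * norm (boxmult n (b j))" for j n
    unfolding Suc by (simp add: circoeff_angavg[OF b0 cont] norm_mult)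
  \<comment> \<open>Only the first p multipliers are counted, the later ones being at most 1. Every
    p is allowed, so its choice can depend on n.\<close>
  have dec: "norm (circoeff F n) \<le> (16 * (real p)\<^sup>2 / (\<bar>of_int n\<bar> * w)) ^ p" if n: "n \<noteq> 0" for n p
  proof -
    have nw: "0 < \<bar>real_of_int n\<bar> * w" using n w by simp
    have 1: "norm (circoeff (?G p) n) \<le> (\<Prod>i<p. 1 / (\<bar>of_int n\<bar> * b i))" for p
    proof (induction p)
      case 0 then show ?case using c0 by (simp del: bumpiter.simps)
    next
      case (Suc p)
      show ?case unfolding cSuc prod.lessThan_Suc
        by (intro mult_mono Suc norm_boxmult_le b0 n prod_nonneg) (auto intro!: mult_nonneg_nonneg less_imp_le[OF b0])
    qed
    have 2: "norm (circoeff (?G (p + k)) n) \<le> norm (circoeff (?G p) n)" for k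
    proof (induction k)
      case (Suc k)
      have "norm (circoeff (?G (p + Suc k)) n) \<le> norm (circoeff (?G (p + k)) n) * 1"
        unfolding add_Suc_right cSuc by (intro mult_left_mono norm_boxmult_le_1 b0) auto
      then show ?case using Suc by (simp del: bumpiter.simps)
    qed simp
    have "(\<lambda>k. norm (circoeff (?G (p + k)) n)) \<longlonglongrightarrow> norm (circoeff F n)"
      using LIMSEQ_ignore_initial_segment[OF tendsto_norm[OF coeff_lim[of n]], of p] by (simp only: add.commute)
    then have "norm (circoeff F n) \<le> norm (circoeff (?G p) n)"
      by (rule LIMSEQ_le_const2) (use 2 in auto)
    also have "\<dots> \<le> (\<Prod>i<p. 1 / (\<bar>of_int n\<bar> * b i))" by (rule 1)
    also have "\<dots> \<le> (\<Prod>i<p. 16 * (real p)\<^sup>2 / (\<bar>of_int n\<bar> * w))"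
    proof (rule prod_mono)
      fix i assume "i \<in> {..<p}"
      then have "(real i + 1)\<^sup>2 \<le> (real p)\<^sup>2" by (intro power_mono) auto
      moreover have "1 / (\<bar>of_int n\<bar> * b i) = 16 * (real i + 1)\<^sup>2 / (\<bar>of_int n\<bar> * w)"
        using w n by (simp add: b_def)
      ultimately show "0 \<le> 1 / (\<bar>of_int n\<bar> * b i) \<and> 1 / (\<bar>of_int n\<bar> * b i) \<le> 16 * (real p)\<^sup>2 / (\<bar>of_int n\<bar> * w)"
        using nw by (auto intro!: divide_right_mono)
    qed
    finally show ?thesis by simp
  qed
  have decay: "norm (circoeff F n) \<le> 3 * exp (- sqrt (\<bar>real_of_int n\<bar> * w) / 7)" for n
  proof (cases "n = 0")
    case False
    then show ?thesis using dec[OF False] w by (intro box_decay_bound) auto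
  next
    case True
    have "norm (circoeff (?G (0 + k)) n) \<le> 1" for k
    proof (induction k)
      case 0 then show ?case using c0 by (simp del: bumpiter.simps)
    next
      case (Suc k)
      have "norm (circoeff (?G (0 + Suc k)) n) \<le> norm (circoeff (?G (0 + k)) n) * 1"
        unfolding add_Suc_right cSuc by (intro mult_left_mono norm_boxmult_le_1 b0) auto
      then show ?case using Suc by (simp del: bumpiter.simps)
    qed
    then have "norm (circoeff F n) \<le> 1"
      by (intro LIMSEQ_le_const2[OF tendsto_norm[OF coeff_lim[of n]]]) auto
    then show ?thesis using True by simp
  qed
  show ?thesis
  proof (intro exI[of _ "circoeff F"] exI[of _ "\<lambda>t. F (cis t)"] conjI allI impI decay F0 F1)
    show "fser (circoeff F) t = complex_of_real (F (cis t))" if "wbound (\<lambda>_. 1) K (circoeff F)" for K t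
      by (rule fourier_inversion[OF contF that])
    show "0 \<le> F (cis t)" "F (cis t) \<le> 1" for t using rngF[of "cis t"] by linarith+
  qed
qed

section \<open>From pointwise decay to weighted norms\<close>

lemma sum_inverse_squares_int_le:
  fixes A :: "int set"
  assumes A: "finite A"
  shows "(\<Sum>n\<in>A - {0}. 1 / (real_of_int n)\<^sup>2) \<le> 4"
proof -
  have pos: "(\<Sum>n\<in>P. 1 / (real_of_int n)\<^sup>2) \<le> 2" if P: "finite P" "\<And>n. n \<in> P \<Longrightarrow> 0 < n" for P
  proof -
    define N where "N = Suc (Max (insert 0 (nat ` P)))"
    have N: "nat n < N" if "n \<in> P" for n
      using P that by (auto simp: N_def less_Suc_eq_le intro: Max_ge)
    have "(\<Sum>n\<in>P. 1 / (real_of_int n)\<^sup>2) \<le> (\<Sum>n\<in>(\<lambda>i. int i + 1) ` {..<N}. 1 / (real_of_int n)\<^sup>2)"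
    proof (rule sum_mono2)
      show "P \<subseteq> (\<lambda>i. int i + 1) ` {..<N}"
      proof
        fix n assume n: "n \<in> P"
        then show "n \<in> (\<lambda>i. int i + 1) ` {..<N}" using N[OF n] P(2)[OF n] by (intro rev_image_eqI[of "nat (n - 1)"]) auto
      qed
    qed auto
    also have "\<dots> = (\<Sum>i<N. 1 / (real i + 1)\<^sup>2)" by (subst sum.reindex) (auto simp: inj_on_def)
    also have "\<dots> \<le> 2" using sum_box_widths_le[of 16 N] by simp
    finally show ?thesis .
  qed
  have "(\<Sum>n\<in>A - {0}. 1 / (real_of_int n)\<^sup>2) = (\<Sum>n\<in>A \<inter> {0<..}. 1 / (real_of_int n)\<^sup>2) + (\<Sum>n\<in>A \<inter> {..<0}. 1 / (real_of_int n)\<^sup>2)"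
    using A by (subst sum.union_disjoint[symmetric]) (auto intro!: sum.cong)
  moreover have "(\<Sum>n\<in>A \<inter> {0<..}. 1 / (real_of_int n)\<^sup>2) \<le> 2" using A by (intro pos) auto
  moreover have "(\<Sum>n\<in>A \<inter> {..<0}. 1 / (real_of_int n)\<^sup>2) = (\<Sum>n\<in>uminus ` (A \<inter> {..<0}). 1 / (real_of_int n)\<^sup>2)"
    by (subst sum.reindex) auto
  moreover have "\<dots> \<le> 2" using A by (intro pos) auto
  ultimately show ?thesis by linarith
qed

lemma exp_minus_le_power4:
  fixes y :: real
  assumes "0 < y"
  shows "exp (- y) \<le> 256 / y ^ 4"
proof -
  have "y / 4 \<le> exp (y / 4)" using exp_ge_add_one_self[of "y / 4"] by linarith
  then have "(y / 4) ^ 4 \<le> exp (y / 4) ^ 4" using assms by (intro power_mono) auto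
  also have "\<dots> = exp y" using exp_of_nat_mult[of 4 "y / 4"] by simp
  finally have "y ^ 4 \<le> 256 * exp y" by (simp add: power_divide)
  then show ?thesis using assms by (simp add: exp_minus field_simps)
qed

text \<open>Half of the rate 2 \<sigma> pays for the weight; the other half is summable by exp (- y)
  <= 256 / y^4 with y = \<sigma> sqrt |n|. The constant rounds up 1 + 4 * 256, where the term n = 0
  is absorbed because \<sigma> <= 1.\<close>

lemma wbound_exp_decay:
  assumes \<sigma>: "0 < \<sigma>" "\<sigma> \<le> 1" and D: "0 \<le> D" and a: "\<And>n. norm (a n) \<le> D * exp (- 2 * \<sigma> * sqrt \<bar>real_of_int n\<bar>)"
  shows "wbound (sw \<sigma>) (D * (1100 / \<sigma> ^ 4)) a"
  unfolding wbound_def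
proof (intro allI impI)
  fix A :: "int set" assume A: "finite A"
  have le: "norm (a n) * sw \<sigma> n \<le> D * exp (- (\<sigma> * sqrt \<bar>real_of_int n\<bar>))" for n
  proof -
    have "norm (a n) * sw \<sigma> n \<le> D * exp (- 2 * \<sigma> * sqrt \<bar>real_of_int n\<bar>) * sw \<sigma> n"
      by (intro mult_right_mono a) (simp add: sw_def)
    then show ?thesis by (simp add: sw_def mult.assoc exp_add[symmetric])
  qed
  have le2: "exp (- (\<sigma> * sqrt \<bar>real_of_int n\<bar>)) \<le> 256 / \<sigma> ^ 4 * (1 / (real_of_int n)\<^sup>2)" if "n \<noteq> 0" for n
  proof -
    have "sqrt \<bar>real_of_int n\<bar> ^ 4 = (sqrt \<bar>real_of_int n\<bar> ^ 2) ^ 2" by (subst power_mult[symmetric]) simp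
    also have "\<dots> = (real_of_int n)\<^sup>2" by simp
    finally show ?thesis
      using exp_minus_le_power4[of "\<sigma> * sqrt \<bar>real_of_int n\<bar>"] \<sigma> that by (simp add: power_mult_distrib)
  qed
  have "(\<Sum>n\<in>A. norm (a n) * sw \<sigma> n) \<le> (\<Sum>n\<in>insert 0 A. D * exp (- (\<sigma> * sqrt \<bar>real_of_int n\<bar>)))"
    by (rule order_trans[OF sum_mono[OF le]], rule sum_mono2) (use A D in auto)
  also have "\<dots> = D * exp 0 + (\<Sum>n\<in>A - {0}. D * exp (- (\<sigma> * sqrt \<bar>real_of_int n\<bar>)))"
    using A by (simp add: sum.insert_remove)
  also have "(\<Sum>n\<in>A - {0}. D * exp (- (\<sigma> * sqrt \<bar>real_of_int n\<bar>))) \<le> (\<Sum>n\<in>A - {0}. D * (256 / \<sigma> ^ 4 * (1 / (real_of_int n)\<^sup>2)))"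
    by (intro sum_mono mult_left_mono D le2) auto
  also have "\<dots> = D * (256 / \<sigma> ^ 4 * (\<Sum>n\<in>A - {0}. 1 / (real_of_int n)\<^sup>2))" by (simp only: sum_distrib_left)
  also have "\<dots> \<le> D * (256 / \<sigma> ^ 4 * 4)"
    using \<sigma> by (intro mult_left_mono D sum_inverse_squares_int_le A) auto
  also have "D * exp 0 + D * (256 / \<sigma> ^ 4 * 4) \<le> D * (1100 / \<sigma> ^ 4)"
  proof -
    have "\<sigma> ^ 4 \<le> 1" using \<sigma> by (intro power_le_one) auto
    then have "1 \<le> 1 / \<sigma> ^ 4" using \<sigma> by simp
    then have "1 + 256 / \<sigma> ^ 4 * 4 \<le> 1100 / \<sigma> ^ 4" by (simp add: field_simps)
    then have "D * (1 + 256 / \<sigma> ^ 4 * 4) \<le> D * (1100 / \<sigma> ^ 4)" by (intro mult_left_mono D)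
    then show ?thesis by (simp add: ring_distribs)
  qed
  finally show "(\<Sum>n\<in>A. norm (a n) * sw \<sigma> n) \<le> D * (1100 / \<sigma> ^ 4)" by linarith
qed

text \<open>The factor 14 turns the decay sqrt (|n| w) / 7 into at least twice the rate \<sigma>.
  The summability obtained in this way is the premise of the inversion clause in
  \<open>bump_exists\<close>.\<close>

lemma bump_wbound:
  assumes w: "0 < w" "w \<le> 1" and \<sigma>: "0 < \<sigma>" "14 * \<sigma> \<le> sqrt w"
  obtains a h where "wbound (sw \<sigma>) (3300 / \<sigma> ^ 4) a" "\<And>t. fser a t = complex_of_real (h t)"
    "\<And>t. 0 \<le> h t" "\<And>t. h t \<le> 1" "\<And>t. cos (w / 2) \<le> cos t \<Longrightarrow> h t = 1" "\<And>t. cos t \<le> cos w \<Longrightarrow> h t = 0"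
    "continuous_on UNIV h"
proof -
  obtain a h where a: "\<And>n. norm (a n) \<le> 3 * exp (- sqrt (\<bar>real_of_int n\<bar> * w) / 7)"
    and f: "\<And>K t. wbound (\<lambda>_. 1) K a \<Longrightarrow> fser a t = complex_of_real (h t)"
    and h: "\<And>t. 0 \<le> h t" "\<And>t. h t \<le> 1" "\<And>t. cos (w / 2) \<le> cos t \<Longrightarrow> h t = 1" "\<And>t. cos t \<le> cos w \<Longrightarrow> h t = 0"
    using bump_exists[OF w] by metis
  have s1: "\<sigma> \<le> 1"
  proof -
    have "sqrt w \<le> 1" using w by simp
    then show ?thesis using \<sigma> by linarith
  qed
  have b: "wbound (sw \<sigma>) (3 * (1100 / \<sigma> ^ 4)) a"
  proof (rule wbound_exp_decay)
    fix n
    have "14 * \<sigma> * sqrt \<bar>real_of_int n\<bar> \<le> sqrt w * sqrt \<bar>real_of_int n\<bar>" by (intro mult_right_mono \<sigma>) auto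
    then have "exp (- sqrt (\<bar>real_of_int n\<bar> * w) / 7) \<le> exp (- 2 * \<sigma> * sqrt \<bar>real_of_int n\<bar>)"
      by (simp add: real_sqrt_mult mult_ac)
    then show "norm (a n) \<le> 3 * exp (- 2 * \<sigma> * sqrt \<bar>real_of_int n\<bar>)" using a[of n] by linarith
  qed (use \<sigma> s1 in auto)
  then have b': "wbound (sw \<sigma>) (3300 / \<sigma> ^ 4) a" by simp
  have fs: "fser a t = complex_of_real (h t)" for t
    by (rule f[OF wbound_one[OF b sw_ge_1]]) (use \<sigma> in simp)
  have "continuous_on UNIV (\<lambda>t. Re (fser a t))"
    by (intro continuous_intros continuous_on_fser[OF b sw_ge_1]) (use \<sigma> in simp)
  then have "continuous_on UNIV h" by (simp add: fs)
  with that b' fs h show ?thesis by blast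
qed

section \<open>The building block\<close>

text \<open>The pole lies at distance \<open>d\<close> outside the unit circle. Inside the disc
  reaching to the pole, l / (1 + d - z) has positive real part, which bounds the modulus; near z = 1
  this real part is of order l / d, which makes the modulus tiny.\<close>

definition outer :: "real \<Rightarrow> real \<Rightarrow> complex \<Rightarrow> complex" where
  "outer l d z = exp (of_real (l / (1 + d)) - of_real l / (of_real (1 + d) - z))"

lemma norm_outer: "norm (outer l d z) = exp (l / (1 + d) - l * (1 + d - Re z) / (norm (of_real (1 + d) - z))\<^sup>2)"
  by (simp add: outer_def Re_divide cmod_power2 del: of_real_divide)

lemma norm_outer_le:
  assumes "0 < l" "0 < d" "Re z \<le> 1 + d"
  shows "norm (outer l d z) \<le> exp l"
proof -
  have "l / (1 + d) \<le> l" using assms by (simp add: field_simps)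
  moreover have "0 \<le> l * (1 + d - Re z) / (norm (of_real (1 + d) - z))\<^sup>2" using assms by simp
  ultimately show ?thesis unfolding norm_outer by simp
qed

lemma cos_ge_one_minus_square: "1 - x\<^sup>2 / 2 \<le> cos (x::real)"
proof -
  have "(sin (x / 2))\<^sup>2 \<le> (x / 2)\<^sup>2"
    unfolding abs_le_square_iff[symmetric] by (rule abs_sin_x_le_abs_x)
  then show ?thesis using cos_double_sin[of "x / 2"] by (simp add: power_divide)
qed

text \<open>For t within d / 2 of a multiple of 2 pi the squared distance d^2 + 2 (1 + d) (1 - cos
  t) to the pole is at most 2 d^2, so the exponent loses at least l d / (2 d^2).\<close>

lemma norm_outer_small:
  assumes l: "0 < l" and d: "0 < d" "d \<le> 1" and t: "cos (d / 2) \<le> cos t"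
  shows "norm (outer l d (cis t)) \<le> exp (l - l / (2 * d))"
proof -
  let ?y = "of_real (1 + d) - cis t"
  have "(norm ?y)\<^sup>2 = (1 + d - cos t)\<^sup>2 + (sin t)\<^sup>2" by (simp add: cmod_power2)
  also have "\<dots> = d\<^sup>2 + 2 * (1 + d) * (1 - cos t)"
    using sin_cos_squared_add3[of t] by (simp add: power2_eq_square algebra_simps)
  also have "\<dots> \<le> d\<^sup>2 + 2 * (1 + d) * (d\<^sup>2 / 8)"
  proof -
    have "1 - (d / 2)\<^sup>2 / 2 \<le> cos (d / 2)" by (rule cos_ge_one_minus_square)
    then have "1 - cos t \<le> d\<^sup>2 / 8" using t by (simp add: power_divide)
    then show ?thesis using d by (intro add_left_mono mult_left_mono) auto
  qed
  also have "\<dots> \<le> 2 * d\<^sup>2" using d mult_right_mono[of d 1 "d\<^sup>2"] by (simp add: algebra_simps)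
  finally have y: "(norm ?y)\<^sup>2 \<le> 2 * d\<^sup>2" .
  have y0: "0 < (norm ?y)\<^sup>2"
  proof -
    have "cos t \<le> 1" by simp
    then have "0 < 1 + d - cos t" using d by linarith
    then have "0 < Re ?y" by simp
    then have "?y \<noteq> 0" by (metis less_irrefl zero_complex.sel(1))
    then show ?thesis by simp
  qed
  have "l / (2 * d) = l * d / (2 * d\<^sup>2)" using d by (simp add: power2_eq_square)
  also have "\<dots> \<le> l * d / (norm ?y)\<^sup>2" using y y0 l d by (intro divide_left_mono) auto
  also have "\<dots> \<le> l * (1 + d - Re (cis t)) / (norm ?y)\<^sup>2" using l y0 by (intro divide_right_mono mult_left_mono) auto
  finally have "l / (2 * d) \<le> l * (1 + d - Re (cis t)) / (norm ?y)\<^sup>2" .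
  moreover have "l / (1 + d) \<le> l" using l d by (simp add: field_simps)
  ultimately show ?thesis unfolding norm_outer by simp
qed

text \<open>Cauchy's estimate on the circle of radius 1 + d / 2 gives geometric decay exp (- k d /
  4), which is weakened to root decay with a rate of order sqrt d. Holomorphy supplies the
  one-sidedness.\<close>

lemma outer_coeffs:
  assumes l: "0 < l" and d: "0 < d" "d \<le> 1" and \<sigma>: "0 < \<sigma>" "\<sigma> \<le> sqrt d / 4"
  obtains oc where "wbound (sw \<sigma>) (exp l * (2200 / \<sigma> ^ 4)) oc" "\<And>t. fser oc t = outer l d (cis t)"
    "oc 0 = 1" "\<And>n. n < 0 \<Longrightarrow> oc n = 0"
proof -
  let ?f = "outer l d"
  have hol: "?f holomorphic_on ball 0 (1 + d)"
  proof -
    have "of_real (1 + d) - z \<noteq> 0" if z: "z \<in> ball 0 (1 + d)" for z :: complex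
    proof
      assume "of_real (1 + d) - z = 0"
      then have "z = of_real (1 + d)" by simp
      then have "norm z = 1 + d" using d by (simp only: norm_of_real)
      then show False using z by simp
    qed
    then show ?thesis unfolding outer_def by (intro holomorphic_intros) blast
  qed
  define c where "c k = (deriv ^^ k) ?f 0 / fact k" for k
  have sub: "cball 0 (1 + d / 2) \<subseteq> ball 0 (1 + d)" using d by auto
  have cb: "norm (c k) \<le> exp l / (1 + d / 2) ^ k" for k
  proof -
    have "norm ((deriv ^^ k) ?f 0) \<le> fact k * exp l / (1 + d / 2) ^ k"
    proof (rule Cauchy_inequality)
      show "?f holomorphic_on ball 0 (1 + d / 2)" using hol by (rule holomorphic_on_subset) (use d in auto)
      show "continuous_on (cball 0 (1 + d / 2)) ?f"
        by (rule holomorphic_on_imp_continuous_on[OF holomorphic_on_subset[OF hol sub]])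
      fix x :: complex assume "norm (0 - x) = 1 + d / 2"
      then show "norm (?f x) \<le> exp l" using complex_Re_le_cmod[of x] d l by (intro norm_outer_le) auto
    qed (use d in auto)
    then show ?thesis by (simp add: c_def norm_divide field_simps)
  qed
  have cd: "norm (c k) \<le> 2 * exp l * exp (- 2 * \<sigma> * sqrt (real k))" for k
  proof -
    have "exp (d / 4) \<le> 1 + d / 4 + (d / 4)\<^sup>2" using d by (intro exp_bound) auto
    also have "\<dots> \<le> 1 + d / 2"
    proof -
      have "d * d \<le> d" using mult_left_mono[of d 1 d] d by simp
      moreover have "(d / 4)\<^sup>2 = d * d / 16" by (simp add: power2_eq_square)
      ultimately show ?thesis using d by linarith
    qed
    finally have "exp (d / 4) ^ k \<le> (1 + d / 2) ^ k" by (intro power_mono) auto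
    then have 1: "exp (real k * d / 4) \<le> (1 + d / 2) ^ k" using exp_of_nat_mult[of k "d / 4"] by simp
    define y where "y = sqrt (real k) * sqrt d"
    have y2: "y\<^sup>2 = real k * d" using d by (simp add: y_def power_mult_distrib)
    \<comment> \<open>Expanding the square trades linear for root decay: k d / 4 is at least sqrt (k
      d) / 2 - 1 / 4.\<close>
    have "0 \<le> (y / 2 - 1 / 2)\<^sup>2" by simp
    then have "y / 2 - 1 / 4 \<le> real k * d / 4" using y2 by (simp add: power2_eq_square algebra_simps)
    moreover have "2 * \<sigma> * sqrt (real k) \<le> y / 2" using \<sigma> mult_right_mono[OF \<sigma>(2), of "sqrt (real k)"] by (simp add: y_def mult_ac)
    ultimately have "exp (- (real k * d / 4)) \<le> exp (1 / 4 + - 2 * \<sigma> * sqrt (real k))" by simp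
    also have "\<dots> = exp (1 / 4) * exp (- 2 * \<sigma> * sqrt (real k))" by (rule exp_add)
    also have "\<dots> \<le> 2 * exp (- 2 * \<sigma> * sqrt (real k))"
    proof (rule mult_right_mono)
      have "exp (1 / 4 :: real) \<le> 1 + 1 / 4 + (1 / 4)\<^sup>2" by (rule exp_bound) auto
      then show "exp (1 / 4 :: real) \<le> 2" by (simp add: power2_eq_square)
    qed auto
    finally have 2: "exp (- (real k * d / 4)) \<le> 2 * exp (- 2 * \<sigma> * sqrt (real k))" .
    have "norm (c k) \<le> exp l / exp (real k * d / 4)"
      using cb[of k] 1 by (rule order_trans[OF _ divide_left_mono]) (use d in auto)
    also have "\<dots> = exp l * exp (- (real k * d / 4))" by (simp only: exp_minus divide_inverse)
    also have "\<dots> \<le> exp l * (2 * exp (- 2 * \<sigma> * sqrt (real k)))" by (intro mult_left_mono 2) auto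
    finally show ?thesis by simp
  qed
  have s1: "\<sigma> \<le> 1"
  proof -
    have "sqrt d \<le> 1" using d by simp
    then show ?thesis using \<sigma> by linarith
  qed
  have "wbound (sw \<sigma>) (2 * exp l * (1100 / \<sigma> ^ 4)) (posseq c)"
  proof (rule wbound_exp_decay)
    show "norm (posseq c n) \<le> 2 * exp l * exp (- 2 * \<sigma> * sqrt \<bar>real_of_int n\<bar>)" for n
    proof (cases "0 \<le> n")
      case True
      then have "real (nat n) = \<bar>real_of_int n\<bar>" by simp
      then show ?thesis using True cd[of "nat n"] by (simp only: posseq_def if_True)
    qed (simp add: posseq_def)
  qed (use \<sigma> s1 in auto)
  then have wb: "wbound (sw \<sigma>) (exp l * (2200 / \<sigma> ^ 4)) (posseq c)" by (simp add: mult_ac)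
  have fs: "fser (posseq c) t = outer l d (cis t)" for t
  proof (rule fser_posseq)
    have "summable (\<lambda>k. exp l * (1 / (1 + d / 2)) ^ k)" using d by (intro summable_mult summable_geometric) auto
    then show "summable (\<lambda>k. norm (c k))"
      by (rule summable_comparison_test'[where N=0]) (use cb in \<open>auto simp: power_divide\<close>)
    show "(\<lambda>k. c k * cis t ^ k) sums outer l d (cis t)"
      using holomorphic_power_series[OF hol, of "cis t"] d by (simp add: c_def)
  qed
  have "posseq c 0 = 1" by (simp add: posseq_def c_def outer_def)
  moreover have "posseq c n = 0" if "n < 0" for n using that by (simp add: posseq_def)
  ultimately show ?thesis using that wb fs by blast
qed

text \<open>\<open>P\<close> is the outer function and \<open>R\<close> its product with a bump of
  width d / 2, living where the outer function is at most exp (- W); so P - R vanishes where this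
  bump is 1. A second bump \<open>h\<close>, of width d / 4, is nonzero only there, and
  \<open>\<psi>\<close>, with values 1 - h, records the zero set by a continuous function. The
  choice of d gives l / (2 d) = W + l, and 28 \<sigma> = sqrt d suits both widths.\<close>

lemma building_block:
  assumes l: "0 < l" and W: "0 \<le> W"
    and d: "d = l / (2 * (W + l))" and \<sigma>: "\<sigma> = sqrt d / 28" and H: "H = 3300 / \<sigma> ^ 4"
  obtains P R \<psi> h where
    "wbound (sw \<sigma>) (exp l * H) P" "P 0 = 1" "\<And>n. n < 0 \<Longrightarrow> P n = 0"
    "wbound (sw \<sigma>) (exp l * H * H) R" "\<And>t. norm (fser R t) \<le> exp (- W)"
    "wbound (sw \<sigma>) (1 + H) \<psi>" "\<And>t. fser \<psi> t = complex_of_real (1 - h t)"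
    "\<And>t. 0 \<le> h t" "\<And>t. h t \<le> 1" "continuous_on UNIV h"
    "norm (\<psi> 0) \<le> 1 - d / (8 * pi)" "\<And>t. h t \<noteq> 0 \<Longrightarrow> fser P t = fser R t"
proof -
  have d0: "0 < d" using l W by (simp add: d)
  have d1: "d \<le> 1 / 2" using l W by (simp add: d field_simps)
  have \<sigma>0: "0 < \<sigma>" using d0 by (simp add: \<sigma>)
  have v1: "1 \<le> sw \<sigma> n" for n by (rule sw_ge_1) (use \<sigma>0 in simp)
  have H0: "0 \<le> H" using \<sigma>0 by (simp add: H)
  have s4: "sqrt (d / 4) = sqrt d / 2" by (simp add: real_sqrt_divide)
  have s2: "14 * \<sigma> \<le> sqrt (d / 2)"
  proof -
    have "sqrt (d / 4) \<le> sqrt (d / 2)" using d0 by simp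
    then show ?thesis using s4 by (simp add: \<sigma>)
  qed
  obtain a g where a: "wbound (sw \<sigma>) (3300 / \<sigma> ^ 4) a" "\<And>t. fser a t = complex_of_real (g t)"
    "\<And>t. 0 \<le> g t" "\<And>t. g t \<le> 1" "\<And>t. cos (d / 2 / 2) \<le> cos t \<Longrightarrow> g t = 1" "\<And>t. cos t \<le> cos (d / 2) \<Longrightarrow> g t = 0"
    "continuous_on UNIV g"
    by (rule bump_wbound[OF _ _ \<sigma>0 s2]) (use d0 d1 in auto)
  obtain a' h where a': "wbound (sw \<sigma>) (3300 / \<sigma> ^ 4) a'" "\<And>t. fser a' t = complex_of_real (h t)"
    "\<And>t. 0 \<le> h t" "\<And>t. h t \<le> 1" "\<And>t. cos (d / 4 / 2) \<le> cos t \<Longrightarrow> h t = 1" "\<And>t. cos t \<le> cos (d / 4) \<Longrightarrow> h t = 0"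
    "continuous_on UNIV h"
    by (rule bump_wbound[OF _ _ \<sigma>0, of "d / 4"]) (use d0 d1 s4 in \<open>auto simp: \<sigma>\<close>)
  obtain P where P: "wbound (sw \<sigma>) (exp l * (2200 / \<sigma> ^ 4)) P" "\<And>t. fser P t = outer l d (cis t)"
    "P 0 = 1" "\<And>n. n < 0 \<Longrightarrow> P n = 0"
    using outer_coeffs[of l d \<sigma>] l d0 d1 \<sigma>0 by (auto simp: \<sigma>)
  have PH: "wbound (sw \<sigma>) (exp l * H) P"
    by (rule wbound_mono[OF P(1)]) (use \<sigma>0 in \<open>auto simp: H divide_right_mono\<close>)
  have aH: "wbound (sw \<sigma>) H a" "wbound (sw \<sigma>) H a'" using a(1) a'(1) by (simp_all add: H)
  have sub: "submult (sw \<sigma>)" using \<sigma>0 by (intro submult_sw) auto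
  define R where "R = conv a P"
  have R1: "wbound (sw \<sigma>) (exp l * H * H) R"
    using conv_bounds(1)[OF aH(1) PH sub] by (simp add: R_def mult_ac)
  have R2: "fser R t = of_real (g t) * outer l d (cis t)" for t
    using conv_bounds(2)[OF aH(1) PH sub] by (simp add: R_def a(2) P(2))
  have R3: "norm (fser R t) \<le> exp (- W)" for t
  proof (cases "cos t \<le> cos (d / 2)")
    case True
    then show ?thesis using a(6) by (simp add: R2)
  next
    case False
    have "norm (fser R t) \<le> 1 * norm (outer l d (cis t))"
      unfolding R2 norm_mult using a(3,4)[of t] by (intro mult_right_mono) auto
    also have "\<dots> \<le> exp (l - l / (2 * d))"
      using False l d0 d1 norm_outer_small[of l d t] by simp
    also have "l / (2 * d) = W + l" using l W by (simp add: d)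
    finally show ?thesis by simp
  qed
  define \<psi> where "\<psi> = (\<lambda>n. unitseq n - a' n)"
  have u: "wbound (sw \<sigma>) 1 unitseq" using wbound_unitseq[of "sw \<sigma>"] by (simp add: sw_def)
  have \<psi>1: "wbound (sw \<sigma>) (1 + H) \<psi>"
    using wbound_add[OF u wbound_uminus[OF aH(2)]] by (simp add: \<psi>_def sw_def cong: if_cong)
  have \<psi>2: "fser \<psi> t = complex_of_real (1 - h t)" for t
    using fser_diff[OF u aH(2) v1 v1] by (simp add: \<psi>_def fser_unitseq a'(2))
  have \<psi>3: "norm (\<psi> 0) \<le> 1 - d / (8 * pi)"
  proof -
    have "((\<lambda>t. complex_of_real (h t)) has_integral of_real (2 * pi) * a' 0) {-pi..pi}"
      using fser_coeff[OF aH(2) v1, of 0] by (simp add: a'(2))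
    moreover have hi: "h integrable_on {x..y}" for x y
      by (intro integrable_continuous_interval continuous_on_subset[OF a'(7)]) auto
    then have "((\<lambda>t. complex_of_real (h t)) has_integral of_real (integral {-pi..pi} h)) {-pi..pi}"
      using has_integral_linear[OF integrable_integral[OF hi], of complex_of_real, OF bounded_linear_of_real] by (simp add: o_def)
    ultimately have "of_real (2 * pi) * a' 0 = of_real (integral {-pi..pi} h)" by (rule has_integral_unique)
    then have a0: "a' 0 = of_real (integral {-pi..pi} h / (2 * pi))" by (simp add: field_simps)
    \<comment> \<open>\<open>h\<close> is 1 on an interval of length d / 4, which accounts for the
      mean d / (8 pi).\<close>
    have "integral {-(d / 8)..d / 8} h \<le> integral {-pi..pi} h"
      by (rule integral_subset_le) (use hi a'(3) d1 pi_gt3 in auto)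
    moreover have "integral {-(d / 8)..d / 8} h = integral {-(d / 8)..d / 8} (\<lambda>_. 1)"
    proof (rule Henstock_Kurzweil_Integration.integral_cong)
      fix t assume t: "t \<in> {-(d / 8)..d / 8}"
      have "cos (d / 4 / 2) \<le> cos \<bar>t\<bar>" using t d1 pi_gt3 by (intro cos_monotone_0_pi_le) auto
      then show "h t = 1" by (intro a'(5)) simp
    qed
    moreover have "integral {-(d / 8)..d / 8} (\<lambda>_. 1) = d / 4" using d0 by simp
    ultimately have ge: "d / 4 \<le> integral {-pi..pi} h" by linarith
    have "norm (integral {-pi..pi} h) \<le> 1 * (pi - (- pi))"
      by (rule integral_bound) (use a'(3,4) in \<open>auto intro: continuous_on_subset[OF a'(7)]\<close>)
    then have le: "integral {-pi..pi} h \<le> 2 * pi" by simp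
    have "\<psi> 0 = of_real (1 - integral {-pi..pi} h / (2 * pi))" by (simp add: \<psi>_def unitseq_def a0)
    then have "norm (\<psi> 0) = \<bar>1 - integral {-pi..pi} h / (2 * pi)\<bar>" by (simp only: norm_of_real)
    also have "\<dots> = 1 - integral {-pi..pi} h / (2 * pi)" using le by simp
    also have "\<dots> \<le> 1 - d / 4 / (2 * pi)" using ge by (intro diff_left_mono divide_right_mono) auto
    finally show ?thesis by simp
  qed
  have zero: "fser P t = fser R t" if "h t \<noteq> 0" for t
  proof -
    have "cos (d / 4) \<le> cos t" using a'(6)[of t] that by linarith
    then have "g t = 1" by (intro a(5)) simp
    then show ?thesis by (simp add: R2 P(2))
  qed
  show ?thesis
    by (rule that[OF PH P(3,4) R1 R3 \<psi>1 \<psi>2 a'(3,4,7) \<psi>3 zero])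
qed

section \<open>Localization\<close>

lemma sum_int_window_telescope:
  fixes f :: "int \<Rightarrow> complex"
  shows "(\<Sum>n\<in>{- int N..int N}. f n - f (n - 1)) = f (int N) - f (- int N - 1)"
proof (induction N)
  case (Suc N)
  have "{- int (Suc N)..int (Suc N)} = insert (- int (Suc N)) (insert (int (Suc N)) {- int N..int N})" by auto
  moreover have "f (- 1 - int N) = f (- int N - 1)" by (rule arg_cong[of _ _ f]) simp
  ultimately show ?case using Suc by (simp add: algebra_simps)
qed simp

text \<open>
  Since \<open>c = \<Sum>m. a m (c - shift m c)\<close>, the sum of \<open>c\<close> over a window is a combination of differences between
  the sums over the window and over its translates, which involve only coefficients near the two ends.
\<close>

lemma localization:
  fixes c a :: "int \<Rightarrow> complex"
  assumes c: "\<And>e. 0 < e \<Longrightarrow> \<exists>M. \<forall>n. M \<le> \<bar>n\<bar> \<longrightarrow> norm (c n) < e" and B: "\<And>n. norm (c n) \<le> B"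
    and a: "wbound (\<lambda>m. 1 + \<bar>real_of_int m\<bar>) K a" and a1: "(\<Sum>\<^sub>\<infinity>m. a m) = 1" and conv0: "\<And>n. conv a c n = 0"
  shows "(\<lambda>N. \<Sum>n\<in>{- int N..int N}. c n) \<longlonglongrightarrow> 0"
proof -
  \<comment> \<open>\<open>J m\<close> compares the window with its translate by m;
    \<open>T i\<close> is the change under one more unit translation and involves two coefficients
    near the ends.\<close>
  define J where "J m N = (\<Sum>n\<in>{- int N..int N}. c n - c (n - m))" for m :: int and N :: nat
  define T where "T i N = c (int N - i) - c (- int N - i - 1)" for i :: int and N :: nat
  have T: "(\<Sum>n\<in>{- int N..int N}. c (n - i) - c (n - (i + 1))) = T i N" for i N
    using sum_int_window_telescope[of "\<lambda>n. c (n - i)" N] by (simp add: T_def algebra_simps)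
  have Jp: "J (m + 1) N = J m N + T m N" for m N
    unfolding J_def T[symmetric] sum.distrib[symmetric] by (rule sum.cong) auto
  have Jm: "J (m - 1) N = J m N - T (m - 1) N" for m N using Jp[of "m - 1" N] by simp
  have Js: "J (int (Suc k)) N = J (int k) N + T (int k) N" "J (- int (Suc k)) N = J (- int k) N - T (- int k - 1) N" for k N
  proof -
    have "int (Suc k) = int k + 1" "- int (Suc k) = - int k - 1" by simp_all
    then show "J (int (Suc k)) N = J (int k) N + T (int k) N" "J (- int (Suc k)) N = J (- int k) N - T (- int k - 1) N"
      by (simp_all only: Jp Jm)
  qed
  have J0: "J 0 = (\<lambda>_. 0)" by (auto simp: J_def)
  have B0: "0 \<le> B" using order_trans[OF norm_ge_zero B[of 0]] .
  have TB: "norm (T i N) \<le> 2 * B" for i N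
    unfolding T_def using norm_triangle_ineq4[of "c (int N - i)" "c (- int N - i - 1)"] B[of "int N - i"] B[of "- int N - i - 1"] by linarith
  have T0: "(\<lambda>N. T i N) \<longlonglongrightarrow> 0" for i
  proof (rule LIMSEQ_I)
    fix r :: real assume "0 < r"
    then obtain M where M: "\<And>n. M \<le> \<bar>n\<bar> \<Longrightarrow> norm (c n) < r / 2" using c[of "r / 2"] by auto
    show "\<exists>no. \<forall>N\<ge>no. norm (T i N - 0) < r"
    proof (intro exI allI impI)
      fix N assume "nat (\<bar>M\<bar> + \<bar>i\<bar> + 1) \<le> N"
      then have N: "\<bar>M\<bar> + \<bar>i\<bar> + 1 \<le> int N" by simp
      have "norm (c (int N - i)) < r / 2" using N by (intro M) linarith
      moreover have "norm (c (- int N - i - 1)) < r / 2" using N by (intro M) linarith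
      ultimately show "norm (T i N - 0) < r"
        unfolding T_def using norm_triangle_ineq4[of "c (int N - i)" "c (- int N - i - 1)"] by simp
    qed
  qed
  have Jk: "norm (J (int k) N) \<le> 2 * B * real k" "norm (J (- int k) N) \<le> 2 * B * real k" for k N
  proof (induction k)
    case (Suc k)
    { case 1
      show ?case unfolding Js(1) using norm_triangle_ineq[of "J (int k) N" "T (int k) N"] Suc(1) TB[of "int k" N] by (simp add: algebra_simps)
    next
      case 2
      show ?case unfolding Js(2) using norm_triangle_ineq4[of "J (- int k) N" "T (- int k - 1) N"] Suc(2) TB[of "- int k - 1" N] by (simp add: algebra_simps)
    }
  qed (simp_all add: J0)
  \<comment> \<open>This linear growth in m is the reason for the weight 1 + |m| on
    \<open>a\<close>.\<close>
  have JB: "norm (J m N) \<le> 2 * B * \<bar>real_of_int m\<bar>" for m N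
  proof (cases "m \<ge> 0")
    case True then show ?thesis using Jk(1)[of "nat m" N] by simp
  next
    case False then show ?thesis using Jk(2)[of "nat (- m)" N] by simp
  qed
  have Jl: "(\<lambda>N. J (int k) N) \<longlonglongrightarrow> 0" "(\<lambda>N. J (- int k) N) \<longlonglongrightarrow> 0" for k
  proof (induction k)
    case (Suc k)
    { case 1
      show ?case unfolding Js(1) using tendsto_add[OF Suc(1) T0[of "int k"]] by simp
    next
      case 2
      show ?case unfolding Js(2) using tendsto_diff[OF Suc(2) T0[of "- int k - 1"]] by simp
    }
  qed (simp_all add: J0)
  have JL: "(\<lambda>N. J m N) \<longlonglongrightarrow> 0" for m
  proof (cases "m \<ge> 0")
    case True then show ?thesis using Jl(1)[of "nat m"] by simp
  next
    case False then show ?thesis using Jl(2)[of "nat (- m)"] by simp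
  qed
  have as: "asum a" by (rule wbound_abs_summable[OF a]) simp
  \<comment> \<open>Summing over m first uses that \<open>a\<close> has sum 1 and that its
    convolution with \<open>c\<close> vanishes.\<close>
  have aJ: "(\<Sum>n\<in>{- int N..int N}. c n) = (\<Sum>\<^sub>\<infinity>m. a m * J m N)" for N
  proof -
    have "((\<lambda>m. \<Sum>n\<in>{- int N..int N}. a m * c n + - (a m * c (n - m))) has_sum (\<Sum>n\<in>{- int N..int N}. c n)) UNIV"
    proof (rule has_sum_finite_sum)
      fix n
      have "((\<lambda>m. a m * c n) has_sum 1 * c n) UNIV"
        by (rule has_sum_cmult_left) (use has_sum_infsum[OF abs_summable_summable[OF as]] a1 in simp)
      moreover have "((\<lambda>m. - (a m * c (n - m))) has_sum - conv a c n) UNIV"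
        unfolding conv_def
        by (rule has_sum_uminusI, rule has_sum_infsum, rule abs_summable_summable, rule wbound_mult_bounded(1)[OF a _ B]) simp
      ultimately have "((\<lambda>m. a m * c n + - (a m * c (n - m))) has_sum 1 * c n + - conv a c n) UNIV" by (rule has_sum_add)
      then show "((\<lambda>m. a m * c n + - (a m * c (n - m))) has_sum c n) UNIV" by (simp add: conv0)
    qed simp
    moreover have "(\<Sum>n\<in>{- int N..int N}. a m * c n + - (a m * c (n - m))) = a m * J m N" for m
      unfolding J_def sum_distrib_left by (rule sum.cong) (auto simp: right_diff_distrib)
    ultimately have "((\<lambda>m. a m * J m N) has_sum (\<Sum>n\<in>{- int N..int N}. c n)) UNIV" by simp
    then show ?thesis by (simp add: infsumI)
  qed
  \<comment> \<open>The series in m converges uniformly in N, so finitely many m decide the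
    limit.\<close>
  have ul: "uniform_limit UNIV (\<lambda>A N. \<Sum>m\<in>A. a m * J m N) (\<lambda>N. \<Sum>\<^sub>\<infinity>m. a m * J m N) (finite_subsets_at_top UNIV)"
  proof (rule Weierstrass_m_test_general[where M="\<lambda>m. norm (a m) * (1 + \<bar>real_of_int m\<bar>) * (2 * B)"])
    show "(\<lambda>m. norm (a m) * (1 + \<bar>real_of_int m\<bar>) * (2 * B)) summable_on UNIV"
      by (intro summable_on_cmult_left wbound_weight_summable[OF a]) simp
    fix m N
    have "norm (a m * J m N) \<le> norm (a m) * (2 * B * \<bar>real_of_int m\<bar>)"
      unfolding norm_mult by (intro mult_left_mono JB) auto
    also have "\<dots> \<le> norm (a m) * ((1 + \<bar>real_of_int m\<bar>) * (2 * B))"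
      using B0 by (intro mult_left_mono) (auto simp: algebra_simps)
    finally show "norm (a m * J m N) \<le> norm (a m) * (1 + \<bar>real_of_int m\<bar>) * (2 * B)" by (simp add: mult.assoc)
  qed
  show ?thesis unfolding aJ
  proof (rule LIMSEQ_I)
    fix r :: real assume r: "0 < r"
    then have "\<forall>\<^sub>F A in finite_subsets_at_top UNIV. \<forall>N. dist (\<Sum>m\<in>A. a m * J m N) (\<Sum>\<^sub>\<infinity>m. a m * J m N) < r / 2"
      using ul by (auto simp: uniform_limit_iff dest: spec[of _ "r / 2"])
    then obtain A where A': "finite A" "\<forall>Y. finite Y \<and> A \<subseteq> Y \<and> Y \<subseteq> UNIV \<longrightarrow> (\<forall>N. dist (\<Sum>m\<in>Y. a m * J m N) (\<Sum>\<^sub>\<infinity>m. a m * J m N) < r / 2)"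
      unfolding eventually_finite_subsets_at_top by (elim exE conjE) (rule that)
    have A: "dist (\<Sum>m\<in>A. a m * J m N) (\<Sum>\<^sub>\<infinity>m. a m * J m N) < r / 2" for N
      using A'(2)[rule_format, of A] A'(1) by simp
    have "(\<lambda>N. \<Sum>m\<in>A. a m * J m N) \<longlonglongrightarrow> (\<Sum>m\<in>A. a m * 0)"
      by (intro tendsto_sum tendsto_mult JL tendsto_const)
    then have "(\<lambda>N. \<Sum>m\<in>A. a m * J m N) \<longlonglongrightarrow> 0" by simp
    from LIMSEQ_D[OF this, of "r / 2"] r
    obtain no where no: "\<And>N. N \<ge> no \<Longrightarrow> norm (\<Sum>m\<in>A. a m * J m N) < r / 2" by auto
    show "\<exists>no. \<forall>N\<ge>no. norm ((\<Sum>\<^sub>\<infinity>m. a m * J m N) - 0) < r"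
    proof (intro exI[of _ no] allI impI)
      fix N assume "N \<ge> no"
      then show "norm ((\<Sum>\<^sub>\<infinity>m. a m * J m N) - 0) < r"
        using no[of N] A[of N] norm_triangle_sub[of "\<Sum>\<^sub>\<infinity>m. a m * J m N" "\<Sum>m\<in>A. a m * J m N"]
        by (simp add: dist_norm norm_minus_commute)
    qed
  qed
qed

section \<open>One step of the construction\<close>

lemma wbound_le:
  assumes "wbound v K c" "\<And>n. norm (c' n) \<le> norm (c n)" "\<And>n. 0 \<le> v n"
  shows "wbound v K c'"
  unfolding wbound_def
proof (intro allI impI)
  fix A :: "'a set" assume A: "finite A"
  have "(\<Sum>n\<in>A. norm (c' n) * v n) \<le> (\<Sum>n\<in>A. norm (c n) * v n)" by (intro sum_mono mult_right_mono assms)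
  then show "(\<Sum>n\<in>A. norm (c' n) * v n) \<le> K" using wboundD[OF assms(1) A] by linarith
qed

lemma conv_add_right:
  assumes c: "wbound v K c" "\<And>n. 1 \<le> v n" and x: "\<And>n. norm (x n) \<le> B" and y: "\<And>n. norm (y n) \<le> B'"
  shows "conv c (\<lambda>n. x n + y n) n = conv c x n + conv c y n"
proof -
  have "((\<lambda>m. c m * x (n - m) + c m * y (n - m)) has_sum conv c x n + conv c y n) UNIV"
    unfolding conv_def
    by (rule has_sum_add[OF has_sum_infsum[OF abs_summable_summable[OF wbound_mult_bounded(1)[OF c x]]]
          has_sum_infsum[OF abs_summable_summable[OF wbound_mult_bounded(1)[OF c y]]]])
  then show ?thesis unfolding conv_def[of c "\<lambda>n. x n + y n"] by (intro infsumI) (simp add: distrib_left)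
qed

lemma conv_scaled_unitseq: "conv c (\<lambda>n. z * unitseq n) n = z * c n"
proof -
  have "conv c (\<lambda>n. z * unitseq n) n = (\<Sum>\<^sub>\<infinity>m. (if m = n then c m * z else 0))"
    unfolding conv_def unitseq_def by (rule infsum_cong) auto
  then show ?thesis by (simp add: infsum_delta_int mult.commute)
qed

locale high_phase =
  fixes \<sigma> :: real and M :: nat
  assumes \<sigma>: "0 < \<sigma>" and M: "1 \<le> M" and s: "4 / sqrt M \<le> \<sigma>"
begin

definition X where "X = 2 * real M * (1 + 8 / \<sigma>\<^sup>2)"

lemma weights_ge: "1 \<le> sw \<sigma> n" "1 \<le> sw (1 / real M) n" "0 \<le> sw \<sigma> n"
  using sw_ge_1[of \<sigma> n] sw_ge_1[of "1 / real M" n] \<sigma> by auto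

lemma wbound_comp: "wbound (sw \<sigma>) G q \<Longrightarrow> wbound (sw (1 / real M)) (X * G) (compphase q M)"
  unfolding X_def by (rule compphase_bounds(1)[OF _ \<sigma> M s])

lemma norm_comp: "wbound (sw \<sigma>) G q \<Longrightarrow> norm (compphase q M n) \<le> X * G"
  using wbound_term[OF wbound_one[OF wbound_comp weights_ge(2)], of G q n] by simp

text \<open>The mean is split off because \<open>phase 0\<close> belongs to the constant 1 and has
  no decay; it yields the main term \<open>q 0 * c\<close> of a step.\<close>

lemma wbound_offcenter:
  assumes q: "wbound (sw \<sigma>) G q"
  shows "wbound (sw \<sigma>) G (\<lambda>a. q a - q 0 * unitseq a)"
  by (rule wbound_le[OF q]) (auto simp: unitseq_def weights_ge)

lemma compphase_split:
  assumes q: "wbound (sw \<sigma>) G q"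
  shows "compphase q M n = compphase (\<lambda>a. q a - q 0 * unitseq a) M n + q 0 * unitseq n"
proof -
  have "wbound (sw \<sigma>) (norm (q 0)) (\<lambda>a. q 0 * unitseq a)"
    by (auto simp: wbound_def unitseq_def if_distrib if_distribR sum.delta sw_def cong: if_cong)
  from compphase_diff[OF q this \<sigma> M s] show ?thesis by (simp add: compphase_unitseq)
qed

lemma conv_split:
  assumes c: "wbound v K c" "\<And>n. 1 \<le> v n" and q: "wbound (sw \<sigma>) G q"
  shows "conv c (compphase q M) n = conv c (compphase (\<lambda>a. q a - q 0 * unitseq a) M) n + q 0 * c n"
proof -
  have "conv c (compphase q M) n = conv c (\<lambda>n. compphase (\<lambda>a. q a - q 0 * unitseq a) M n + q 0 * unitseq n) n"
    by (intro arg_cong2[of _ _ _ _ "\<lambda>x n. conv c x n"] ext refl) (rule compphase_split[OF q])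
  also have "\<dots> = conv c (compphase (\<lambda>a. q a - q 0 * unitseq a) M) n + conv c (\<lambda>n. q 0 * unitseq n) n"
    by (rule conv_add_right[OF c, where B="X * G" and B'="norm (q 0)"])
       (use norm_comp[OF wbound_offcenter[OF q]] in \<open>auto simp: unitseq_def\<close>)
  finally show ?thesis by (simp add: conv_scaled_unitseq)
qed

text \<open>Off the mean only frequencies M * a with |a| >= 1 occur, and their coefficients are at
  most 20 M powr (- 1 / 3); convolution with a summable sequence keeps this up to its norm.\<close>

lemma step_uniform:
  assumes c: "wbound v K c" "\<And>n. 1 \<le> v n" and q: "wbound (sw \<sigma>) G q"
  shows "norm (conv c (compphase q M) n - q 0 * c n) \<le> K * (G * (20 * real M powr (- 1 / 3)))"
proof -
  let ?q = "\<lambda>a. q a - q 0 * unitseq a"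
  have "norm (compphase ?q M n) \<le> G * (20 * real M powr (- 1 / 3))" for n
  proof (rule norm_compphase_le[OF wbound_offcenter[OF q] \<sigma>])
    fix a assume "?q a \<noteq> 0"
    then have a: "a \<noteq> 0" by (auto simp: unitseq_def)
    have "norm (phase (int M * a) n) \<le> 20 * \<bar>real_of_int (int M * a)\<bar> powr (- 1 / 3)"
      using a M by (intro norm_phase_decay) auto
    also have "\<bar>real_of_int (int M * a)\<bar> powr (- 1 / 3) \<le> real M powr (- 1 / 3)"
    proof (rule powr_mono2')
      have "1 \<le> \<bar>real_of_int a\<bar>" using a by linarith
      then have "real M * 1 \<le> real M * \<bar>real_of_int a\<bar>" by (intro mult_left_mono) auto
      then show "real M \<le> \<bar>real_of_int (int M * a)\<bar>" by (simp add: abs_mult)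
    qed (use M in auto)
    finally show "norm (phase (int M * a) n) \<le> 20 * real M powr (- 1 / 3)" by simp
  qed auto
  then have "norm (conv c (compphase ?q M) n) \<le> K * (G * (20 * real M powr (- 1 / 3)))"
    by (intro norm_conv_le[OF c])
  then show ?thesis using conv_split[OF c q, of n] by simp
qed

text \<open>In \<open>c m * x (n - m)\<close> with n < 0 one factor is always small: either n - m <=
  M / 2, which is left of half of every frequency that the one-sided \<open>q\<close> contributes
  off its mean, or m < - M / 2, where the weight makes \<open>c m\<close> small.\<close>

lemma step_left:
  assumes c: "wbound (sw \<theta>) K c" "0 \<le> \<theta>" and q: "wbound (sw \<sigma>) G q"
    and q0: "q 0 = 1" and qneg: "\<And>a. a < 0 \<Longrightarrow> q a = 0" and n: "n < 0"
  shows "norm (conv c (compphase q M) n - c n) \<le> K * (G * exp (- real M)) + K * exp (- (\<theta> * sqrt (M / 2))) * (X * G)"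
proof -
  let ?q = "\<lambda>a. q a - q 0 * unitseq a"
  define x where "x = compphase ?q M"
  have c1: "1 \<le> sw \<theta> n" for n by (rule sw_ge_1[OF c(2)])
  have K0: "0 \<le> K" using wbound_nonneg[OF c(1)] .
  have x1: "norm (x m) \<le> G * exp (- real M)" if m: "2 * m \<le> int M" for m
    unfolding x_def
  proof (rule norm_compphase_le[OF wbound_offcenter[OF q] \<sigma>])
    fix a assume "?q a \<noteq> 0"
    then have "a \<noteq> 0" "\<not> a < 0" using qneg by (auto simp: unitseq_def)
    then have a: "1 \<le> a" by simp
    then have Ma: "int M \<le> int M * a" using mult_left_mono[of 1 a "int M"] by simp
    have "norm (phase (int M * a) m) \<le> exp (- of_int (int M * a))"
    proof (rule norm_phase_left)
      show "1 \<le> int M * a" using Ma M by linarith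
      show "2 * m \<le> int M * a" using Ma m by linarith
    qed
    also have "\<dots> \<le> exp (- real M)"
    proof -
      have "real_of_int (int M) \<le> real_of_int (int M * a)" using Ma by (simp only: of_int_le_iff)
      then show ?thesis by simp
    qed
    finally show "norm (phase (int M * a) m) \<le> exp (- real M)" .
  qed auto
  have x2: "wbound (\<lambda>_. 1) (X * G) x" unfolding x_def by (rule wbound_one[OF wbound_comp[OF wbound_offcenter[OF q]] weights_ge(2)])
  have c2: "norm (c m) \<le> K * exp (- (\<theta> * sqrt (M / 2)))" if m: "real M / 2 \<le> \<bar>real_of_int m\<bar>" for m
  proof -
    have "norm (c m) * exp (\<theta> * sqrt (M / 2)) \<le> norm (c m) * sw \<theta> m"
      unfolding sw_def using m c(2) by (intro mult_left_mono) (auto intro!: mult_left_mono)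
    also have "\<dots> \<le> K" by (rule wbound_term[OF c(1)])
    finally show ?thesis by (simp add: exp_minus field_simps)
  qed
  have xs: "(\<lambda>m. norm (x (n - m))) summable_on UNIV" "(\<Sum>\<^sub>\<infinity>m. norm (x (n - m))) \<le> X * G"
  proof -
    have "asum x" by (rule wbound_abs_summable[OF x2]) simp
    then have "(\<lambda>m. norm (x m)) summable_on range (\<lambda>m. n - m)" by (rule summable_on_subset_banach) simp
    then show "(\<lambda>m. norm (x (n - m))) summable_on UNIV"
      by (subst (asm) summable_on_reindex) (auto simp: inj_on_def o_def)
    have "(\<Sum>\<^sub>\<infinity>m. norm (x (n - m))) = (\<Sum>\<^sub>\<infinity>m. norm (x m))"
      by (rule infsum_reindex_bij_witness[of _ "\<lambda>m. n - m" "\<lambda>m. n - m"]) auto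
    then show "(\<Sum>\<^sub>\<infinity>m. norm (x (n - m))) \<le> X * G" using wbound_infsum_norm[OF x2] by simp
  qed
  let ?E = "K * exp (- (\<theta> * sqrt (M / 2)))"
  have cs: "asum c" by (rule wbound_abs_summable[OF c(1) c1])
  have G0: "0 \<le> G * exp (- real M)" using wbound_nonneg[OF q] by simp
  have tm: "norm (c m * x (n - m)) \<le> norm (c m) * (G * exp (- real M)) + ?E * norm (x (n - m))" for m
  proof (cases "2 * (n - m) \<le> int M")
    case True
    have "norm (c m * x (n - m)) \<le> norm (c m) * (G * exp (- real M))"
      unfolding norm_mult by (intro mult_left_mono x1 True) auto
    moreover have "0 \<le> ?E * norm (x (n - m))" using K0 by simp
    ultimately show ?thesis by linarith
  next
    case False
    then have "int M \<le> 2 * (- m)" using n by presburger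
    also have "\<dots> \<le> 2 * \<bar>m\<bar>" by simp
    finally have "real_of_int (int M) \<le> real_of_int (2 * \<bar>m\<bar>)" by (subst of_int_le_iff)
    then have "norm (c m) \<le> ?E" by (intro c2) simp
    then have "norm (c m * x (n - m)) \<le> ?E * norm (x (n - m))" unfolding norm_mult by (intro mult_right_mono) auto
    moreover have "0 \<le> norm (c m) * (G * exp (- real M))" using G0 by simp
    ultimately show ?thesis by linarith
  qed
  have s1: "(\<lambda>m. norm (c m) * (G * exp (- real M))) summable_on UNIV" by (rule summable_on_cmult_left[OF cs])
  have s2: "(\<lambda>m. ?E * norm (x (n - m))) summable_on UNIV" by (rule summable_on_cmult_right[OF xs(1)])
  have "norm (conv c x n) \<le> (\<Sum>\<^sub>\<infinity>m. norm (c m) * (G * exp (- real M)) + ?E * norm (x (n - m)))"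
    unfolding conv_def by (rule norm_infsum_le_bound[OF summable_on_add[OF s1 s2] tm])
  also have "\<dots> = (\<Sum>\<^sub>\<infinity>m. norm (c m) * (G * exp (- real M))) + (\<Sum>\<^sub>\<infinity>m. ?E * norm (x (n - m)))"
    by (rule infsum_add[OF s1 s2])
  also have "(\<Sum>\<^sub>\<infinity>m. norm (c m) * (G * exp (- real M))) = (\<Sum>\<^sub>\<infinity>m. norm (c m)) * (G * exp (- real M))"
    by (rule infsum_cmult_left) (use cs in auto)
  also have "(\<Sum>\<^sub>\<infinity>m. ?E * norm (x (n - m))) = ?E * (\<Sum>\<^sub>\<infinity>m. norm (x (n - m)))"
    by (rule infsum_cmult_right) (use xs in auto)
  also have "(\<Sum>\<^sub>\<infinity>m. norm (c m)) * (G * exp (- real M)) \<le> K * (G * exp (- real M))"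
    by (intro mult_right_mono wbound_infsum_norm[OF c(1) c1] G0)
  also have "?E * (\<Sum>\<^sub>\<infinity>m. norm (x (n - m))) \<le> ?E * (X * G)"
    using K0 by (intro mult_left_mono xs(2)) auto
  finally have "norm (conv c x n) \<le> K * (G * exp (- real M)) + ?E * (X * G)" by simp
  then show ?thesis using conv_split[OF c(1) c1 q, of n] by (simp add: q0 x_def)
qed

end

section \<open>The limit series\<close>

lemma fser_periodic: "fser c (t + 2 * pi * of_int m) = fser c t"
proof -
  have "cis (of_int n * (t + 2 * pi * of_int m)) = cis (of_int n * t)" for n
  proof -
    have "cis (of_int n * (t + 2 * pi * of_int m)) = cis (of_int n * t) * cis (2 * pi * of_int (n * m))"
      unfolding cis_mult by (simp add: algebra_simps)
    also have "cis (2 * pi * of_int (n * m)) = 1" by (rule cis_multiple_2pi) auto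
    finally show ?thesis by simp
  qed
  then show ?thesis by (simp add: fser_def)
qed

lemma cos_gt_imp_near_period:
  assumes r: "0 < r" "r \<le> 1" and c: "cos r < cos t"
  shows "\<exists>m::int. \<bar>t - 2 * pi * of_int m\<bar> < r"
proof -
  define m where "m = \<lfloor>(t + pi) / (2 * pi)\<rfloor>"
  define u where "u = t - 2 * pi * of_int m"
  have "of_int m \<le> (t + pi) / (2 * pi)" "(t + pi) / (2 * pi) < of_int m + 1" unfolding m_def by linarith+
  then have "2 * pi * of_int m \<le> t + pi" "t + pi < 2 * pi * of_int m + 2 * pi" by (simp_all add: field_simps)
  then have u: "\<bar>u\<bar> \<le> pi" by (auto simp: u_def)
  have "cis u = cis t"
    using cis_multiple_2pi[of "of_int (- m)"] cis_mult[of t "2 * pi * of_int (- m)"] by (simp add: u_def)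
  then have "cos u = cos t" by (simp add: complex_eq_iff)
  have "\<bar>u\<bar> < r"
  proof (rule ccontr)
    assume "\<not> \<bar>u\<bar> < r"
    then have "cos \<bar>u\<bar> \<le> cos r" using r u by (intro cos_monotone_0_pi_le) auto
    then show False using c \<open>cos u = cos t\<close> by simp
  qed
  then show ?thesis unfolding u_def by blast
qed

text \<open>The sequence \<open>y k\<close>, which adds (1 / 2)^(k + 1) to \<open>x k\<close>,
  absorbs the errors and decreases, so x converges. With a positive limit, the telescoping bound on
  the sum of \<open>\<eta> k * x k\<close> would force \<eta> to be summable.\<close>

lemma contracting_sequence_tendsto_0:
  fixes x \<eta> :: "nat \<Rightarrow> real"
  assumes x0: "\<And>k. 0 \<le> x k" and \<eta>0: "\<And>k. 0 \<le> \<eta> k" and div: "\<not> summable \<eta>"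
    and rec: "\<And>k. x (Suc k) \<le> (1 - \<eta> k) * x k + (1 / 2) ^ (k + 2)"
  shows "x \<longlonglongrightarrow> 0"
proof -
  define y where "y k = x k + (1 / 2) ^ (k + 1)" for k
  have y0: "0 \<le> y k" for k using x0[of k] by (simp add: y_def)
  have ys: "y (Suc k) \<le> y k - \<eta> k * x k" for k using rec[of k] by (simp add: y_def algebra_simps)
  have "decseq y"
  proof (rule decseq_SucI)
    fix k show "y (Suc k) \<le> y k" using ys[of k] mult_nonneg_nonneg[OF \<eta>0[of k] x0[of k]] by linarith
  qed
  then obtain L where L: "y \<longlonglongrightarrow> L" by (rule decseq_convergent[of y 0]) (use y0 in auto)
  have L0: "0 \<le> L" by (rule LIMSEQ_le_const[OF L]) (use y0 in auto)
  have "(\<lambda>k. (1 / 2 :: real) ^ (k + 1)) \<longlonglongrightarrow> 0"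
    by (rule LIMSEQ_ignore_initial_segment) (rule LIMSEQ_power_zero, simp)
  from tendsto_diff[OF L this] have xL: "x \<longlonglongrightarrow> L" by (simp add: y_def)
  have "L = 0"
  proof (rule ccontr)
    assume "L \<noteq> 0"
    then have Lp: "0 < L" using L0 by simp
    have part: "(\<Sum>j<n. \<eta> j * x j) \<le> y 0" for n
    proof -
      have "(\<Sum>j<n. \<eta> j * x j) \<le> y 0 - y n"
      proof (induction n)
        case (Suc n) then show ?case using ys[of n] by simp
      qed simp
      then show ?thesis using y0[of n] by linarith
    qed
    have "summable (\<lambda>j. \<eta> j * x j)"
      by (rule summableI_nonneg_bounded[of _ "y 0"]) (use \<eta>0 x0 part in auto)
    then have s: "summable (\<lambda>j. 2 / L * (\<eta> j * x j))" by (rule summable_mult)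
    have "\<forall>\<^sub>F k in sequentially. L / 2 < x k" using order_tendstoD(1)[OF xL, of "L / 2"] Lp by simp
    then obtain N where N: "\<And>k. N \<le> k \<Longrightarrow> L / 2 < x k" by (auto simp: eventually_sequentially)
    have "summable \<eta>"
    proof (rule summable_comparison_test'[OF s])
      fix k assume "N \<le> k"
      then have "\<eta> k * (L / 2) \<le> \<eta> k * x k" using N[of k] \<eta>0 by (intro mult_left_mono) auto
      then show "norm (\<eta> k) \<le> 2 / L * (\<eta> k * x k)" using Lp \<eta>0[of k] by (simp add: field_simps)
    qed
    then show False using div by simp
  qed
  then show ?thesis using xL by simp
qed

text \<open>Separates the construction from the choice of parameters. \<open>E1\<close> makes the
  steps summable, \<open>E2\<close> and \<open>E3\<close> bring the two error terms of
  \<open>step_left\<close> down to exp (- W), and \<open>XG\<close> bounds the norm of a composed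
  factor.\<close>

locale null_series =
  fixes M :: "nat \<Rightarrow> nat" and s \<sigma> W \<eta> :: "nat \<Rightarrow> real" and P R \<psi> :: "nat \<Rightarrow> int \<Rightarrow> complex" and h :: "nat \<Rightarrow> real \<Rightarrow> real"
  assumes M1: "\<And>k. 1 \<le> M k" and sM: "\<And>k. real (M k) = exp (s k)"
    and sS: "\<And>k. s (Suc k) = 32 * s k" and sk: "\<And>k. 20 * (real k + 2) \<le> s k"
    and \<sigma>0: "\<And>k. 0 < \<sigma> k" and \<sigma>M: "\<And>k. 4 / sqrt (real (M k)) \<le> \<sigma> k"
    and P: "\<And>k. wbound (sw (\<sigma> k)) (exp (s k / 10)) (P k)"
    and R: "\<And>k. wbound (sw (\<sigma> k)) (exp (s k / 10)) (R k)"
    and Q: "\<And>k. wbound (sw (\<sigma> k)) (exp (s k / 10)) (\<lambda>n. P k n - R k n)"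
    and \<psi>: "\<And>k. wbound (sw (\<sigma> k)) (exp (s k / 10)) (\<psi> k)"
    and XG: "\<And>k. 2 * real (M k) * (1 + 8 / (\<sigma> k)\<^sup>2) * exp (s k / 10) \<le> exp (2 * s k)"
    and P0: "\<And>k. P k 0 = 1" and Pneg: "\<And>k n. n < 0 \<Longrightarrow> P k n = 0"
    and Rsup: "\<And>k t. norm (fser (R k) t) \<le> exp (- W k)"
    and \<psi>h: "\<And>k t. fser (\<psi> k) t = complex_of_real (1 - h k t)"
    and h0: "\<And>k t. 0 \<le> h k t" and h1: "\<And>k t. h k t \<le> 1" and hc: "\<And>k. continuous_on UNIV (h k)"
    and \<psi>0: "\<And>k. norm (\<psi> k 0) \<le> 1 - \<eta> k" and \<eta>0: "\<And>k. 0 \<le> \<eta> k" and \<eta>div: "\<not> summable \<eta>"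
    and PR: "\<And>k t. h k t \<noteq> 0 \<Longrightarrow> fser (P k) t = fser (R k) t"
    and Ws: "\<And>k. s k \<le> W k"
    and E1: "\<And>k. 20 * exp (s k / 5 - s k / 3) + exp (s k / 10 - s k) \<le> exp (- s k / 20)"
    and E2: "\<And>k. exp (s k / 10) * exp (- exp (s k)) \<le> exp (- W k)"
    and E3: "\<And>k. exp (- (exp (15 / 32 * s k) / 2)) * exp (2 * s k) \<le> exp (- W k)"
begin

primrec cs :: "nat \<Rightarrow> int \<Rightarrow> complex" where
  "cs 0 = unitseq"
| "cs (Suc k) = conv (cs k) (compphase (\<lambda>n. P k n - R k n) (M k))"

text \<open>
  The functions with coefficients \<open>ds k\<close> are continuous majorants of the indicator of the set where no factor of
  the first \<open>k\<close> vanishes on a neighbourhood.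
\<close>

primrec ds :: "nat \<Rightarrow> int \<Rightarrow> complex" where
  "ds 0 = unitseq"
| "ds (Suc k) = conv (ds k) (compphase (\<psi> k) (M k))"

text \<open>The weight rate that survives at stage k is that of its last and highest frequency;
  stage 0 has no factor, and the value 1 there is at least all later rates.\<close>

definition th :: "nat \<Rightarrow> real" where "th k = (case k of 0 \<Rightarrow> 1 | Suc j \<Rightarrow> 1 / real (M j))"

lemma th_nonneg: "0 \<le> th k" by (simp add: th_def split: nat.split)

lemma th_eq: "th (Suc k) = exp (- s k)" by (simp add: th_def sM exp_minus divide_inverse)

lemma s_pos: "0 < s k" using sk[of k] by (smt (verit) of_nat_0_le_iff)

lemma th_Suc_le: "th (Suc k) \<le> th k"
proof (cases k)
  case 0 then show ?thesis using M1[of 0] by (simp add: th_def)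
next
  case (Suc j) then show ?thesis using sS[of j] s_pos[of j] by (simp add: th_eq)
qed

lemma th_ge: "exp (- s k / 32) \<le> th k"
proof (cases k)
  case 0 then show ?thesis using s_pos[of 0] by (simp add: th_def)
next
  case (Suc j) then show ?thesis using sS[of j] by (simp add: th_eq)
qed

lemma high_phase_step: "high_phase (\<sigma> k) (M k)"
  by unfold_locales (use \<sigma>0 M1 \<sigma>M in auto)

lemma comp_bound:
  assumes "wbound (sw (\<sigma> k)) (exp (s k / 10)) q"
  shows "wbound (sw (th (Suc k))) (exp (2 * s k)) (compphase q (M k))"
  using wbound_mono[OF compphase_bounds(1)[OF assms \<sigma>0 M1 \<sigma>M] order_refl XG] by (simp add: th_def)

lemma fser_comp:
  assumes "wbound (sw (\<sigma> k)) (exp (s k / 10)) q"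
  shows "fser (compphase q (M k)) t = fser q (real (M k) * (t + sin t / 100))"
  by (rule compphase_bounds(2)[OF assms \<sigma>0 M1 \<sigma>M])

text \<open>Budget of exponents: exp (s / 10) * exp (2 s) is at most exp (3 s), and since s grows by
  the factor 32 this is below exp (s / 10) for the next s. The norm invariant thus restores itself
  at each stage.\<close>

lemma product_bounds:
  assumes c: "wbound (sw (th k)) (exp (s k / 10)) c" and q: "wbound (sw (\<sigma> k)) (exp (s k / 10)) q"
  shows "wbound (sw (th (Suc k))) (exp (3 * s k)) (conv c (compphase q (M k)))"
    "wbound (sw (th (Suc k))) (exp (s (Suc k) / 10)) (conv c (compphase q (M k)))"
    "fser (conv c (compphase q (M k))) t = fser c t * fser q (real (M k) * (t + sin t / 100))"
proof -
  have c': "wbound (sw (th (Suc k))) (exp (s k / 10)) c"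
    by (rule wbound_mono[OF c sw_mono[OF th_Suc_le] order_refl])
  note S = conv_bounds[OF c' comp_bound[OF q] submult_sw[OF th_nonneg]]
  show "wbound (sw (th (Suc k))) (exp (3 * s k)) (conv c (compphase q (M k)))"
    by (rule wbound_mono[OF S(1)]) (use s_pos[of k] in \<open>auto simp: exp_add[symmetric]\<close>)
  show "wbound (sw (th (Suc k))) (exp (s (Suc k) / 10)) (conv c (compphase q (M k)))"
    by (rule wbound_mono[OF S(1)]) (use s_pos[of k] sS[of k] in \<open>auto simp: exp_add[symmetric]\<close>)
  show "fser (conv c (compphase q (M k))) t = fser c t * fser q (real (M k) * (t + sin t / 100))"
    unfolding S(2) by (simp add: fser_comp[OF q])
qed

lemma unit_bound: "wbound (sw (th 0)) (exp (s 0 / 10)) unitseq"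
  by (rule wbound_mono[OF wbound_unitseq[of "sw (th 0)"]]) (use s_pos[of 0] in \<open>auto simp: sw_def\<close>)

lemma cs_bound: "wbound (sw (th k)) (exp (s k / 10)) (cs k)"
proof (induction k)
  case (Suc k) show ?case unfolding cs.simps by (rule product_bounds(2)[OF Suc Q])
qed (simp add: unit_bound)

lemma ds_bound: "wbound (sw (th k)) (exp (s k / 10)) (ds k)"
proof (induction k)
  case (Suc k) show ?case unfolding ds.simps by (rule product_bounds(2)[OF Suc \<psi>])
qed (simp add: unit_bound)

lemma sw_th_ge_1: "1 \<le> sw (th k) n" by (rule sw_ge_1[OF th_nonneg])

lemma sw_sigma_ge_1: "1 \<le> sw (\<sigma> k) n" by (rule sw_ge_1) (use \<sigma>0 less_imp_le in auto)

lemma small_steps: "exp (- s k / 20) \<le> (1 / 2) ^ (k + 2)"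
proof -
  have "exp (- s k / 20) \<le> exp (real (k + 2) * (- 1))" using sk[of k] by simp
  also have "\<dots> = exp (- 1) ^ (k + 2)" by (rule exp_of_nat_mult)
  also have "\<dots> \<le> (1 / 2) ^ (k + 2)"
  proof (rule power_mono)
    show "exp (- 1 :: real) \<le> 1 / 2" using exp_ge_add_one_self[of "1::real"] by (simp add: exp_minus field_simps)
  qed simp
  finally show ?thesis .
qed

lemma M_powr: "real (M k) powr (- 1 / 3) = exp (- s k / 3)"
  by (simp add: sM powr_def)

lemma uniform_step:
  assumes c: "wbound (sw (th k)) (exp (s k / 10)) c" and q: "wbound (sw (\<sigma> k)) (exp (s k / 10)) q"
  shows "norm (conv c (compphase q (M k)) n - q 0 * c n) \<le> 20 * exp (s k / 5 - s k / 3)"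
proof -
  interpret high_phase "\<sigma> k" "M k" by (rule high_phase_step)
  have "norm (conv c (compphase q (M k)) n - q 0 * c n) \<le> exp (s k / 10) * (exp (s k / 10) * (20 * real (M k) powr (- 1 / 3)))"
    by (rule step_uniform[OF c _ q]) (rule sw_th_ge_1)
  also have "\<dots> = 20 * (exp (s k / 10) * exp (s k / 10) * exp (- s k / 3))" by (simp only: M_powr mult_ac)
  also have "exp (s k / 10) * exp (s k / 10) * exp (- s k / 3) = exp (s k / 5 - s k / 3)" by (simp add: exp_add[symmetric])
  finally show ?thesis .
qed

lemma R_coeff: "norm (R k n) \<le> exp (- W k)"
  by (rule norm_coeff_le[OF R sw_sigma_ge_1 Rsup])

lemma cs_term: "norm (cs k n) \<le> exp (s k / 10)"
  using wbound_term[OF wbound_one[OF cs_bound sw_th_ge_1], of k n] by simp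

text \<open>The factor has mean 1 - \<open>R k 0\<close>. The defect is at most exp (- W) <= exp (-
  s), and \<open>uniform_step\<close> bounds the oscillating part.\<close>

lemma cs_step: "norm (cs (Suc k) n - cs k n) \<le> (1 / 2) ^ (k + 2)"
proof -
  have a1: "norm (cs (Suc k) n - (P k 0 - R k 0) * cs k n) \<le> 20 * exp (s k / 5 - s k / 3)"
    unfolding cs.simps by (rule uniform_step[OF cs_bound Q])
  have a2: "norm (R k 0 * cs k n) \<le> exp (s k / 10 - s k)"
  proof -
    have "norm (R k 0 * cs k n) \<le> exp (- W k) * exp (s k / 10)" unfolding norm_mult by (intro mult_mono R_coeff cs_term) auto
    also have "\<dots> \<le> exp (- s k) * exp (s k / 10)" using Ws[of k] by simp
    also have "\<dots> = exp (s k / 10 - s k)" by (simp add: exp_add[symmetric])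
    finally show ?thesis .
  qed
  have a3: "cs (Suc k) n - cs k n = (cs (Suc k) n - (P k 0 - R k 0) * cs k n) - R k 0 * cs k n"
    by (simp only: P0) (simp add: algebra_simps del: cs.simps)
  have "norm (cs (Suc k) n - cs k n) \<le> 20 * exp (s k / 5 - s k / 3) + exp (s k / 10 - s k)"
    unfolding a3 by (rule order_trans[OF norm_triangle_ineq4 add_mono[OF a1 a2]])
  then show ?thesis using E1[of k] small_steps[of k] by linarith
qed

text \<open>The factor is split as P - R. For P, which has no negative frequencies,
  \<open>step_left\<close> gives two terms. R lacks this structure, but its values, and so its
  coefficients after composition, are at most exp (- W). Each of the three terms is at most exp (s /
  10 - W).\<close>

lemma cs_left_step:
  assumes n: "n < 0"
  shows "norm (cs (Suc k) n - cs k n) \<le> 3 * exp (s k / 10 - W k)"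
proof -
  interpret high_phase "\<sigma> k" "M k" by (rule high_phase_step)
  let ?K = "exp (s k / 10)"
  have cP: "compphase (\<lambda>n. P k n - R k n) (M k) = (\<lambda>n. compphase (P k) (M k) n + - compphase (R k) (M k) n)"
    using compphase_diff[OF P R \<sigma>0 M1 \<sigma>M] by auto
  have Rb: "norm (compphase (R k) (M k) n) \<le> exp (- W k)" for n
    by (rule norm_coeff_le[OF wbound_comp[OF R]]) (auto simp: fser_comp[OF R] Rsup sw_ge_1)
  have "cs (Suc k) n = conv (cs k) (compphase (P k) (M k)) n + conv (cs k) (\<lambda>n. - compphase (R k) (M k) n) n"
    unfolding cs.simps cP
    by (rule conv_add_right[OF cs_bound sw_th_ge_1, where B="X * exp (s k / 10)" and B'="exp (- W k)"])
       (use norm_comp[OF P] Rb in auto)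
  moreover have "norm (conv (cs k) (\<lambda>n. - compphase (R k) (M k) n) n) \<le> ?K * exp (- W k)"
    by (rule norm_conv_le[OF cs_bound sw_th_ge_1]) (use Rb in auto)
  moreover have "norm (conv (cs k) (compphase (P k) (M k)) n - cs k n) \<le> ?K * exp (- W k) + ?K * exp (- W k)"
  proof -
    have "norm (conv (cs k) (compphase (P k) (M k)) n - cs k n)
        \<le> ?K * (?K * exp (- real (M k))) + ?K * exp (- (th k * sqrt (real (M k) / 2))) * (X * ?K)"
      by (rule step_left[OF cs_bound th_nonneg P P0 Pneg n])
    also have "?K * (?K * exp (- real (M k))) \<le> ?K * exp (- W k)"
      using E2[of k] by (intro mult_left_mono) (auto simp: sM)
    also have "?K * exp (- (th k * sqrt (real (M k) / 2))) * (X * ?K) \<le> ?K * exp (- W k)"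
    proof -
      have "X * ?K \<le> exp (2 * s k)" using XG[of k] by (simp add: X_def)
      moreover have "exp (- (th k * sqrt (real (M k) / 2))) \<le> exp (- (exp (15 / 32 * s k) / 2))"
      proof -
        \<comment> \<open>The rate \<open>th k\<close> is at least exp (- s / 32) and sqrt M = exp
          (s / 2); their product is the origin of 15 / 32.\<close>
        have "exp (s k / 2) / 2 \<le> sqrt (real (M k) / 2)"
          by (rule real_le_rsqrt) (simp add: sM power_divide exp_double[symmetric])
        then have "exp (- s k / 32) * (exp (s k / 2) / 2) \<le> th k * sqrt (real (M k) / 2)"
          by (intro mult_mono th_ge th_nonneg) auto
        moreover have "exp (- s k / 32) * (exp (s k / 2) / 2) = exp (15 / 32 * s k) / 2" by (simp add: exp_add[symmetric])
        ultimately show ?thesis by simp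
      qed
      ultimately have "exp (- (th k * sqrt (real (M k) / 2))) * (X * ?K) \<le> exp (- (exp (15 / 32 * s k) / 2)) * exp (2 * s k)"
        by (intro mult_mono) (auto simp: X_def)
      then have "exp (- (th k * sqrt (real (M k) / 2))) * (X * ?K) \<le> exp (- W k)" using E3[of k] by linarith
      then have "?K * (exp (- (th k * sqrt (real (M k) / 2))) * (X * ?K)) \<le> ?K * exp (- W k)" by (intro mult_left_mono) auto
      then show ?thesis by (simp only: mult.assoc)
    qed
    finally show ?thesis by simp
  qed
  ultimately have "norm (cs (Suc k) n - cs k n) \<le> 3 * (?K * exp (- W k))"
    using norm_triangle_ineq[of "conv (cs k) (compphase (P k) (M k)) n - cs k n" "conv (cs k) (\<lambda>n. - compphase (R k) (M k) n) n"]
    by (simp add: algebra_simps)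
  then show ?thesis by (simp add: exp_add[symmetric])
qed

text \<open>Serves the indices of either sign beyond a fixed power of \<open>M k\<close>, where a
  stage is small by its weight alone.\<close>

lemma cs_right_decay: "norm (cs (Suc k) n) \<le> exp (3 * s k) * exp (- (sqrt \<bar>real_of_int n\<bar> * exp (- s k)))"
proof -
  have "wbound (sw (th (Suc k))) (exp (3 * s k)) (cs (Suc k))" unfolding cs.simps by (rule product_bounds(1)[OF cs_bound Q])
  from wbound_term[OF this, of n] show ?thesis
    by (simp add: sw_def th_eq exp_minus field_simps)
qed

section \<open>The limit coefficients\<close>

definition lc :: "int \<Rightarrow> complex" where "lc n = lim (\<lambda>k. cs k n)"

lemma cs_tail:
  "norm (cs (k + j) n - cs k n) \<le> (1 / 2) ^ (k + 1) - (1 / 2) ^ (k + j + 1)"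
proof (induction j)
  case (Suc j)
  have "norm (cs (k + Suc j) n - cs k n) \<le> norm (cs (Suc (k + j)) n - cs (k + j) n) + norm (cs (k + j) n - cs k n)"
    using norm_triangle_ineq[of "cs (Suc (k + j)) n - cs (k + j) n" "cs (k + j) n - cs k n"] by simp
  also have "\<dots> \<le> (1 / 2) ^ (k + j + 2) + ((1 / 2) ^ (k + 1) - (1 / 2) ^ (k + j + 1))"
    by (intro add_mono cs_step Suc)
  also have "\<dots> = (1 / 2) ^ (k + 1) - (1 / 2) ^ (k + Suc j + 1)" by simp
  finally show ?case .
qed simp

lemma cs_lim: "(\<lambda>k. cs k n) \<longlonglongrightarrow> lc n"
proof -
  have "summable (\<lambda>k. cs (Suc k) n - cs k n)"
  proof (rule summable_comparison_test'[where N=0])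
    show "summable (\<lambda>k. (1 / 2 :: real) ^ (k + 2))" by (rule summable_ignore_initial_segment) (rule summable_geometric, simp)
  qed (rule cs_step)
  then have "(\<lambda>m. \<Sum>k<m. cs (Suc k) n - cs k n) \<longlonglongrightarrow> (\<Sum>k. cs (Suc k) n - cs k n)" by (rule summable_LIMSEQ)
  then have "(\<lambda>m. (cs m n - cs 0 n) + cs 0 n) \<longlonglongrightarrow> (\<Sum>k. cs (Suc k) n - cs k n) + cs 0 n"
    unfolding sum_lessThan_telescope[of "\<lambda>k. cs k n"] by (rule tendsto_add[OF _ tendsto_const])
  then have "convergent (\<lambda>k. cs k n)" by (auto simp: convergent_def simp del: cs.simps)
  then show ?thesis unfolding lc_def by (simp only: convergent_LIMSEQ_iff)
qed

lemma lc_dist: "norm (lc n - cs k n) \<le> (1 / 2) ^ (k + 1)"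
proof -
  have "(\<lambda>j. norm (cs (j + k) n - cs k n)) \<longlonglongrightarrow> norm (lc n - cs k n)"
    by (intro tendsto_intros LIMSEQ_ignore_initial_segment cs_lim)
  then show ?thesis
  proof (rule LIMSEQ_le_const2)
    have "norm (cs (j + k) n - cs k n) \<le> (1 / 2) ^ (k + 1)" for j
      using cs_tail[of k j n] zero_le_power[of "1 / 2 :: real" "k + j + 1"] unfolding add.commute[of j k] by linarith
    then show "\<exists>N. \<forall>j\<ge>N. norm (cs (j + k) n - cs k n) \<le> (1 / 2) ^ (k + 1)" by blast
  qed
qed

text \<open>The coefficient at 0 starts as 1 and changes by at most 1 / 2 in total.\<close>

lemma lc_nonzero: "lc 0 \<noteq> 0"
proof
  assume "lc 0 = 0"
  then show False using lc_dist[of 0 0] by (simp add: unitseq_def)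
qed

lemma lc_bounded: "norm (lc n) \<le> 2"
proof -
  have "norm (lc n) \<le> norm (lc n - cs 0 n) + norm (cs 0 n)" using norm_triangle_ineq[of "lc n - cs 0 n" "cs 0 n"] by simp
  also have "norm (cs 0 n) \<le> 1" by (simp add: unitseq_def)
  also have "norm (lc n - cs 0 n) \<le> 1 / 2" using lc_dist[of n 0] by simp
  finally show ?thesis by simp
qed

text \<open>Each stage tends to zero by its weight, and the stages approximate the limit uniformly
  in n.\<close>

lemma lc_tendsto_0:
  assumes e: "0 < e"
  shows "\<exists>N. \<forall>n. N \<le> \<bar>n\<bar> \<longrightarrow> norm (lc n) < e"
proof -
  obtain k where k: "(1 / 2 :: real) ^ k < e / 2" using real_arch_pow_inv[of "e / 2" "1 / 2"] e by auto
  have k': "(1 / 2 :: real) ^ (k + 1) < e / 2" using k by (simp add: field_simps)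
  define K where "K = exp (s k / 10)"
  have th: "0 < th k" by (simp add: th_def sM split: nat.split)
  define r where "r = 2 * K / (e * th k)"
  have r: "0 < r" using th e by (simp add: r_def K_def)
  have "norm (lc n) < e" if n: "\<lceil>r\<^sup>2\<rceil> \<le> \<bar>n\<bar>" for n
  proof -
    have "r\<^sup>2 \<le> \<bar>real_of_int n\<bar>" using n by (simp add: ceiling_le_iff)
    then have "r \<le> sqrt \<bar>real_of_int n\<bar>" by (rule real_le_rsqrt)
    then have "th k * r \<le> th k * sqrt \<bar>real_of_int n\<bar>" using th by (intro mult_left_mono) auto
    also have "\<dots> < exp (th k * sqrt \<bar>real_of_int n\<bar>)" using exp_ge_add_one_self[of "th k * sqrt \<bar>real_of_int n\<bar>"] by linarith
    finally have w: "th k * r < sw (th k) n" by (simp add: sw_def)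
    have "norm (cs k n) * (th k * r) \<le> norm (cs k n) * sw (th k) n" using w by (intro mult_left_mono) auto
    also have "\<dots> \<le> K" unfolding K_def by (rule wbound_term[OF cs_bound])
    finally have "norm (cs k n) * (2 * K / e) \<le> K" using th by (simp add: r_def)
    then have "norm (cs k n) \<le> e / 2" using e by (simp add: K_def field_simps)
    moreover have "norm (lc n) \<le> norm (lc n - cs k n) + norm (cs k n)" using norm_triangle_ineq[of "lc n - cs k n" "cs k n"] by simp
    ultimately show ?thesis using lc_dist[of n k] k' by linarith
  qed
  then show ?thesis by blast
qed


section \<open>The zero sets and the exceptional null set\<close>

definition Z :: "nat \<Rightarrow> real set" where "Z k = {t. h k (real (M k) * (t + sin t / 100)) \<noteq> 0}"

lemma open_Z: "open (Z k)"
  unfolding Z_def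
  by (intro open_Collect_neq continuous_on_const continuous_on_compose2[OF hc]) (auto intro!: continuous_intros)

lemma h_periodic: "h k (t + 2 * pi * of_int m) = h k t"
  using fser_periodic[of "\<psi> k" t m] unfolding \<psi>h of_real_eq_iff by simp

lemma Z_periodic: "t + 2 * pi * of_int m \<in> Z k \<longleftrightarrow> t \<in> Z k"
proof -
  have "cis (t + 2 * pi * of_int m) = cis t"
    using cis_multiple_2pi[of "of_int m"] by (simp add: cis_mult[symmetric])
  then have "sin (t + 2 * pi * of_int m) = sin t" by (simp add: complex_eq_iff)
  then have "real (M k) * (t + 2 * pi * of_int m + sin (t + 2 * pi * of_int m) / 100)
      = real (M k) * (t + sin t / 100) + 2 * pi * of_int (int (M k) * m)" by (simp add: algebra_simps)
  then show ?thesis unfolding Z_def mem_Collect_eq by (simp only: h_periodic)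
qed

lemma fser_cs_zero: "t \<in> Z j \<Longrightarrow> j < k \<Longrightarrow> fser (cs k) t = 0"
proof (induction k)
  case (Suc k)
  have f: "fser (cs (Suc k)) t = fser (cs k) t * fser (\<lambda>n. P k n - R k n) (real (M k) * (t + sin t / 100))"
    unfolding cs.simps by (rule product_bounds(3)[OF cs_bound Q])
  show ?case
  proof (cases "j = k")
    case True
    have "fser (\<lambda>n. P k n - R k n) (real (M k) * (t + sin t / 100)) = 0"
      using Suc.prems(1) True by (simp add: fser_diff[OF P R sw_sigma_ge_1 sw_sigma_ge_1] Z_def PR)
    then show ?thesis by (simp only: f mult_zero_right)
  next
    case False
    then have "fser (cs k) t = 0" using Suc by simp
    then show ?thesis by (simp only: f mult_zero_left)
  qed
qed simp

lemma fser_ds: "fser (ds k) t = of_real (\<Prod>j<k. 1 - h j (real (M j) * (t + sin t / 100)))"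
proof (induction k)
  case (Suc k)
  have "fser (ds (Suc k)) t = fser (ds k) t * fser (\<psi> k) (real (M k) * (t + sin t / 100))"
    unfolding ds.simps by (rule product_bounds(3)[OF ds_bound \<psi>])
  then show ?case by (simp only: Suc \<psi>h prod.lessThan_Suc of_real_mult)
qed (simp add: fser_unitseq)

text \<open>High frequency replaces independence: up to a summable error each factor multiplies the
  mean by the mean of 1 - \<open>h k\<close>, at most 1 - \<open>\<eta> k\<close>, and the
  \<open>\<eta> k\<close> have divergent sum.\<close>

lemma ds_zero_lim: "(\<lambda>k. norm (ds k 0)) \<longlonglongrightarrow> 0"
proof (rule contracting_sequence_tendsto_0[OF _ \<eta>0 \<eta>div])
  fix k
  have "norm (ds (Suc k) 0 - \<psi> k 0 * ds k 0) \<le> 20 * exp (s k / 5 - s k / 3)"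
    unfolding ds.simps by (rule uniform_step[OF ds_bound \<psi>])
  also have "\<dots> \<le> (1 / 2) ^ (k + 2)"
  proof -
    have "0 \<le> exp (s k / 10 - s k)" by simp
    then show ?thesis using E1[of k] small_steps[of k] by linarith
  qed
  finally have a: "norm (ds (Suc k) 0 - \<psi> k 0 * ds k 0) \<le> (1 / 2) ^ (k + 2)" .
  have b: "norm (\<psi> k 0 * ds k 0) \<le> (1 - \<eta> k) * norm (ds k 0)"
    unfolding norm_mult by (intro mult_right_mono \<psi>0) auto
  have "norm (ds (Suc k) 0) \<le> norm (ds (Suc k) 0 - \<psi> k 0 * ds k 0) + norm (\<psi> k 0 * ds k 0)"
    using norm_triangle_ineq[of "ds (Suc k) 0 - \<psi> k 0 * ds k 0" "\<psi> k 0 * ds k 0"] by (simp del: ds.simps)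
  then show "norm (ds (Suc k) 0) \<le> (1 - \<eta> k) * norm (ds k 0) + (1 / 2) ^ (k + 2)" using a b by linarith
qed auto

definition bad :: "real set" where "bad = - (\<Union>k. Z k)"

lemma closed_bad: "closed bad"
  unfolding bad_def by (intro closed_Compl open_UN ballI open_Z)

text \<open>On \<open>bad\<close> all cutoffs vanish, so each majorant is 1 there and nonnegative
  elsewhere; its integral, 2 pi times \<open>ds k 0\<close>, tends to zero.\<close>

lemma emeasure_bad_period: "emeasure lborel (bad \<inter> {-pi..pi}) = 0"
proof -
  let ?A = "bad \<inter> {-pi..pi}"
  have A: "?A \<in> sets borel" using closed_bad by simp
  have fin: "emeasure lborel ?A < \<infinity>"
    by (rule le_less_trans[OF emeasure_mono[of _ "{-pi..pi}"]]) auto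
  have m: "((\<lambda>x. if x \<in> ?A then 1 else 0) has_integral measure lborel ?A) {-pi..pi}"
    by (subst has_integral_restrict) (use has_integral_measure_lborel[OF A fin] in auto)
  have "measure lborel ?A \<le> 2 * pi * norm (ds k 0)" for k
  proof -
    let ?p = "\<lambda>t. \<Prod>j<k. 1 - h j (real (M j) * (t + sin t / 100))"
    have "((\<lambda>t. fser (ds k) t * cis (- of_int 0 * t)) has_integral of_real (2 * pi) * ds k 0) {-pi..pi}"
      by (rule fser_coeff[OF ds_bound sw_th_ge_1])
    then have "((\<lambda>t. complex_of_real (?p t)) has_integral of_real (2 * pi) * ds k 0) {-pi..pi}"
      by (simp add: fser_ds del: of_real_prod)
    from has_integral_linear[OF this bounded_linear_Re]
    have p: "(?p has_integral Re (of_real (2 * pi) * ds k 0)) {-pi..pi}" by (simp add: o_def del: of_real_prod)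
    have "measure lborel ?A \<le> Re (of_real (2 * pi) * ds k 0)"
    proof (rule has_integral_le[OF m p])
      fix t assume "t \<in> {-pi..pi}"
      show "(if t \<in> ?A then 1 else 0) \<le> ?p t"
      proof (cases "t \<in> ?A")
        case True
        then have "h j (real (M j) * (t + sin t / 100)) = 0" for j by (auto simp: bad_def Z_def)
        then show ?thesis by simp
      next
        case False
        have "0 \<le> ?p t" by (rule prod_nonneg) (use h1 in auto)
        then show ?thesis using False by (simp only: if_False)
      qed
    qed
    also have "\<dots> \<le> norm (of_real (2 * pi) * ds k 0)" by (rule complex_Re_le_cmod)
    finally show ?thesis by (simp add: norm_mult)
  qed
  then have "measure lborel ?A \<le> 0"
    using LIMSEQ_le_const[OF tendsto_mult[OF tendsto_const[of "2 * pi"] ds_zero_lim], of "measure lborel ?A"] by simp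
  then have "measure lborel ?A = 0" by (simp add: measure_nonneg order_antisym)
  then show ?thesis using fin by (subst emeasure_eq_ennreal_measure) auto
qed

lemma AE_not_bad: "AE t in lborel. t \<notin> bad"
proof -
  let ?A = "bad \<inter> {-pi..pi}"
  have "?A \<in> null_sets lborel" using closed_bad emeasure_bad_period by (intro null_setsI) auto
  then have nA: "negligible ?A" by (simp add: negligible_iff_null_sets null_sets_completionI)
  have sub: "bad \<subseteq> (\<Union>m::int. (+) (2 * pi * of_int m) ` ?A)"
  proof
    fix t assume t: "t \<in> bad"
    define m where "m = \<lfloor>(t + pi) / (2 * pi)\<rfloor>"
    have "of_int m \<le> (t + pi) / (2 * pi)" "(t + pi) / (2 * pi) < of_int m + 1" unfolding m_def by linarith+
    then have "2 * pi * of_int m \<le> t + pi" "t + pi < 2 * pi * of_int m + 2 * pi" by (simp_all add: field_simps)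
    then have r: "t - 2 * pi * of_int m \<in> {-pi..pi}" by auto
    have "t - 2 * pi * of_int m \<in> bad"
      using t Z_periodic[of "t - 2 * pi * of_int m" m] by (simp add: bad_def)
    then have "t - 2 * pi * of_int m \<in> ?A" using r by blast
    then have "2 * pi * of_int m + (t - 2 * pi * of_int m) \<in> (+) (2 * pi * of_int m) ` ?A" by (rule imageI)
    then show "t \<in> (\<Union>m::int. (+) (2 * pi * of_int m) ` ?A)" by auto
  qed
  have "negligible (\<Union>m::int. (+) (2 * pi * of_int m) ` ?A)"
    by (rule negligible_countable_Union) (use nA in \<open>auto intro: negligible_translation\<close>)
  then have "negligible bad" using sub by (rule negligible_subset)
  then have "bad \<in> null_sets lborel"
    using closed_bad by (simp add: negligible_iff_null_sets null_sets_completion_iff)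
  then show ?thesis by (rule AE_not_in)
qed

text \<open>A bump around t0, supported where all later stages vanish, annihilates these stages
  under convolution, hence also their uniform limit. Modulation by t0 then moves the point to 0,
  where \<open>localization\<close> applies.\<close>

lemma converges_on_Z:
  assumes t0: "t0 \<in> Z j"
  shows "(\<lambda>N. \<Sum>n\<in>{- int N..int N}. lc n * cis (of_int n * t0)) \<longlonglongrightarrow> 0"
proof -
  obtain r0 where r0: "0 < r0" "ball t0 r0 \<subseteq> Z j" using open_Z t0 open_contains_ball by blast
  define r where "r = min r0 1"
  have r: "0 < r" "r \<le> 1" "r \<le> r0" using r0 by (auto simp: r_def)
  define \<tau> where "\<tau> = sqrt r / 14"
  have \<tau>: "0 < \<tau>" "14 * \<tau> \<le> sqrt r" using r by (auto simp: \<tau>_def)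
  obtain a g where a: "wbound (sw \<tau>) (3300 / \<tau> ^ 4) a" and g: "\<And>t. fser a t = complex_of_real (g t)"
    "\<And>t. 0 \<le> g t" "\<And>t. g t \<le> 1" "\<And>t. cos (r / 2) \<le> cos t \<Longrightarrow> g t = 1" "\<And>t. cos t \<le> cos r \<Longrightarrow> g t = 0"
    "continuous_on UNIV g"
    by (rule bump_wbound[OF r(1,2) \<tau>]) (rule that; assumption)
  have w1: "1 \<le> sw \<tau> n" for n by (rule sw_ge_1) (use \<tau> in simp)
  define a' where "a' m = a m * cis (- of_int m * t0)" for m
  have a': "wbound (sw \<tau>) (3300 / \<tau> ^ 4) a'"
    by (rule wbound_le[OF a]) (auto simp: a'_def norm_mult sw_def)
  have fa': "fser a' t = fser a (t - t0)" for t
  proof -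
    have "a' n * cis (of_int n * t) = a n * cis (of_int n * (t - t0))" for n
    proof -
      have "cis (of_int n * (t - t0)) = cis (- of_int n * t0) * cis (of_int n * t)" unfolding cis_mult by (simp add: algebra_simps)
      then show ?thesis by (simp only: a'_def mult.assoc)
    qed
    then show ?thesis by (simp only: fser_def)
  qed
  have z: "conv a' (cs k) n = 0" if k: "j < k" for k n
  proof -
    \<comment> \<open>Bump and stage are bounded in different weights; the smaller rate serves both,
      so the product formula applies.\<close>
    define v where "v = sw (min \<tau> (th k))"
    have sub: "submult v" unfolding v_def using \<tau> th_nonneg by (intro submult_sw) auto
    have 1: "wbound v (3300 / \<tau> ^ 4) a'" unfolding v_def by (rule wbound_mono[OF a' sw_mono order_refl]) auto
    have 2: "wbound v (exp (s k / 10)) (cs k)" unfolding v_def by (rule wbound_mono[OF cs_bound sw_mono order_refl]) auto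
    have v1: "1 \<le> v n" for n using sub by (simp add: submult_def)
    have "fser (conv a' (cs k)) t = fser (\<lambda>_. 0) t" for t
    proof -
      have "fser (conv a' (cs k)) t = fser a (t - t0) * fser (cs k) t" using conv_bounds(2)[OF 1 2 sub] fa' by simp
      also have "\<dots> = 0"
      proof (cases "cos (t - t0) \<le> cos r")
        case True then show ?thesis using g(1,5) by simp
      next
        case False
        then obtain m :: int where m: "\<bar>t - t0 - 2 * pi * of_int m\<bar> < r"
          using cos_gt_imp_near_period[OF r(1,2), of "t - t0"] by auto
        have "t - 2 * pi * of_int m \<in> ball t0 r0" using m r by (auto simp: dist_real_def)
        then have "t - 2 * pi * of_int m \<in> Z j" using r0 by blast
        then have "t \<in> Z j" using Z_periodic[of "t - 2 * pi * of_int m" m] by simp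
        then show ?thesis using fser_cs_zero k by simp
      qed
      finally show ?thesis by (simp add: fser_def)
    qed
    then have "conv a' (cs k) = (\<lambda>_. 0)"
      by (intro fser_unique[OF conv_bounds(1)[OF 1 2 sub] v1, of "\<lambda>_. 1" 0]) (auto simp: wbound_def)
    then show ?thesis by simp
  qed
  have zl: "conv a' lc n = 0" for n
  proof -
    \<comment> \<open>Convolution with a summable sequence preserves, up to its norm, the uniform
      distance between a stage and the limit.\<close>
    have d: "norm (conv a' lc n) \<le> 3300 / \<tau> ^ 4 * (1 / 2) ^ (k + 1)" if k: "j < k" for k
    proof -
      have "conv a' (\<lambda>n. (lc n - cs k n) + cs k n) n = conv a' (\<lambda>n. lc n - cs k n) n + conv a' (cs k) n"
        by (rule conv_add_right[OF a' w1 lc_dist cs_term])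
      then have "conv a' lc n = conv a' (\<lambda>n. lc n - cs k n) n" using z[OF k] by simp
      then show ?thesis by (simp only:) (rule norm_conv_le[OF a' w1 lc_dist])
    qed
    have "(\<lambda>k. (1 / 2 :: real) ^ (k + 1)) \<longlonglongrightarrow> 0"
      by (rule LIMSEQ_ignore_initial_segment) (rule LIMSEQ_power_zero, simp)
    then have "(\<lambda>k. 3300 / \<tau> ^ 4 * (1 / 2 :: real) ^ (k + 1)) \<longlonglongrightarrow> 3300 / \<tau> ^ 4 * 0"
      by (rule tendsto_mult[OF tendsto_const])
    then have "norm (conv a' lc n) \<le> 3300 / \<tau> ^ 4 * 0"
      by (rule LIMSEQ_le_const) (use d in \<open>auto intro!: exI[of _ "Suc j"]\<close>)
    then show ?thesis by simp
  qed
  have conv0: "conv a (\<lambda>n. lc n * cis (of_int n * t0)) n = 0" for n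
  proof -
    have "conv a (\<lambda>n. lc n * cis (of_int n * t0)) n = (\<Sum>\<^sub>\<infinity>m. cis (of_int n * t0) * (a' m * lc (n - m)))"
      unfolding conv_def
    proof (rule infsum_cong)
      fix m
      have "cis (of_int (n - m) * t0) = cis (of_int n * t0) * cis (- of_int m * t0)" unfolding cis_mult by (simp add: algebra_simps)
      then show "a m * (lc (n - m) * cis (of_int (n - m) * t0)) = cis (of_int n * t0) * (a' m * lc (n - m))"
        by (simp only: a'_def mult_ac)
    qed
    also have "\<dots> = cis (of_int n * t0) * conv a' lc n" unfolding conv_def by (rule infsum_cmult_right')
    finally show ?thesis by (simp add: zl)
  qed
  \<comment> \<open>The root weight dominates the linear one through y^2 / 2 <= exp y with y =
    \<tau> sqrt |m|.\<close>
  have wl: "wbound (\<lambda>m. 1 + \<bar>real_of_int m\<bar>) ((1 + 2 / \<tau>\<^sup>2) * (3300 / \<tau> ^ 4)) a"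
  proof (rule wbound_scale[OF a])
    fix m :: int
    define y where "y = \<tau> * sqrt \<bar>real_of_int m\<bar>"
    have y: "0 \<le> y" using \<tau> by (simp add: y_def)
    have "y\<^sup>2 / 2 \<le> exp y" using exp_lower_Taylor_quadratic[OF y] y by linarith
    moreover have "y\<^sup>2 = \<tau>\<^sup>2 * \<bar>real_of_int m\<bar>" by (simp add: y_def power_mult_distrib)
    ultimately have "\<bar>real_of_int m\<bar> \<le> 2 / \<tau>\<^sup>2 * exp y" using \<tau> by (simp add: field_simps)
    moreover have "1 \<le> exp y" using y by simp
    ultimately show "1 + \<bar>real_of_int m\<bar> \<le> (1 + 2 / \<tau>\<^sup>2) * sw \<tau> m"
      unfolding sw_def y_def[symmetric] ring_distribs mult_1_left by linarith
  qed simp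
  have a1: "(\<Sum>\<^sub>\<infinity>m. a m) = 1"
  proof -
    have "(\<Sum>\<^sub>\<infinity>m. a m) = fser a 0" by (simp add: fser_def)
    also have "\<dots> = 1" using g(1)[of 0] g(4)[of 0] by simp
    finally show ?thesis .
  qed
  show ?thesis
  proof (rule localization[OF _ _ wl a1 conv0])
    show "\<exists>N. \<forall>n. N \<le> \<bar>n\<bar> \<longrightarrow> norm (lc n * cis (of_int n * t0)) < e" if "0 < e" for e
      using lc_tendsto_0[OF that] by (simp add: norm_mult)
    show "norm (lc n * cis (of_int n * t0)) \<le> 2" for n using lc_bounded by (simp add: norm_mult)
  qed
qed

lemma AE_converges: "AE t in lborel. (\<lambda>N. \<Sum>n\<in>{- int N..int N}. lc n * cis (of_int n * t)) \<longlonglongrightarrow> 0"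
  using AE_not_bad by eventually_elim (auto simp: bad_def intro: converges_on_Z)

end

section \<open>The weight function\<close>

text \<open>After a strict decrease from a to b the secant, and by concavity the function, would
  become negative further right; \<open>x\<close> is one unit beyond the zero of the secant.\<close>

lemma concave_positive_imp_mono:
  fixes g :: "real \<Rightarrow> real"
  assumes conc: "concave_on {0<..} g" and pos: "\<And>t. 0 < t \<Longrightarrow> 0 < g t" and ab: "0 < a" "a \<le> b"
  shows "g a \<le> g b"
proof (rule ccontr)
  assume "\<not> g a \<le> g b"
  then have lt: "g b < g a" by simp
  then have ab': "a < b" using ab by (cases "a = b") auto
  define x where "x = (b * g a - a * g b) / (g a - g b) + 1"
  have "b * (g a - g b) < b * g a - a * g b" using ab' pos[of b] ab by (simp add: algebra_simps)
  then have "b < (b * g a - a * g b) / (g a - g b)" using lt by (simp add: pos_less_divide_eq)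
  then have xb: "b < x" by (simp add: x_def)
  define u where "u = (x - b) / (x - a)"
  define v where "v = (b - a) / (x - a)"
  have uv: "0 \<le> u" "0 \<le> v" "u + v = 1" using xb ab' by (auto simp: u_def v_def add_divide_distrib[symmetric])
  have "u * a + v * x = ((x - b) * a + (b - a) * x) / (x - a)" by (simp add: u_def v_def add_divide_distrib)
  also have "(x - b) * a + (b - a) * x = b * (x - a)" by (simp add: algebra_simps)
  finally have e: "u * a + v * x = b" using xb ab' by simp
  have "u * g a + v * g x \<le> g b"
    using conc uv ab xb e unfolding concave_on_iff by (metis ab' greaterThan_iff less_trans real_scaleR_def)
  moreover have "0 \<le> v * g x" using uv pos[of x] ab ab' xb by simp
  ultimately have "u * g a \<le> g b" by linarith
  then have "(x - b) * g a \<le> g b * (x - a)" using xb ab' by (simp add: u_def pos_divide_le_eq)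
  moreover have "(x - 1) * (g a - g b) = b * g a - a * g b" using lt by (simp add: x_def)
  ultimately show False using lt by (simp add: algebra_simps)
qed

text \<open>The point 1 is a convex combination of t and 1 / 2, a base point inside the open
  half-line. Discarding the positive value at 1 / 2 leaves a bound on g t.\<close>

lemma concave_positive_linear_bound:
  fixes g :: "real \<Rightarrow> real"
  assumes conc: "concave_on {0<..} g" and pos: "\<And>t. 0 < t \<Longrightarrow> 0 < g t" and t: "1 \<le> t"
  shows "g t \<le> 2 * g 1 * t"
proof -
  define u where "u = (t - 1) / (t - 1 / 2)"
  define v where "v = (1 / 2) / (t - 1 / 2)"
  have "u + v = (t - 1 + 1 / 2) / (t - 1 / 2)" unfolding u_def v_def by (simp only: add_divide_distrib)
  also have "t - 1 + 1 / 2 = t - 1 / 2" by simp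
  finally have uv: "0 \<le> u" "0 \<le> v" "u + v = 1" using t by (auto simp: u_def v_def)
  have "u * (1 / 2) + v * t = ((t - 1) * (1 / 2) + 1 / 2 * t) / (t - 1 / 2)" by (simp add: u_def v_def add_divide_distrib)
  also have "(t - 1) * (1 / 2) + 1 / 2 * t = t - 1 / 2" by (simp add: field_simps)
  finally have e: "u * (1 / 2) + v * t = 1" using t by simp
  have "u * g (1 / 2) + v * g t \<le> g (u * (1 / 2) + v * t)"
  proof -
    have "\<forall>x\<in>{0<..}. \<forall>y\<in>{0<..}. \<forall>u\<ge>0. \<forall>v\<ge>0. u + v = 1 \<longrightarrow> u * g x + v * g y \<le> g (u * x + v * y)"
      using conc unfolding concave_on_iff by simp
    from this[rule_format, of "1 / 2" t u v] show ?thesis using uv t by simp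
  qed
  then have "u * g (1 / 2) + v * g t \<le> g 1" by (simp only: e)
  moreover have "0 \<le> u * g (1 / 2)" using uv pos[of "1 / 2"] by simp
  ultimately have "v * g t \<le> g 1" by linarith
  then have "g t \<le> 2 * g 1 * (t - 1 / 2)" using t by (simp add: v_def field_simps)
  also have "\<dots> \<le> 2 * g 1 * t" using pos[of 1] by (intro mult_left_mono) auto
  finally show ?thesis .
qed

lemma card_nat_interval_le:
  fixes x y :: real
  assumes "0 \<le> x" "x \<le> y"
  shows "finite {n::nat. x \<le> n \<and> n < y}" "real (card {n::nat. x \<le> n \<and> n < y}) \<le> y - x + 1"
proof -
  have sub: "{n::nat. x \<le> n \<and> n < y} \<subseteq> {nat \<lceil>x\<rceil>..<nat \<lceil>y\<rceil>}"
  proof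
    fix n assume "n \<in> {n::nat. x \<le> n \<and> n < y}"
    then have "x \<le> real n" "real n < y" by auto
    then show "n \<in> {nat \<lceil>x\<rceil>..<nat \<lceil>y\<rceil>}" by (simp add: nat_le_iff ceiling_le_iff less_ceiling_iff zless_nat_eq_int_zless)
  qed
  then show "finite {n::nat. x \<le> n \<and> n < y}" by (rule finite_subset) simp
  have "card {n::nat. x \<le> n \<and> n < y} \<le> card {nat \<lceil>x\<rceil>..<nat \<lceil>y\<rceil>}" by (rule card_mono[OF _ sub]) simp
  also have "\<dots> = nat \<lceil>y\<rceil> - nat \<lceil>x\<rceil>" by simp
  finally have "real (card {n::nat. x \<le> n \<and> n < y}) \<le> real (nat \<lceil>y\<rceil> - nat \<lceil>x\<rceil>)" by (simp only: of_nat_le_iff)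
  also have "\<dots> = real_of_int \<lceil>y\<rceil> - real_of_int \<lceil>x\<rceil>"
  proof -
    have "nat \<lceil>x\<rceil> \<le> nat \<lceil>y\<rceil>" using assms by (intro nat_mono ceiling_mono)
    then have "real (nat \<lceil>y\<rceil> - nat \<lceil>x\<rceil>) = real (nat \<lceil>y\<rceil>) - real (nat \<lceil>x\<rceil>)" by (rule of_nat_diff)
    moreover have "0 \<le> \<lceil>x\<rceil>" "0 \<le> \<lceil>y\<rceil>" using assms by linarith+
    ultimately show ?thesis by simp
  qed
  also have "\<dots> \<le> y - x + 1" using ceiling_correct[of x] ceiling_correct[of y] by linarith
  finally show "real (card {n::nat. x \<le> n \<and> n < y}) \<le> y - x + 1" .
qed

text \<open>Cauchy condensation with ratio 32: at most 128 s k integers lie from 4 s k up to the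
  next such bound, and each of their terms is at most 1 / \<omega> (4 s k).\<close>

lemma condensed_divergence:
  fixes \<omega> :: "real \<Rightarrow> real" and s :: "nat \<Rightarrow> real"
  assumes pos: "\<And>t. 0 < t \<Longrightarrow> 0 < \<omega> t" and mono: "\<And>a b. 0 < a \<Longrightarrow> a \<le> b \<Longrightarrow> \<omega> a \<le> \<omega> b"
    and div: "\<not> summable (\<lambda>n. 1 / \<omega> (real (Suc n)))"
    and s: "\<And>k. 20 * (real k + 2) \<le> s k" and sS: "\<And>k. s (Suc k) = 32 * s k"
  shows "\<not> summable (\<lambda>k. s k / \<omega> (4 * s k))"
proof
  assume sm: "summable (\<lambda>k. s k / \<omega> (4 * s k))"
  have s0: "1 \<le> s k" for k using s[of k] by (smt (verit) of_nat_0_le_iff)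
  have nn: "0 \<le> s k / \<omega> (4 * s k)" for k using s0[of k] pos[of "4 * s k"] by simp
  define S where "S K = {n::nat. 4 * s 0 \<le> n \<and> n < 4 * s K}" for K
  have bd: "finite (S K) \<and> (\<Sum>n\<in>S K. 1 / \<omega> n) \<le> (\<Sum>k<K. 128 * (s k / \<omega> (4 * s k)))" for K
  proof (induction K)
    case (Suc K)
    let ?T = "{n::nat. 4 * s K \<le> n \<and> n < 4 * s (Suc K)}"
    have T: "finite ?T" "real (card ?T) \<le> 4 * s (Suc K) - 4 * s K + 1"
      using card_nat_interval_le[of "4 * s K" "4 * s (Suc K)"] s0[of K] sS[of K] by auto
    have sub: "S (Suc K) \<subseteq> S K \<union> ?T" by (auto simp: S_def)
    have "(\<Sum>n\<in>S (Suc K). 1 / \<omega> n) \<le> (\<Sum>n\<in>S K \<union> ?T. 1 / \<omega> n)"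
    proof (rule sum_mono2)
      fix n assume "n \<in> S K \<union> ?T - S (Suc K)"
      then have "0 < real n" using s0[of 0] s0[of K] by (auto simp: S_def)
      then show "0 \<le> 1 / \<omega> n" using pos[of n] by simp
    qed (use Suc T sub in auto)
    also have "\<dots> \<le> (\<Sum>n\<in>S K. 1 / \<omega> n) + (\<Sum>n\<in>?T. 1 / \<omega> n)"
    proof -
      have "0 \<le> (\<Sum>n\<in>S K \<inter> ?T. 1 / \<omega> n)"
      proof (rule sum_nonneg)
        fix n assume "n \<in> S K \<inter> ?T"
        then have "0 < real n" using s0[of K] by auto
        then show "0 \<le> 1 / \<omega> n" using pos[of n] by simp
      qed
      then show ?thesis using sum.union_inter[of "S K" ?T "\<lambda>n. 1 / \<omega> n"] Suc T by simp
    qed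
    also have "(\<Sum>n\<in>?T. 1 / \<omega> n) \<le> (\<Sum>n\<in>?T. 1 / \<omega> (4 * s K))"
    proof (rule sum_mono)
      fix n assume "n \<in> ?T"
      then have "\<omega> (4 * s K) \<le> \<omega> n" using s0[of K] by (intro mono) auto
      then show "1 / \<omega> n \<le> 1 / \<omega> (4 * s K)" using pos[of "4 * s K"] s0[of K] by (intro divide_left_mono) auto
    qed
    also have "\<dots> = real (card ?T) * (1 / \<omega> (4 * s K))" by simp
    also have "\<dots> \<le> (128 * s K) * (1 / \<omega> (4 * s K))"
      using T(2) sS[of K] s0[of K] pos[of "4 * s K"] by (intro mult_right_mono) auto
    finally show ?case using Suc T sub by (auto intro: finite_subset)
  next
    case 0
    have "S 0 = {}" by (auto simp: S_def)
    then show ?case by simp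
  qed
  define n0 where "n0 = nat \<lceil>4 * s 0\<rceil>"
  have n0: "4 * s 0 \<le> n0" unfolding n0_def by linarith
  define f where "f n = 1 / \<omega> (real n)" for n :: nat
  have "summable (\<lambda>n. f (n + n0))"
  proof (rule summableI_nonneg_bounded)
    fix n show "0 \<le> f (n + n0)" using pos[of "real (n + n0)"] n0 s0[of 0] by (simp add: f_def)
  next
    fix N
    obtain K where K: "real (n0 + N) < real K" using reals_Archimedean2 by blast
    moreover have "real K \<le> 4 * s K" using s[of K] by (simp add: ring_distribs)
    ultimately have K': "real (n0 + N) < 4 * s K" by (rule less_le_trans)
    have "(\<Sum>n<N. f (n + n0)) = (\<Sum>n\<in>(\<lambda>n. n + n0) ` {..<N}. f n)" by (subst sum.reindex) (auto simp: inj_on_def)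
    also have "\<dots> \<le> (\<Sum>n\<in>S K. f n)"
    proof (rule sum_mono2)
      show "finite (S K)" using bd by blast
      show "(\<lambda>n. n + n0) ` {..<N} \<subseteq> S K" using n0 K' by (auto simp: S_def)
      fix n assume "n \<in> S K - (\<lambda>n. n + n0) ` {..<N}"
      then have "0 < real n" using s0[of 0] by (auto simp: S_def)
      then show "0 \<le> f n" using pos[of n] by (simp add: f_def)
    qed
    also have "\<dots> \<le> (\<Sum>k<K. 128 * (s k / \<omega> (4 * s k)))" using bd[of K] by (simp add: f_def)
    also have "\<dots> \<le> (\<Sum>k. 128 * (s k / \<omega> (4 * s k)))"
      by (rule sum_le_suminf[OF summable_mult[OF sm]]) (auto intro!: mult_nonneg_nonneg nn simp del: times_divide_eq_right)
    finally show "(\<Sum>n<N. f (n + n0)) \<le> (\<Sum>k. 128 * (s k / \<omega> (4 * s k)))" .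
  qed
  then have "summable f" by (simp only: summable_iff_shift)
  then have "summable (\<lambda>n. f (Suc n))" by (simp only: summable_Suc_iff)
  then show False using div by (simp add: f_def)
qed

section \<open>Choice of the parameters\<close>

lemma eventually_parameter_bounds:
  fixes E A B :: real
  assumes "0 < E" "0 < A" "0 < B"
  shows "\<exists>S. \<forall>s\<ge>S. exp (s / 100) * (1 + 3300 * E\<^sup>2 * s\<^sup>2)\<^sup>2 \<le> exp (s / 10) \<and>
      2 * (1 + 8 * (E * s)) * exp (s / 10) \<le> exp s \<and> 16 * (E * s) \<le> exp s \<and>
      20 * exp (s / 5 - s / 3) + exp (s / 10 - s) \<le> exp (- s / 20) \<and>
      s / 10 + B * s\<^sup>2 \<le> exp s \<and> 2 * s + B * s\<^sup>2 \<le> exp (15 / 32 * s) / 2 \<and> s + A * s\<^sup>2 \<le> exp (s / 4)" (is "\<exists>S. \<forall>s\<ge>S. ?P s")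
proof -
  have "\<forall>\<^sub>F s in at_top. exp (s / 100) * (1 + 3300 * E\<^sup>2 * s\<^sup>2)\<^sup>2 \<le> exp (s / 10)"
    using assms by real_asymp
  moreover have "\<forall>\<^sub>F s in at_top. 2 * (1 + 8 * (E * s)) * exp (s / 10) \<le> exp s" using assms by real_asymp
  moreover have "\<forall>\<^sub>F s in at_top. 16 * (E * s) \<le> exp s" using assms by real_asymp
  moreover have "\<forall>\<^sub>F s::real in at_top. 20 * exp (s / 5 - s / 3) + exp (s / 10 - s) \<le> exp (- s / 20)" by real_asymp
  moreover have "\<forall>\<^sub>F s in at_top. s / 10 + B * s\<^sup>2 \<le> exp s" using assms by real_asymp
  moreover have "\<forall>\<^sub>F s in at_top. 2 * s + B * s\<^sup>2 \<le> exp (15 / 32 * s) / 2" using assms by real_asymp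
  moreover have "\<forall>\<^sub>F s in at_top. s + A * s\<^sup>2 \<le> exp (s / 4)" using assms by real_asymp
  ultimately have "\<forall>\<^sub>F s in at_top. ?P s"
    by eventually_elim blast
  then show ?thesis unfolding eventually_at_top_linorder .
qed

text \<open>A predicate on tuples, so that one use of \<open>choice\<close> selects all
  blocks.\<close>

definition block_spec :: "real \<Rightarrow> real \<Rightarrow> real \<Rightarrow> real \<Rightarrow>
    (int \<Rightarrow> complex) \<times> (int \<Rightarrow> complex) \<times> (int \<Rightarrow> complex) \<times> (real \<Rightarrow> real) \<Rightarrow> bool" where
  "block_spec s W d \<sigma> = (\<lambda>(P, R, \<psi>, h). wbound (sw \<sigma>) (exp (s / 10)) P \<and> P 0 = 1 \<and> (\<forall>n<0. P n = 0) \<and>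
      wbound (sw \<sigma>) (exp (s / 10)) R \<and> (\<forall>t. norm (fser R t) \<le> exp (- W)) \<and>
      wbound (sw \<sigma>) (exp (s / 10)) (\<lambda>n. P n - R n) \<and>
      wbound (sw \<sigma>) (exp (s / 10)) \<psi> \<and> (\<forall>t. fser \<psi> t = complex_of_real (1 - h t)) \<and>
      (\<forall>t. 0 \<le> h t) \<and> (\<forall>t. h t \<le> 1) \<and> continuous_on UNIV h \<and>
      norm (\<psi> 0) \<le> 1 - d / (8 * pi) \<and> (\<forall>t. h t \<noteq> 0 \<longrightarrow> fser P t = fser R t))"

text \<open>Since W = O(s^2), the arc width gives 1 / \<sigma>^2 = O(s) and H = O(s^2); these
  factors fit into the gap between exp (s / 100) and exp (s / 10). The constant 156800 is 784 * 200,
  from \<sigma>^2 = d / 784 and the definition of d.\<close>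

lemma building_block_bounded:
  assumes s: "1 \<le> s" and W: "s \<le> W" "W \<le> B * s\<^sup>2" and E: "E = 156800 * (B + 1)"
    and d: "d = s / 100 / (2 * (W + s / 100))" and \<sigma>: "\<sigma> = sqrt d / 28"
    and a: "exp (s / 100) * (1 + 3300 * E\<^sup>2 * s\<^sup>2)\<^sup>2 \<le> exp (s / 10)"
  shows "1 / \<sigma>\<^sup>2 \<le> E * s" "0 < \<sigma>"
    "\<exists>q. block_spec s W d \<sigma> q"
proof -
  define H where "H = 3300 / \<sigma> ^ 4"
  have d0: "0 < d" using s W by (simp add: d)
  show \<sigma>0: "0 < \<sigma>" using d0 by (simp add: \<sigma>)
  have sd: "\<sigma>\<^sup>2 = d / 784" using d0 by (simp add: \<sigma> power_divide)
  show D: "1 / \<sigma>\<^sup>2 \<le> E * s"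
  proof -
    have "1 / \<sigma>\<^sup>2 = 156800 * (W + s / 100) / s" using s W by (simp add: sd d field_simps)
    also have "\<dots> \<le> 156800 * ((B + 1) * s\<^sup>2) / s"
    proof -
      have "s / 100 \<le> s\<^sup>2" using s self_le_power[of s 2] by simp
      then have "W + s / 100 \<le> (B + 1) * s\<^sup>2" using W by (simp add: ring_distribs)
      then show ?thesis using s by (intro divide_right_mono mult_left_mono) auto
    qed
    also have "\<dots> = E * s" using s by (simp add: E power2_eq_square)
    finally show ?thesis .
  qed
  have H0: "0 \<le> H" using \<sigma>0 by (simp add: H_def)
  have HE: "H \<le> 3300 * E\<^sup>2 * s\<^sup>2"
  proof -
    have "H = 3300 * (1 / \<sigma>\<^sup>2)\<^sup>2" by (simp add: H_def power_divide flip: power_mult)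
    also have "\<dots> \<le> 3300 * (E * s)\<^sup>2" using D by (intro mult_left_mono power_mono) auto
    finally show ?thesis by (simp add: power_mult_distrib mult.assoc)
  qed
  have G: "exp (s / 100) * (1 + H)\<^sup>2 \<le> exp (s / 10)"
  proof -
    have "(1 + H)\<^sup>2 \<le> (1 + 3300 * E\<^sup>2 * s\<^sup>2)\<^sup>2" using HE H0 by (intro power_mono) auto
    then have "exp (s / 100) * (1 + H)\<^sup>2 \<le> exp (s / 100) * (1 + 3300 * E\<^sup>2 * s\<^sup>2)\<^sup>2" by (intro mult_left_mono) auto
    then show ?thesis using a by linarith
  qed
  have e1: "1 \<le> exp (s / 100)" using s by simp
  have b1: "exp (s / 100) * H \<le> exp (s / 10)"
    by (rule order_trans[OF mult_left_mono G]) (use H0 in \<open>auto simp: power2_eq_square algebra_simps\<close>)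
  have b2: "exp (s / 100) * H * H \<le> exp (s / 10)" unfolding mult.assoc
    by (rule order_trans[OF mult_left_mono G]) (use H0 in \<open>auto simp: power2_eq_square algebra_simps\<close>)
  have b3: "exp (s / 100) * H + exp (s / 100) * H * H \<le> exp (s / 10)"
    unfolding mult.assoc distrib_left[symmetric]
    by (rule order_trans[OF mult_left_mono G]) (use H0 in \<open>auto simp: power2_eq_square algebra_simps\<close>)
  have b4: "1 + H \<le> exp (s / 10)"
  proof -
    have "1 + H \<le> (1 + H)\<^sup>2" using H0 by (intro self_le_power) auto
    also have "\<dots> \<le> exp (s / 100) * (1 + H)\<^sup>2" using mult_right_mono[OF e1, of "(1 + H)\<^sup>2"] by simp
    finally show ?thesis using G by linarith
  qed
  obtain P R \<psi> h where q: "wbound (sw \<sigma>) (exp (s / 100) * H) P" "P 0 = 1" "\<And>n. n < 0 \<Longrightarrow> P n = 0"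
    "wbound (sw \<sigma>) (exp (s / 100) * H * H) R" "\<And>t. norm (fser R t) \<le> exp (- W)"
    "wbound (sw \<sigma>) (1 + H) \<psi>" "\<And>t. fser \<psi> t = complex_of_real (1 - h t)"
    "\<And>t. 0 \<le> h t" "\<And>t. h t \<le> 1" "continuous_on UNIV h"
    "norm (\<psi> 0) \<le> 1 - d / (8 * pi)" "\<And>t. h t \<noteq> 0 \<Longrightarrow> fser P t = fser R t"
    by (rule building_block[OF _ _ d \<sigma> H_def]) (use s W in auto)
  have sw0: "0 \<le> sw \<sigma> n" for n by (simp add: sw_def)
  have PR: "wbound (sw \<sigma>) (exp (s / 10)) (\<lambda>n. P n - R n)"
    using wbound_mono[OF wbound_add[OF q(1) wbound_uminus[OF q(4)] sw0] order_refl b3] by simp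
  show "\<exists>q. block_spec s W d \<sigma> q"
    unfolding block_spec_def split_paired_Ex prod.case
    using q(2,3,5,7-12) PR wbound_mono[OF q(1) order_refl b1] wbound_mono[OF q(4) order_refl b2] wbound_mono[OF q(6) order_refl b4]
    by (intro exI[of _ P] exI[of _ R] exI[of _ \<psi>] exI[of _ h] conjI allI impI)
qed

section \<open>Assembly and decay at negative indices\<close>

theorem theorem3:
  fixes \<omega> :: "real \<Rightarrow> real"
  assumes pos: "\<forall>t>0. \<omega> t > 0"
    and conc: "concave_on {0<..} (\<lambda>t. \<omega> t / t)"
    and div: "\<not> summable (\<lambda>n::nat. 1 / \<omega> (real (Suc n)))"
  shows "\<exists>c :: int \<Rightarrow> complex.
           (\<exists>n. c n \<noteq> 0) \<and>
           (AE t in lborel.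
              (\<lambda>N::nat. \<Sum>n\<in>{- int N..int N}. c n * exp (\<i> * of_int n * of_real t))
                \<longlonglongrightarrow> 0) \<and>
           (\<exists>C M. \<forall>n::int. n < - M \<longrightarrow>
                 norm (c n) \<le> C * exp (- \<omega> (ln (real_of_int (- n)))))"
proof -
  have pos': "0 < \<omega> t" if "0 < t" for t using pos that by blast
  have gpos: "0 < \<omega> t / t" if "0 < t" for t using pos'[OF that] that by simp
  have g_mono: "\<omega> a / a \<le> \<omega> b / b" if "0 < a" "a \<le> b" for a b
    using concave_positive_imp_mono[OF conc gpos that] by simp
  have mono: "\<omega> a \<le> \<omega> b" if ab: "0 < a" "a \<le> b" for a b
  proof -
    have "\<omega> a = a * (\<omega> a / a)" using ab by simp
    also have "\<dots> \<le> b * (\<omega> b / b)" using ab g_mono[OF ab] gpos[OF ab(1)] by (intro mult_mono) auto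
    finally show ?thesis using ab by simp
  qed
  define A where "A = 2 * \<omega> 1"
  have A: "0 < A" using pos'[of 1] by (simp add: A_def)
  have ub: "\<omega> t \<le> A * t\<^sup>2" if t: "1 \<le> t" for t
    using concave_positive_linear_bound[OF conc gpos t] t by (simp add: A_def power2_eq_square divide_le_eq mult_ac)
  have lb: "\<omega> 1 * t \<le> \<omega> t" if t: "1 \<le> t" for t
    using g_mono[of 1 t] t by (simp add: le_divide_eq)
  \<comment> \<open>Covers W = \<omega> (4 s) + s, by \<omega> (4 s) <= 16 A s^2 and s <=
    s^2.\<close>
  define B where "B = 16 * A + 1"
  define E where "E = 156800 * (B + 1)"
  have B: "0 < B" and E: "0 < E" using A by (auto simp: B_def E_def)
  obtain S where S: "\<And>s. S \<le> s \<Longrightarrow> exp (s / 100) * (1 + 3300 * E\<^sup>2 * s\<^sup>2)\<^sup>2 \<le> exp (s / 10)"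
    "\<And>s. S \<le> s \<Longrightarrow> 2 * (1 + 8 * (E * s)) * exp (s / 10) \<le> exp s" "\<And>s. S \<le> s \<Longrightarrow> 16 * (E * s) \<le> exp s"
    "\<And>s. S \<le> s \<Longrightarrow> 20 * exp (s / 5 - s / 3) + exp (s / 10 - s) \<le> exp (- s / 20)"
    "\<And>s. S \<le> s \<Longrightarrow> s / 10 + B * s\<^sup>2 \<le> exp s" "\<And>s. S \<le> s \<Longrightarrow> 2 * s + B * s\<^sup>2 \<le> exp (15 / 32 * s) / 2"
    "\<And>s. S \<le> s \<Longrightarrow> s + A * s\<^sup>2 \<le> exp (s / 4)"
    using eventually_parameter_bounds[OF E A B] by auto
  \<comment> \<open>The threshold 40 gives 20 (k + 2) <= s k at k = 0; geometric growth gives it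
    afterwards.\<close>
  define M0 where "M0 = nat \<lceil>exp (max S 40)\<rceil>"
  have M0: "exp (max S 40) \<le> real M0" unfolding M0_def by linarith
  have M0p: "0 < real M0" using M0 by (smt (verit) exp_gt_zero)
  have lnM0: "max S 40 \<le> ln (real M0)" unfolding ln_ge_iff[OF M0p] by (rule M0)
  define s where "s k = 32 ^ k * ln (real M0)" for k :: nat
  define M where "M k = M0 ^ (32 ^ k)" for k :: nat
  have p32: "1 + real k \<le> 32 ^ k" for k :: nat
  proof (induction k)
    case (Suc k) then show ?case by simp
  qed simp
  have sM: "real (M k) = exp (s k)" for k
  proof -
    have "exp (s k) = exp (real (32 ^ k) * ln (real M0))" by (simp add: s_def)
    also have "\<dots> = exp (ln (real M0)) ^ (32 ^ k)" by (rule exp_of_nat_mult)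
    finally show ?thesis using M0p by (simp add: M_def)
  qed
  have M1: "1 \<le> M k" for k using M0p by (simp add: M_def)
  have sS: "s (Suc k) = 32 * s k" for k by (simp add: s_def)
  have sk: "20 * (real k + 2) \<le> s k" for k
  proof -
    have "(1 + real k) * 40 \<le> 32 ^ k * ln (real M0)" using p32[of k] lnM0 by (intro mult_mono) auto
    then show ?thesis by (simp add: s_def)
  qed
  have s1: "1 \<le> s k" for k using sk[of k] by (simp add: ring_distribs)
  have sS0: "S \<le> s k" for k
  proof -
    have "S \<le> 1 * ln (real M0)" using lnM0 by simp
    also have "\<dots> \<le> 32 ^ k * ln (real M0)" using lnM0 by (intro mult_right_mono) auto
    finally show ?thesis by (simp only: s_def)
  qed
  \<comment> \<open>Step k has to serve all indices with ln |n| < 4 s k, hence the argument of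
    \<omega>; the added s k makes the errors summable over k.\<close>
  define W where "W k = \<omega> (4 * s k) + s k" for k
  have Ws: "s k \<le> W k" for k using pos'[of "4 * s k"] s1[of k] by (simp add: W_def)
  have WB: "W k \<le> B * (s k)\<^sup>2" for k
  proof -
    have "\<omega> (4 * s k) \<le> A * (4 * s k)\<^sup>2" using s1[of k] by (intro ub) simp
    moreover have "s k \<le> (s k)\<^sup>2" using s1[of k] by (intro self_le_power) auto
    ultimately show ?thesis by (simp add: W_def B_def power_mult_distrib ring_distribs)
  qed
  define d where "d k = s k / 100 / (2 * (W k + s k / 100))" for k
  define \<sigma> where "\<sigma> k = sqrt (d k) / 28" for k
  define \<eta> where "\<eta> k = d k / (8 * pi)" for k
  note block = building_block_bounded[OF s1 Ws WB E_def d_def \<sigma>_def S(1)[OF sS0]]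
  obtain q where q: "\<And>k. block_spec (s k) (W k) (d k) (\<sigma> k) (q k)"
    using choice[of "\<lambda>k. block_spec (s k) (W k) (d k) (\<sigma> k)"] block(3) by auto
  define P where "P k = fst (q k)" for k
  define R where "R k = fst (snd (q k))" for k
  define \<psi> where "\<psi> k = fst (snd (snd (q k)))" for k
  define h where "h k = snd (snd (snd (q k)))" for k
  note qk = q[unfolded block_spec_def case_prod_beta, folded P_def R_def \<psi>_def h_def]
  have \<eta>0: "0 \<le> \<eta> k" for k using s1[of k] Ws[of k] by (simp add: \<eta>_def d_def)
  have \<eta>div: "\<not> summable \<eta>"
  proof
    assume "summable \<eta>"
    \<comment> \<open>The added s k does not spoil divergence: \<omega> (4 s) >= 4 \<omega> 1 * s,
      so W + s / 100 is at most a constant times \<omega> (4 s).\<close>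
    define C where "C = 1600 * pi * (1 + 1 / \<omega> 1)"
    have "summable (\<lambda>k. C * \<eta> k)" using \<open>summable \<eta>\<close> by (rule summable_mult)
    then have "summable (\<lambda>k. s k / \<omega> (4 * s k))"
    proof (rule summable_comparison_test'[where N=0])
      fix k
      have w0: "0 < \<omega> (4 * s k)" using s1[of k] by (intro pos') simp
      have o1: "0 < \<omega> 1" by (intro pos') simp
      have "\<omega> 1 * (4 * s k) \<le> \<omega> (4 * s k)" using s1[of k] by (intro lb) simp
      then have "4 * s k \<le> \<omega> (4 * s k) / \<omega> 1" using o1 by (simp add: le_divide_eq mult.commute)
      moreover have "(1 + 1 / \<omega> 1) * \<omega> (4 * s k) = \<omega> (4 * s k) + \<omega> (4 * s k) / \<omega> 1" by (simp add: ring_distribs)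
      ultimately have "W k + s k / 100 \<le> (1 + 1 / \<omega> 1) * \<omega> (4 * s k)" unfolding W_def using s1[of k] by linarith
      then have "s k / ((1 + 1 / \<omega> 1) * \<omega> (4 * s k)) \<le> s k / (W k + s k / 100)"
        using s1[of k] Ws[of k] w0 o1 by (intro divide_left_mono mult_pos_pos add_pos_pos) auto
      also have "\<dots> = 1600 * pi * \<eta> k"
      proof -
        define V where "V = W k + s k / 100"
        have "V \<noteq> 0" using s1[of k] Ws[of k] by (simp add: V_def)
        then show ?thesis unfolding \<eta>_def d_def V_def[symmetric] by (simp add: field_simps)
      qed
      finally have "(1 + 1 / \<omega> 1) * (s k / ((1 + 1 / \<omega> 1) * \<omega> (4 * s k))) \<le> (1 + 1 / \<omega> 1) * (1600 * pi * \<eta> k)"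
        using o1 by (intro mult_left_mono) auto
      moreover have "(1 + 1 / \<omega> 1) * (s k / ((1 + 1 / \<omega> 1) * \<omega> (4 * s k))) = s k / \<omega> (4 * s k)"
      proof -
        have "1 + 1 / \<omega> 1 \<noteq> 0" using o1 by (smt (verit) divide_pos_pos)
        then show ?thesis by simp
      qed
      ultimately show "norm (s k / \<omega> (4 * s k)) \<le> C * \<eta> k" using w0 s1[of k] by (simp add: C_def mult_ac)
    qed
    then show False using condensed_divergence[OF pos' mono div sk sS] by simp
  qed
  interpret null_series M s \<sigma> W \<eta> P R \<psi> h
  proof unfold_locales
    show "4 / sqrt (real (M k)) \<le> \<sigma> k" for k
    proof -
      have s0: "0 < \<sigma> k" by (rule block(2))
      have "16 * (1 / (\<sigma> k)\<^sup>2) \<le> 16 * (E * s k)" by (intro mult_left_mono block(1)) auto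
      also have "\<dots> \<le> exp (s k)" by (rule S(3)[OF sS0])
      finally have "16 / exp (s k) \<le> (\<sigma> k)\<^sup>2" using s0 by (simp add: field_simps)
      then have "sqrt (16 / exp (s k)) \<le> \<sigma> k" using s0 by (intro real_le_lsqrt) auto
      then show ?thesis by (simp add: sM real_sqrt_divide)
    qed
    show "2 * real (M k) * (1 + 8 / (\<sigma> k)\<^sup>2) * exp (s k / 10) \<le> exp (2 * s k)" for k
    proof -
      have "1 + 8 / (\<sigma> k)\<^sup>2 \<le> 1 + 8 * (E * s k)" using block(1)[of k] by simp
      then have "real (M k) * (2 * (1 + 8 / (\<sigma> k)\<^sup>2) * exp (s k / 10)) \<le> real (M k) * (2 * (1 + 8 * (E * s k)) * exp (s k / 10))"
        by (intro mult_left_mono mult_right_mono) auto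
      also have "\<dots> \<le> real (M k) * exp (s k)" by (intro mult_left_mono S(2)[OF sS0]) auto
      also have "\<dots> = exp (2 * s k)" by (simp add: sM exp_add[symmetric])
      finally show ?thesis by (simp only: mult_ac)
    qed
    show "exp (s k / 10) * exp (- exp (s k)) \<le> exp (- W k)" for k
      using S(5)[OF sS0, of k] WB[of k] by (simp add: exp_add[symmetric])
    show "exp (- (exp (15 / 32 * s k) / 2)) * exp (2 * s k) \<le> exp (- W k)" for k
      using S(6)[OF sS0, of k] WB[of k] by (simp add: exp_add[symmetric])
    show "norm (\<psi> k 0) \<le> 1 - \<eta> k" for k using qk[of k] by (simp add: \<eta>_def)
  qed (use M1 sM sS sk block(2) qk \<eta>0 \<eta>div Ws S(4)[OF sS0] in \<open>auto\<close>)
  have decay: "norm (lc n) \<le> 3 * exp (- \<omega> (ln (real_of_int (- n))))" if n: "n < - \<lceil>exp (4 * s 0)\<rceil>" for n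
  proof -
    define t where "t = ln (real_of_int (- n))"
    have np: "exp (4 * s 0) < real_of_int (- n)" using n by linarith
    then have n0: "0 < real_of_int (- n)" using exp_gt_zero[of "4 * s 0"] by linarith
    have t0: "4 * s 0 < t" unfolding t_def using ln_less_cancel_iff[OF exp_gt_zero n0, of "4 * s 0"] np by (simp only: ln_exp)
    have et: "exp t = real_of_int (- n)" unfolding t_def using n0 by simp
    \<comment> \<open>Stage j is already small at n by its own weight, since |n| is at least the
      fourth power of the previous frequency; every later step i is small because \<omega> t <=
      \<omega> (4 s i).\<close>
    define j where "j = (LEAST j. t < 4 * s j)"
    have "\<exists>j. t < 4 * s j"
    proof -
      obtain j where "t < real j" using reals_Archimedean2 by blast
      moreover have "real j \<le> 4 * s j" using sk[of j] by (simp add: ring_distribs)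
      ultimately have "t < 4 * s j" by (rule less_le_trans)
      then show ?thesis by blast
    qed
    then have j: "t < 4 * s j" unfolding j_def by (rule LeastI_ex)
    have "j \<noteq> 0" using j t0 by (intro notI) simp
    then obtain k where k: "j = Suc k" by (cases j) auto
    have "k < j" using k by simp
    then have "\<not> t < 4 * s k" unfolding j_def by (rule not_less_Least)
    then have tk: "4 * s k \<le> t" by simp
    have t1: "1 \<le> t" using tk s1[of k] by linarith
    have tS: "S \<le> t" using tk sS0[of k] s1[of k] by linarith
    have first: "norm (cs j n) \<le> exp (- \<omega> t)"
    proof -
      have "3 * s k + \<omega> t \<le> t + A * t\<^sup>2" using ub[OF t1] tk s1[of k] by linarith
      also have "\<dots> \<le> exp (t / 4)" by (rule S(7)[OF tS])
      \<comment> \<open>Here 4 s k <= t leaves t / 4 of the exponent t / 2, which explains the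
        fourth power as threshold.\<close>
      also have "\<dots> \<le> exp (t / 2 - s k)" using tk by simp
      also have "\<dots> = exp (t / 2) * exp (- s k)" by (simp add: exp_add[symmetric])
      also have "exp (t / 2) = sqrt \<bar>real_of_int n\<bar>"
      proof -
        have "(exp (t / 2))\<^sup>2 = exp t" by (simp add: exp_double[symmetric])
        then have "sqrt (exp t) = exp (t / 2)" by (intro real_sqrt_unique) auto
        moreover have "exp t = \<bar>real_of_int n\<bar>" using et n0 by simp
        ultimately show ?thesis by simp
      qed
      finally have "3 * s k + - (sqrt \<bar>real_of_int n\<bar> * exp (- s k)) \<le> - \<omega> t" by linarith
      then have "exp (3 * s k) * exp (- (sqrt \<bar>real_of_int n\<bar> * exp (- s k))) \<le> exp (- \<omega> t)"
        by (simp only: exp_add[symmetric] exp_le_cancel_iff)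
      then show ?thesis using cs_right_decay[of k n] unfolding k by linarith
    qed
    have n': "n < 0" using n0 by simp
    have step: "norm (cs (Suc i) n - cs i n) \<le> exp (- \<omega> t) * (1 / 2) ^ i" if i: "j \<le> i" for i
    proof -
      have "s j \<le> s i"
        unfolding s_def using i lnM0 by (intro mult_right_mono power_increasing) auto
      then have "\<omega> t \<le> \<omega> (4 * s i)" using j t1 by (intro mono) auto
      \<comment> \<open>Of the surplus s i in W, one tenth pays for the norm and one twentieth is
        kept for the summation.\<close>
      then have "s i / 10 - W i \<le> - \<omega> t + - (s i / 20)" using s1[of i] by (simp add: W_def)
      then have "exp (s i / 10 - W i) \<le> exp (- \<omega> t + - (s i / 20))" by (simp only: exp_le_cancel_iff)
      also have "\<dots> = exp (- \<omega> t) * exp (- s i / 20)" by (simp add: exp_add[symmetric])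
      also have "\<dots> \<le> exp (- \<omega> t) * (1 / 2) ^ (i + 2)" by (intro mult_left_mono small_steps) auto
      finally have "3 * exp (s i / 10 - W i) \<le> exp (- \<omega> t) * (1 / 2) ^ i * (3 / 4)" by (simp add: power_add)
      also have "\<dots> \<le> exp (- \<omega> t) * (1 / 2) ^ i" by simp
      finally show ?thesis using cs_left_step[OF n', of i] by linarith
    qed
    \<comment> \<open>The bound starts at 1 and the geometric steps add at most 2, whence the
      constant 3.\<close>
    have tail: "norm (cs (j + m) n) \<le> exp (- \<omega> t) * (3 - 2 * (1 / 2) ^ m)" for m
    proof (induction m)
      case 0 then show ?case using first by simp
    next
      case (Suc m)
      have "norm (cs (j + Suc m) n) \<le> norm (cs (Suc (j + m)) n - cs (j + m) n) + norm (cs (j + m) n)"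
        using norm_triangle_ineq[of "cs (Suc (j + m)) n - cs (j + m) n" "cs (j + m) n"] by (simp del: cs.simps)
      also have "\<dots> \<le> exp (- \<omega> t) * (1 / 2) ^ (j + m) + exp (- \<omega> t) * (3 - 2 * (1 / 2) ^ m)"
        by (intro add_mono step Suc) simp
      also have "\<dots> \<le> exp (- \<omega> t) * (1 / 2) ^ m + exp (- \<omega> t) * (3 - 2 * (1 / 2) ^ m)"
        by (intro add_right_mono mult_left_mono power_decreasing) auto
      also have "\<dots> = exp (- \<omega> t) * (3 - 2 * (1 / 2) ^ Suc m)" by (simp add: algebra_simps)
      finally show ?case .
    qed
    have "(\<lambda>m. norm (cs (m + j) n)) \<longlonglongrightarrow> norm (lc n)"
      by (intro tendsto_norm LIMSEQ_ignore_initial_segment cs_lim)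
    then have "norm (lc n) \<le> 3 * exp (- \<omega> t)"
    proof (rule LIMSEQ_le_const2)
      have "norm (cs (m + j) n) \<le> 3 * exp (- \<omega> t)" for m
      proof -
        have "exp (- \<omega> t) * (3 - 2 * (1 / 2) ^ m) \<le> exp (- \<omega> t) * 3" by (intro mult_left_mono) auto
        then show ?thesis using tail[of m] unfolding add.commute[of m j] by linarith
      qed
      then show "\<exists>N. \<forall>m\<ge>N. norm (cs (m + j) n) \<le> 3 * exp (- \<omega> t)" by blast
    qed
    then show ?thesis by (simp add: t_def)
  qed
  have ae: "AE t in lborel. (\<lambda>N::nat. \<Sum>n\<in>{- int N..int N}. lc n * exp (\<i> * of_int n * of_real t)) \<longlonglongrightarrow> 0"
    using AE_converges by (simp add: cis_conv_exp mult.assoc)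
  show ?thesis
    by (intro exI[of _ lc] conjI ae) (use lc_nonzero decay in blast)+
qed

end
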